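(* Given an imprecise 1.5D terrain with $n$ vertical intervals, the discrete optimistic shortest watchtower problem (minimize, over all realizations $T$ of the imprecise terrain and all watchtowers of $T$ whose base is a vertex of $T$, the height of the watchtower) can be solved exactly in $O(n)$ time.
   Context: An imprecise 1.5D terrain is given by $n$ closed vertical intervals $\ell_1,\dots,\ell_n$ in the plane with fixed $x$-coordinates $x_1<\dots<x_n$; $t_i$ and $b_i$ denote the top and bottom endpoints of $\ell_i$. A realization is obtained by choosing a point (vertex) $v_i\in\ell_i$ for each $i$; it is the $x$-monotone polyline $T$ with vertices $v_1,\dots,v_n$ and edges $v_iv_{i+1}$. Two points $p,q$ on or above $T$ are visible to each other (see each other) if the segment $\overline{pq}$ lies above $T$ (touching $T$ is allowed). A point $w$ guards (sees) $T$ if every point of $T$ is visible from $w$. A watchtower for $T$ is a vertical line segment $\overline{uw}$ whose lower endpoint $u$ (the base) lies on $T$ and whose upper endpoint $w$ (the top) guards $T$; its height is $|uw|$. In the discrete version the base must be a vertex of $T$. *)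

theory Defs
  imports "HOL-Analysis.Analysis" "HOL-Library.Landau_Symbols"
begin

section \<open>Imprecise terrains, visibility and watchtowers\<close>

text \<open>
  An imprecise terrain with \<open>n\<close> intervals is given by \<open>x\<close>, \<open>b\<close>, \<open>t\<close>, of which only the values
  at the indices \<open>0, \<dots>, n - 1\<close> matter: the interval with index \<open>i\<close> is \<open>{x i} \<times> {b i..t i}\<close>.
\<close>

definition imprecise_terrain ::
  "nat \<Rightarrow> (nat \<Rightarrow> real) \<Rightarrow> (nat \<Rightarrow> real) \<Rightarrow> (nat \<Rightarrow> real) \<Rightarrow> bool" where
  "imprecise_terrain n x b t \<longleftrightarrow>
     1 \<le> n \<and> strict_mono_on {..<n} x \<and> (\<forall>i<n. b i \<le> t i)"

definition realization :: "nat \<Rightarrow> (nat \<Rightarrow> real) \<Rightarrow> (nat \<Rightarrow> real) \<Rightarrow> (nat \<Rightarrow> real) \<Rightarrow> bool" where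
  "realization n b t v \<longleftrightarrow> (\<forall>i<n. v i \<in> {b i..t i})"

definition vertices :: "nat \<Rightarrow> (nat \<Rightarrow> real) \<Rightarrow> (nat \<Rightarrow> real) \<Rightarrow> (real \<times> real) set" where
  "vertices n x v = (\<lambda>i. (x i, v i)) ` {..<n}"

text \<open>The vertices are included separately for the sake of the one-vertex polyline.\<close>

definition terrain :: "nat \<Rightarrow> (nat \<Rightarrow> real) \<Rightarrow> (nat \<Rightarrow> real) \<Rightarrow> (real \<times> real) set" where
  "terrain n x v =
     vertices n x v \<union> (\<Union>i\<in>{i. Suc i < n}. closed_segment (x i, v i) (x (Suc i), v (Suc i)))"

definition on_or_above :: "(real \<times> real) set \<Rightarrow> real \<times> real \<Rightarrow> bool" where
  "on_or_above T p \<longleftrightarrow> (\<exists>y. (fst p, y) \<in> T \<and> y \<le> snd p)"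

definition visible :: "(real \<times> real) set \<Rightarrow> real \<times> real \<Rightarrow> real \<times> real \<Rightarrow> bool" where
  "visible T p q \<longleftrightarrow> (\<forall>r\<in>closed_segment p q. on_or_above T r)"

definition guards :: "(real \<times> real) set \<Rightarrow> real \<times> real \<Rightarrow> bool" where
  "guards T w \<longleftrightarrow> (\<forall>p\<in>T. visible T w p)"

definition watchtower :: "(real \<times> real) set \<Rightarrow> real \<times> real \<Rightarrow> real \<times> real \<Rightarrow> bool" where
  "watchtower T u w \<longleftrightarrow> u \<in> T \<and> fst w = fst u \<and> snd u \<le> snd w \<and> guards T w"

definition discrete_watchtower ::
  "nat \<Rightarrow> (nat \<Rightarrow> real) \<Rightarrow> (nat \<Rightarrow> real) \<Rightarrow> real \<times> real \<Rightarrow> real \<times> real \<Rightarrow> bool" where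
  "discrete_watchtower n x v u w \<longleftrightarrow> u \<in> vertices n x v \<and> watchtower (terrain n x v) u w"

definition optimistic_shortest_discrete_watchtower ::
  "nat \<Rightarrow> (nat \<Rightarrow> real) \<Rightarrow> (nat \<Rightarrow> real) \<Rightarrow> (nat \<Rightarrow> real) \<Rightarrow>
   (nat \<Rightarrow> real) \<Rightarrow> real \<times> real \<Rightarrow> real \<times> real \<Rightarrow> bool" where
  "optimistic_shortest_discrete_watchtower n x b t v u w \<longleftrightarrow>
     realization n b t v \<and> discrete_watchtower n x v u w \<and>
     (\<forall>v' u' w'. realization n b t v' \<longrightarrow> discrete_watchtower n x v' u' w' \<longrightarrow>
        dist u w \<le> dist u' w')"


section \<open>The real RAM\<close>

text \<open>
  A structured real RAM.  Memory consists of index (natural number) and real variables and of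
  unbounded index and real arrays, addressed by name.  Real arithmetic is exact and consists of the
  four field operations; there is no rounding, no root extraction and no conversion between indices
  and reals.  Index arithmetic is successor and predecessor only, so that every index computed
  within \<open>T\<close> steps on an input of size \<open>n\<close> is at most \<open>n + O(T)\<close>: unit cost per index operation
  does not allow any hidden computation on large integers.
\<close>

type_synonym name = string

datatype iexp = IConst nat | IVar name | IArr name iexp | Inc iexp | Dec iexp

datatype rexp =
    RConst int | RVar name | RArr name iexp
  | Plus rexp rexp | Minus rexp rexp | Times rexp rexp | Divide rexp rexp

datatype bexp = ILess iexp iexp | RLess rexp rexp | BNot bexp | BAnd bexp bexp

datatype com =
    Skip
  | IAssign name iexp
  | RAssign name rexp
  | IStore name iexp iexp
  | RStore name iexp rexp
  | Seq com com
  | Cond bexp com com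
  | While bexp com

record state =
  ivar :: "name \<Rightarrow> nat"
  rvar :: "name \<Rightarrow> real"
  iarr :: "name \<Rightarrow> nat \<Rightarrow> nat"
  rarr :: "name \<Rightarrow> nat \<Rightarrow> real"

primrec ival :: "iexp \<Rightarrow> state \<Rightarrow> nat" where
  "ival (IConst k) s = k"
| "ival (IVar a) s = ivar s a"
| "ival (IArr a e) s = iarr s a (ival e s)"
| "ival (Inc e) s = ival e s + 1"
| "ival (Dec e) s = ival e s - 1"

primrec rval :: "rexp \<Rightarrow> state \<Rightarrow> real" where
  "rval (RConst k) s = of_int k"
| "rval (RVar a) s = rvar s a"
| "rval (RArr a e) s = rarr s a (ival e s)"
| "rval (Plus e f) s = rval e s + rval f s"
| "rval (Minus e f) s = rval e s - rval f s"
| "rval (Times e f) s = rval e s * rval f s"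
| "rval (Divide e f) s = rval e s / rval f s"

primrec bval :: "bexp \<Rightarrow> state \<Rightarrow> bool" where
  "bval (ILess e f) s \<longleftrightarrow> ival e s < ival f s"
| "bval (RLess e f) s \<longleftrightarrow> rval e s < rval f s"
| "bval (BNot c) s \<longleftrightarrow> \<not> bval c s"
| "bval (BAnd c d) s \<longleftrightarrow> bval c s \<and> bval d s"

text \<open>Every node of an expression costs one step, whether it is a memory access or an operation.\<close>

primrec icost :: "iexp \<Rightarrow> nat" where
  "icost (IConst k) = 1"
| "icost (IVar a) = 1"
| "icost (IArr a e) = icost e + 1"
| "icost (Inc e) = icost e + 1"
| "icost (Dec e) = icost e + 1"

primrec rcost :: "rexp \<Rightarrow> nat" where
  "rcost (RConst k) = 1"
| "rcost (RVar a) = 1"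
| "rcost (RArr a e) = icost e + 1"
| "rcost (Plus e f) = rcost e + rcost f + 1"
| "rcost (Minus e f) = rcost e + rcost f + 1"
| "rcost (Times e f) = rcost e + rcost f + 1"
| "rcost (Divide e f) = rcost e + rcost f + 1"

primrec bcost :: "bexp \<Rightarrow> nat" where
  "bcost (ILess e f) = icost e + icost f + 1"
| "bcost (RLess e f) = rcost e + rcost f + 1"
| "bcost (BNot c) = bcost c + 1"
| "bcost (BAnd c d) = bcost c + bcost d + 1"

text \<open>
  \<open>exec c s T s'\<close>: started in state \<open>s\<close>, the program \<open>c\<close> halts after exactly \<open>T\<close> steps in
  state \<open>s'\<close>.
\<close>

inductive exec :: "com \<Rightarrow> state \<Rightarrow> nat \<Rightarrow> state \<Rightarrow> bool" where
  Skip: "exec Skip s 1 s"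
| IAssign: "exec (IAssign a e) s (icost e + 1) (s\<lparr>ivar := (ivar s)(a := ival e s)\<rparr>)"
| RAssign: "exec (RAssign a e) s (rcost e + 1) (s\<lparr>rvar := (rvar s)(a := rval e s)\<rparr>)"
| IStore: "exec (IStore a i e) s (icost i + icost e + 1)
    (s\<lparr>iarr := (iarr s)(a := (iarr s a)(ival i s := ival e s))\<rparr>)"
| RStore: "exec (RStore a i e) s (icost i + rcost e + 1)
    (s\<lparr>rarr := (rarr s)(a := (rarr s a)(ival i s := rval e s))\<rparr>)"
| Seq: "exec c s T s' \<Longrightarrow> exec d s' U s'' \<Longrightarrow> exec (Seq c d) s (T + U) s''"
| CondTrue: "bval g s \<Longrightarrow> exec c s T s' \<Longrightarrow> exec (Cond g c d) s (bcost g + 1 + T) s'"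
| CondFalse: "\<not> bval g s \<Longrightarrow> exec d s T s' \<Longrightarrow> exec (Cond g c d) s (bcost g + 1 + T) s'"
| WhileFalse: "\<not> bval g s \<Longrightarrow> exec (While g c) s (bcost g + 1) s"
| WhileTrue: "bval g s \<Longrightarrow> exec c s T s' \<Longrightarrow> exec (While g c) s' U s'' \<Longrightarrow>
    exec (While g c) s (bcost g + 1 + T + U) s''"

lemma exec_deterministic:
  "exec c s T s' \<Longrightarrow> exec c s U s'' \<Longrightarrow> T = U \<and> s' = s''"
proof (induction arbitrary: U s'' rule: exec.induct)
  case (WhileFalse g s c)
  from WhileFalse.prems WhileFalse.hyps show ?case
    by (cases rule: exec.cases) simp_all
next
  case (WhileTrue g s c T s1 V s2)
  from WhileTrue.prems WhileTrue.hyps(1) obtain T' s1' V' where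
    "U = bcost g + 1 + T' + V'" "exec c s T' s1'" "exec (While g c) s1' V' s''"
    by (cases rule: exec.cases) simp_all
  with WhileTrue.IH show ?case by blast
next
  case (Seq c s T s1 d V s2)
  from Seq.prems obtain T' s1' V' where
    "U = T' + V'" "exec c s T' s1'" "exec d s1' V' s''"
    by (cases rule: exec.cases) simp_all
  with Seq.IH show ?case by blast
next
  case (CondTrue g s c T s1 d)
  from CondTrue.prems CondTrue.hyps obtain T' where
    "U = bcost g + 1 + T'" "exec c s T' s''"
    by (cases rule: exec.cases) simp_all
  with CondTrue.IH show ?case by blast
next
  case (CondFalse g s d T s1 c)
  from CondFalse.prems CondFalse.hyps obtain T' where
    "U = bcost g + 1 + T'" "exec d s T' s''"
    by (cases rule: exec.cases) simp_all
  with CondFalse.IH show ?case by blast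
qed (erule exec.cases; simp)+


section \<open>Solving the watchtower problem on the real RAM\<close>

text \<open>
  The input is the number of intervals and three real arrays of that length; all other memory cells
  hold zero initially.
\<close>

definition input_state ::
  "nat \<Rightarrow> (nat \<Rightarrow> real) \<Rightarrow> (nat \<Rightarrow> real) \<Rightarrow> (nat \<Rightarrow> real) \<Rightarrow> state" where
  "input_state n x b t =
     \<lparr>ivar = (\<lambda>_. 0)(''n'' := n),
      rvar = (\<lambda>_. 0),
      iarr = (\<lambda>_ _. 0),
      rarr = (\<lambda>_ _. 0)(''x'' := (\<lambda>i. if i < n then x i else 0),
                       ''b'' := (\<lambda>i. if i < n then b i else 0),
                       ''t'' := (\<lambda>i. if i < n then t i else 0))\<rparr>"

text \<open>
  The output consists of the vertex heights \<open>v\<close> of an optimal realization, the index \<open>k\<close> of the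
  vertex at the base of an optimal watchtower, the ordinate \<open>w\<close> of its top, and its height \<open>h\<close>,
  the minimum.
\<close>

definition solved ::
  "nat \<Rightarrow> (nat \<Rightarrow> real) \<Rightarrow> (nat \<Rightarrow> real) \<Rightarrow> (nat \<Rightarrow> real) \<Rightarrow> state \<Rightarrow> bool" where
  "solved n x b t s \<longleftrightarrow>
     (let v = rarr s ''v''; k = ivar s ''k''; u = (x k, v k); w = (x k, rvar s ''w'')
      in k < n \<and> optimistic_shortest_discrete_watchtower n x b t v u w \<and>
         rvar s ''h'' = dist u w)"

end

theory Submission
  imports Defs
begin

text \<open>
  For a top \<open>(x k, h)\<close> over the vertex \<open>k\<close>, visibility of the whole terrain means that the slopes from
  the top to the vertices increase outwards.  Such vertices can be chosen in the intervals iff \<open>h\<close> is at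
  least the height over \<open>x k\<close> of every \<^emph>\<open>bridge\<close>, the line through the bottom of an interval \<open>i\<close> and the
  top of an interval \<open>j\<close> farther out than \<open>i\<close>.  If \<open>H k\<close> is the largest such height, the shortest tower over
  \<open>k\<close> has height \<open>max 0 (H k - t k)\<close>, and a realization is found by a prefix maximum of slopes.

  To compute the bridges to the right in linear time, scan the intervals from right to left.  Of the
  bridges starting at \<open>i\<close> only the one of least slope matters; it lies below all tops to its right, so it may
  be used for every \<open>k\<close>, and it is dominated by an earlier bridge unless its slope is a new minimum.  New
  minima are found with a pointer to the top that is lowest in the direction of the current slope: it
  stays on the lower hull of the tops and only moves to the left between insertions.  The slopes of the
  remaining lines are monotone, so their upper envelope is, dually, again a lower hull built by
  insertions at one end; it is queried at increasing abscissas.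
\<close>

text \<open>Why bridges decide: for a fixed top, the lowest admissible vertices follow the running
  maximum of the slopes to the bottoms. Such a vertex overshoots its interval exactly when the
  bottom of an interval nearer to the tower lies above the segment from the tower's top to a top
  endpoint, that is, when a bridge passes above the tower's top. The base itself can be raised to
  \<open>min (t k) (H k)\<close> without hiding anything.

  The obstacle to linear time is that a single hull search may be long. All searches are paid from
  potentials of 40 steps per hull vertex: an insertion passes only vertices that it deletes; the
  pointer passes only vertices to its left, and an insertion adds at most one of these; a query
  passes only vertices that no later query needs. This requires the pointer to survive insertions: a
  deleted top would have to be replaced as the lowest one by the new top. The numerical constants
  are generous roundings.\<close>

section \<open>Weakest preconditions with a time budget\<close>

text \<open>The budget \<open>u\<close> is an integer, so that exact costs can be subtracted without
  truncation; \<open>Q\<close> receives what is left, and nonnegativity is demanded only by loop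
  invariants and at the end.\<close>

definition wp :: "com \<Rightarrow> (int \<Rightarrow> state \<Rightarrow> bool) \<Rightarrow> int \<Rightarrow> state \<Rightarrow> bool" where
  "wp c Q u s \<longleftrightarrow> (\<exists>T s'. exec c s T s' \<and> Q (u - int T) s')"

inductive_cases exec_elims:
  "exec Skip s T s'" "exec (IAssign a e) s T s'" "exec (RAssign a f) s T s'"
  "exec (IStore a i e) s T s'" "exec (RStore a i f) s T s'" "exec (Seq c d) s T s'"
  "exec (Cond g c d) s T s'"

lemma wp_simps [simp]:
  "wp Skip Q u s \<longleftrightarrow> Q (u - 1) s"
  "wp (IAssign a e) Q u s \<longleftrightarrow>
    Q (u - int (icost e + 1)) (s\<lparr>ivar := (ivar s)(a := ival e s)\<rparr>)"
  "wp (RAssign a f) Q u s \<longleftrightarrow>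
    Q (u - int (rcost f + 1)) (s\<lparr>rvar := (rvar s)(a := rval f s)\<rparr>)"
  "wp (IStore a i e) Q u s \<longleftrightarrow> Q (u - int (icost i + icost e + 1))
    (s\<lparr>iarr := (iarr s)(a := (iarr s a)(ival i s := ival e s))\<rparr>)"
  "wp (RStore a i f) Q u s \<longleftrightarrow> Q (u - int (icost i + rcost f + 1))
    (s\<lparr>rarr := (rarr s)(a := (rarr s a)(ival i s := rval f s))\<rparr>)"
  unfolding wp_def by (force intro: exec.intros elim: exec_elims)+

lemma wp_Seq [simp]: "wp (Seq c d) Q = wp c (wp d Q)"
proof (intro ext iffI)
  fix u s assume "wp (Seq c d) Q u s"
  then show "wp c (wp d Q) u s"
    unfolding wp_def by (force elim!: exec_elims simp: algebra_simps)
next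
  fix u s assume "wp c (wp d Q) u s"
  then obtain T s' U s'' where "exec c s T s'" "exec d s' U s''" "Q (u - int T - int U) s''"
    unfolding wp_def by blast
  then show "wp (Seq c d) Q u s"
    unfolding wp_def by (intro exI[of _ "T + U"] exI[of _ s'']) (auto intro: exec.Seq simp: algebra_simps)
qed

lemma wp_Cond [simp]:
  "wp (Cond g c d) Q u s \<longleftrightarrow>
    (if bval g s then wp c Q (u - int (bcost g + 1)) s else wp d Q (u - int (bcost g + 1)) s)"
proof
  assume "wp (Cond g c d) Q u s"
  then show "if bval g s then wp c Q (u - int (bcost g + 1)) s else wp d Q (u - int (bcost g + 1)) s"
    unfolding wp_def by (fastforce elim!: exec_elims simp: algebra_simps)
next
  assume "if bval g s then wp c Q (u - int (bcost g + 1)) s else wp d Q (u - int (bcost g + 1)) s"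
  then obtain T s' where
    "bval g s \<Longrightarrow> exec c s T s'" "\<not> bval g s \<Longrightarrow> exec d s T s'"
    "Q (u - int (bcost g + 1) - int T) s'"
    unfolding wp_def by (auto split: if_splits)
  moreover have "exec (Cond g c d) s (bcost g + 1 + T) s'"
    using calculation(1,2) exec.CondTrue exec.CondFalse by blast
  ultimately show "wp (Cond g c d) Q u s"
    unfolding wp_def by (intro exI[of _ "bcost g + 1 + T"] exI[of _ s']) (auto simp: algebra_simps)
qed

text \<open>Since every iteration spends part of the budget, a budget that stays nonnegative also yields
  termination.\<close>

lemma wp_While:
  assumes "I u s"
    and nonneg: "\<And>u s. I u s \<Longrightarrow> 0 \<le> u"
    and step: "\<And>u s. I u s \<Longrightarrow> bval g s \<Longrightarrow> wp c I (u - int (bcost g + 1)) s"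
    and exit: "\<And>u s. I u s \<Longrightarrow> \<not> bval g s \<Longrightarrow> Q (u - int (bcost g + 1)) s"
  shows "wp (While g c) Q u s"
  using \<open>I u s\<close>
proof (induction "nat u" arbitrary: u s rule: less_induct)
  case less
  show ?case
  proof (cases "bval g s")
    case True
    then obtain T s' where s': "exec c s T s'" "I (u - int (bcost g + 1) - int T) s'"
      using step[OF less.prems] unfolding wp_def by auto
    have "wp (While g c) Q (u - int (bcost g + 1) - int T) s'"
      by (rule less.hyps[OF _ s'(2)]) (use nonneg[OF s'(2)] in linarith)
    then obtain U s'' where "exec (While g c) s' U s''"
      "Q (u - int (bcost g + 1) - int T - int U) s''"
      unfolding wp_def by auto
    moreover from this have "exec (While g c) s (bcost g + 1 + T + U) s''"
      using exec.WhileTrue[OF True s'(1)] by blast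
    ultimately show ?thesis
      unfolding wp_def
      by (intro exI[of _ "bcost g + 1 + T + U"] exI[of _ s'']) (auto simp: algebra_simps)
  next
    case False
    then show ?thesis
      unfolding wp_def using exit[OF less.prems False] exec.WhileFalse[OF False] by blast
  qed
qed

lemma wp_mono:
  "wp c Q u s \<Longrightarrow> (\<And>u s. Q u s \<Longrightarrow> R u s) \<Longrightarrow> wp c R u s"
  unfolding wp_def by blast

section \<open>Lower convex hulls\<close>

text \<open>For \<open>X v < X q\<close>: point \<open>j\<close> is not below the line through the
  points \<open>v\<close> and \<open>q\<close>, multiplied out so that later arguments are
  polynomial.\<close>

definition supports :: "(nat \<Rightarrow> real) \<Rightarrow> (nat \<Rightarrow> real) \<Rightarrow> nat \<Rightarrow> nat \<Rightarrow> nat \<Rightarrow> bool" where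
  "supports X T v q j \<longleftrightarrow> (T q - T v) * (X j - X v) \<le> (T j - T v) * (X q - X v)"

definition slope :: "real \<Rightarrow> real \<Rightarrow> (nat \<Rightarrow> real) \<Rightarrow> (nat \<Rightarrow> real) \<Rightarrow> nat \<Rightarrow> real" where
  "slope a y X T j = (T j - y) / (X j - a)"

lemma slope_le_iff:
  assumes "a < X u" "a < X v"
  shows "slope a y X T u \<le> slope a y X T v \<longleftrightarrow> (T u - y) * (X v - a) \<le> (T v - y) * (X u - a)"
  using assms unfolding slope_def by (simp add: field_simps)

text \<open>The recurring way to close a nonlinear inequality: \<open>r\<close> is a certificate
  built from nonnegative factors, and after scaling by \<open>c\<close> only a comparison of
  monomials remains.\<close>

lemma le_by_mult_diff:
  fixes p q c r :: real
  assumes "0 < c" "r \<le> (q - p) * c" "0 \<le> r"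
  shows "p \<le> q"
  using assms by (smt (verit) mult_neg_pos)

text \<open>The comparison of slopes puts the viewpoint \<open>(a, y)\<close> on or below the line
  through \<open>v\<close> and \<open>q\<close>. Seen from there, slopes along the line fall to the
  right, and \<open>j\<close> lies on or above the line. In \<open>slope_edge_right\<close> the
  viewpoint is on or above the line and slopes rise.\<close>

lemma slope_edge_left:
  assumes "supports X T v q j" "a < X v" "X v < X q" "a < X j" "X j \<le> X q"
    and "slope a y X T q \<le> slope a y X T v"
  shows "slope a y X T q \<le> slope a y X T j"
proof -
  have 1: "(T q - y) * (X v - a) \<le> (T v - y) * (X q - a)"
    using assms by (subst slope_le_iff[symmetric]) auto
  have 2: "(X q - a) * ((T q - T v) * (X j - X v)) \<le> (X q - a) * ((T j - T v) * (X q - X v))"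
    using assms unfolding supports_def by (intro mult_left_mono) auto
  have 3: "0 \<le> (X q - X j) * ((T v - y) * (X q - a) - (T q - y) * (X v - a))"
    using assms 1 by (intro mult_nonneg_nonneg) auto
  have "(T q - y) * (X j - a) \<le> (T j - y) * (X q - a)"
    by (rule le_by_mult_diff[of "X q - X v", OF _ _ 3]) (use assms 2 in \<open>auto simp: algebra_simps\<close>)
  then show ?thesis
    using assms by (subst slope_le_iff) auto
qed

lemma slope_edge_right:
  assumes "supports X T v q j" "a < X v" "X v < X q" "X v \<le> X j"
    and "slope a y X T v \<le> slope a y X T q"
  shows "slope a y X T v \<le> slope a y X T j"
proof -
  have 1: "(T v - y) * (X q - a) \<le> (T q - y) * (X v - a)"
    using assms by (subst slope_le_iff[symmetric]) auto
  have 2: "(X v - a) * ((T q - T v) * (X j - X v)) \<le> (X v - a) * ((T j - T v) * (X q - X v))"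
    using assms unfolding supports_def by (intro mult_left_mono) auto
  have 3: "0 \<le> (X j - X v) * ((T q - y) * (X v - a) - (T v - y) * (X q - a))"
    using assms 1 by (intro mult_nonneg_nonneg) auto
  have "(T v - y) * (X j - a) \<le> (T j - y) * (X v - a)"
    by (rule le_by_mult_diff[of "X q - X v", OF _ _ 3]) (use assms 2 in \<open>auto simp: algebra_simps\<close>)
  then show ?thesis
    using assms by (subst slope_le_iff) auto
qed

text \<open>The analogue of \<open>slope_edge_left\<close> for parallel sight lines:
  \<open>T j - X j * y\<close> is the intercept of the line of slope \<open>y\<close> through point
  \<open>j\<close>.\<close>

lemma direction_edge_left:
  fixes y :: real
  assumes "supports X T v q j" "X v < X q" "X j \<le> X q" "T q - X q * y \<le> T v - X v * y"
  shows "T q - X q * y \<le> T j - X j * y"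
proof -
  have 3: "0 \<le> (X q - X j) * ((T v - X v * y) - (T q - X q * y))"
    using assms by (intro mult_nonneg_nonneg) auto
  show ?thesis
    by (rule le_by_mult_diff[of "X q - X v", OF _ _ 3])
      (use assms in \<open>auto simp: algebra_simps supports_def\<close>)
qed

lemma direction_edge_right:
  fixes y :: real
  assumes "supports X T v q j" "X v < X q" "X v \<le> X j" "T v - X v * y \<le> T q - X q * y"
  shows "T v - X v * y \<le> T j - X j * y"
proof -
  have 3: "0 \<le> (X j - X v) * ((T q - X q * y) - (T v - X v * y))"
    using assms by (intro mult_nonneg_nonneg) auto
  show ?thesis
    by (rule le_by_mult_diff[of "X q - X v", OF _ _ 3])
      (use assms in \<open>auto simp: algebra_simps supports_def\<close>)
qed

text \<open>\<open>A\<close> is the vertex set of the lower hull of the points \<open>(X j, T j)\<close> with \<open>lo \<le> j < n\<close>, and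
  \<open>N\<close> and \<open>P\<close> link every vertex with its right and left neighbour.\<close>

definition lower_hull ::
  "(nat \<Rightarrow> real) \<Rightarrow> (nat \<Rightarrow> real) \<Rightarrow> nat \<Rightarrow> nat \<Rightarrow> (nat \<Rightarrow> nat) \<Rightarrow> (nat \<Rightarrow> nat) \<Rightarrow> nat set \<Rightarrow> bool" where
  "lower_hull X T lo n N P A \<longleftrightarrow>
    A \<subseteq> {lo..<n} \<and> lo \<in> A \<and> n - 1 \<in> A \<and> N (n - 1) = n \<and>
    (\<forall>v\<in>A. Suc v < n \<longrightarrow> N v \<in> A \<and> v < N v \<and> (\<forall>u\<in>A. v < u \<longrightarrow> N v \<le> u) \<and>
       (\<forall>j\<in>{lo..<n}. supports X T v (N v) j)) \<and>
    (\<forall>q\<in>A. lo < q \<longrightarrow> P q \<in> A \<and> P q < q \<and> N (P q) = q)"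

lemma lower_hull_singleton:
  assumes "1 \<le> n" "N (n - 1) = n"
  shows "lower_hull X T (n - 1) n N P {n - 1}"
  using assms unfolding lower_hull_def by auto

text \<open>\<open>a\<close> is the point of tangency seen from the new leftmost point
  \<open>i\<close>; hull vertices left of \<open>a\<close> disappear. Old edges from
  \<open>a\<close> onwards survive because \<open>i\<close> lies on or above their lines.\<close>

lemma lower_hull_insert:
  assumes hull: "lower_hull X T (Suc i) n N P A" and n: "Suc i < n"
    and X: "strict_mono_on {i..<n} X" and a: "a \<in> A"
    and min: "\<And>j. i < j \<Longrightarrow> j < n \<Longrightarrow> slope (X i) (T i) X T a \<le> slope (X i) (T i) X T j"
  shows "lower_hull X T i n (N(i := a)) (P(a := i)) (insert i {v \<in> A. a \<le> v})"
proof -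
  have lt: "X u < X v" if "i \<le> u" "u < v" "v < n" for u v
    using strict_mono_onD[OF X, of u v] that by auto
  have A: "A \<subseteq> {Suc i..<n}" and N1: "N (n - 1) = n" and n1: "n - 1 \<in> A"
    and N: "\<And>v. v \<in> A \<Longrightarrow> Suc v < n \<Longrightarrow> N v \<in> A \<and> v < N v \<and> (\<forall>u\<in>A. v < u \<longrightarrow> N v \<le> u) \<and>
       (\<forall>j\<in>{Suc i..<n}. supports X T v (N v) j)"
    and P: "\<And>q. q \<in> A \<Longrightarrow> Suc i < q \<Longrightarrow> P q \<in> A \<and> P q < q \<and> N (P q) = q"
    using hull unfolding lower_hull_def by auto
  have ai: "i < a" "a < n" and iA: "i \<notin> A" using A a by auto
  have sup_new: "supports X T i a j" if "i \<le> j" "j < n" for j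
  proof (cases "j = i")
    case False
    then have "slope (X i) (T i) X T a \<le> slope (X i) (T i) X T j" using that min by auto
    then show ?thesis using that False ai
      by (subst (asm) slope_le_iff) (auto simp: supports_def lt)
  qed (simp add: supports_def)
  have sup_old: "supports X T v (N v) i" if v: "v \<in> A" "a \<le> v" "Suc v < n" for v
  proof -
    let ?q = "N v"
    have q: "?q \<in> A" "v < ?q" "supports X T v ?q a" using N[of v] v a A by auto
    then have qn: "?q < n" using A by auto
    have Xv: "X i < X v" "X v < X ?q" "X i < X ?q" "X i < X a" using lt v q ai qn A by auto
    have "slope (X i) (T i) X T v \<le> slope (X i) (T i) X T ?q"
    proof (cases "v = a")
      case True
      then show ?thesis using min[of ?q] q qn ai by auto
    next
      \<comment> \<open>Here \<open>a\<close> is on or above the line of the edge but on or below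
        the segment from \<open>i\<close> to \<open>v\<close>. Both lines pass through
        \<open>v\<close>, so further left \<open>i\<close> is on or above the line of the edge as
        well.\<close>
      case False
      then have av: "X a < X v" using lt v ai by auto
      have 1: "(T a - T i) * (X v - X i) \<le> (T v - T i) * (X a - X i)"
        using min[of v] v ai Xv slope_le_iff[of "X i" X a v "T i" T] by auto
      have 2: "(X v - X i) * ((T ?q - T v) * (X a - X v)) \<le> (X v - X i) * ((T a - T v) * (X ?q - X v))"
        using q Xv unfolding supports_def by (intro mult_left_mono) auto
      have 3: "0 \<le> (X ?q - X v) * ((T v - T i) * (X a - X i) - (T a - T i) * (X v - X i))"
        using 1 Xv by (intro mult_nonneg_nonneg) auto
      have "(T v - T i) * (X ?q - X i) \<le> (T ?q - T i) * (X v - X i)"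
        by (rule le_by_mult_diff[of "X v - X a", OF _ _ 3]) (use av 2 in \<open>auto simp: algebra_simps\<close>)
      then show ?thesis using Xv by (subst slope_le_iff) auto
    qed
    then have "(T v - T i) * (X ?q - X i) \<le> (T ?q - T i) * (X v - X i)"
      using Xv by (subst (asm) slope_le_iff) auto
    then show ?thesis unfolding supports_def by (simp add: algebra_simps)
  qed
  show ?thesis
    unfolding lower_hull_def
  proof (intro conjI ballI impI)
    fix v j assume v: "v \<in> insert i {v \<in> A. a \<le> v}" "Suc v < n" and "j \<in> {i..<n}"
    then show "supports X T v ((N(i := a)) v) j"
      using sup_new sup_old[of v] N[of v] iA by (cases "j = i"; cases "v = i") auto
  next
    fix q assume q: "q \<in> insert i {v \<in> A. a \<le> v}" "i < q"
    then have qA: "q \<in> A" "a \<le> q" by auto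
    have *: "P q \<in> A \<and> a \<le> P q \<and> P q < q \<and> N (P q) = q" if "q \<noteq> a"
    proof -
      have Pq: "P q \<in> A" "P q < q" "N (P q) = q" using P[of q] qA that A a by force+
      \<comment> \<open>Otherwise \<open>a\<close> would lie strictly between \<open>P q\<close> and
        its right neighbour \<open>q\<close>.\<close>
      then have "a \<le> P q" using N[of "P q"] a qA that A by (metis Suc_lessI atLeastLessThan_iff leI le_antisym less_trans_Suc subsetD)
      then show ?thesis using Pq by auto
    qed
    show "(P(a := i)) q \<in> insert i {v \<in> A. a \<le> v}" using * by auto
    show "(P(a := i)) q < q" using * ai by (cases "q = a") auto
    show "(N(i := a)) ((P(a := i)) q) = q" using * iA by auto
  qed (use A N1 n1 n a ai N iA in \<open>force+\<close>)
qed

text \<open>The last fact relates the test \<open>N v < n\<close> made by the program to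
  \<open>v\<close> not being the last vertex; the sentinel \<open>N (n - 1) = n\<close> makes it
  work.\<close>

lemma lower_hullD:
  assumes "lower_hull X T lo n N P A"
  shows "A \<subseteq> {lo..<n}" "lo \<in> A" "n - 1 \<in> A" "N (n - 1) = n" "finite A"
    and "\<And>v. v \<in> A \<Longrightarrow> Suc v < n \<Longrightarrow> N v \<in> A"
    and "\<And>v. v \<in> A \<Longrightarrow> Suc v < n \<Longrightarrow> v < N v"
    and "\<And>v j. v \<in> A \<Longrightarrow> Suc v < n \<Longrightarrow> lo \<le> j \<Longrightarrow> j < n \<Longrightarrow> supports X T v (N v) j"
    and "\<And>q. q \<in> A \<Longrightarrow> lo < q \<Longrightarrow> P q \<in> A \<and> P q < q \<and> N (P q) = q"
    and "\<And>v. v \<in> A \<Longrightarrow> N v < n \<longleftrightarrow> Suc v < n"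
proof -
  show A: "A \<subseteq> {lo..<n}" "lo \<in> A" "n - 1 \<in> A" and Nn: "N (n - 1) = n"
    using assms unfolding lower_hull_def by auto
  show "finite A" using A finite_subset by blast
  show NA: "\<And>v. v \<in> A \<Longrightarrow> Suc v < n \<Longrightarrow> N v \<in> A"
    and "\<And>v. v \<in> A \<Longrightarrow> Suc v < n \<Longrightarrow> v < N v"
    and "\<And>v j. v \<in> A \<Longrightarrow> Suc v < n \<Longrightarrow> lo \<le> j \<Longrightarrow> j < n \<Longrightarrow> supports X T v (N v) j"
    and "\<And>q. q \<in> A \<Longrightarrow> lo < q \<Longrightarrow> P q \<in> A \<and> P q < q \<and> N (P q) = q"
    using assms unfolding lower_hull_def by auto
  show "N v < n \<longleftrightarrow> Suc v < n" if "v \<in> A" for v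
  proof (cases "Suc v < n")
    case False
    moreover have "v < n" using that A by auto
    ultimately have "v = n - 1" by linarith
    then show ?thesis using Nn False by auto
  qed (use NA[OF that] A in auto)
qed

text \<open>What makes a local walk exact: one comparison across an edge rules out every index on
  the worse side, whether or not it is a hull vertex. The abstraction over \<open>F\<close> lets the
  same walk minimise slopes from a point and intercepts in a direction.\<close>

definition edge_unimodal ::
  "nat set \<Rightarrow> nat \<Rightarrow> nat \<Rightarrow> (nat \<Rightarrow> nat) \<Rightarrow> (nat \<Rightarrow> real) \<Rightarrow> bool" where
  "edge_unimodal A lo n N F \<longleftrightarrow> (\<forall>v\<in>A. Suc v < n \<longrightarrow>
     (F (N v) \<le> F v \<longrightarrow> (\<forall>j\<in>{lo..N v}. F (N v) \<le> F j)) \<and>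
     (F v \<le> F (N v) \<longrightarrow> (\<forall>j\<in>{v..<n}. F v \<le> F j)))"

lemma edge_unimodal_slope:
  assumes hull: "lower_hull X T lo n N P A" and X: "strict_mono_on {lo..<n} X" and a: "a < X lo"
  shows "edge_unimodal A lo n N (slope a y X T)"
  unfolding edge_unimodal_def
proof (intro ballI impI conjI)
  note h = lower_hullD[OF hull]
  have le: "X u \<le> X v" if "lo \<le> u" "u \<le> v" "v < n" for u v
    using strict_mono_on_leD[OF X, of u v] that by auto
  have lt: "X u < X v" if "lo \<le> u" "u < v" "v < n" for u v
    using strict_mono_onD[OF X, of u v] that by auto
  have a_lt: "a < X v" if "lo \<le> v" "v < n" for v
    using a le[of lo v] that by auto
  fix v j assume v: "v \<in> A" "Suc v < n"
  then have v': "N v \<in> A" "v < N v" "lo \<le> v" "N v < n" using h(1) h(6)[OF v] h(7)[OF v] by auto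
  show "slope a y X T (N v) \<le> slope a y X T j"
    if "slope a y X T (N v) \<le> slope a y X T v" "j \<in> {lo..N v}"
    by (rule slope_edge_left[OF h(8)[OF v]]) (use that v' a_lt lt le in auto)
  show "slope a y X T v \<le> slope a y X T j"
    if "slope a y X T v \<le> slope a y X T (N v)" "j \<in> {v..<n}"
    by (rule slope_edge_right[OF h(8)[OF v, of j]]) (use that v' a_lt lt le in auto)
qed

lemma edge_unimodal_direction:
  assumes hull: "lower_hull X T lo n N P A" and X: "strict_mono_on {lo..<n} X"
  shows "edge_unimodal A lo n N (\<lambda>j. T j - X j * y)"
  unfolding edge_unimodal_def
proof (intro ballI impI conjI)
  note h = lower_hullD[OF hull]
  have le: "X u \<le> X v" if "lo \<le> u" "u \<le> v" "v < n" for u v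
    using strict_mono_on_leD[OF X, of u v] that by auto
  have lt: "X u < X v" if "lo \<le> u" "u < v" "v < n" for u v
    using strict_mono_onD[OF X, of u v] that by auto
  fix v j assume v: "v \<in> A" "Suc v < n"
  then have v': "N v \<in> A" "v < N v" "lo \<le> v" "N v < n" using h(1) h(6)[OF v] h(7)[OF v] by auto
  show "T (N v) - X (N v) * y \<le> T j - X j * y"
    if "T (N v) - X (N v) * y \<le> T v - X v * y" "j \<in> {lo..N v}"
    by (rule direction_edge_left[OF h(8)[OF v]]) (use that v' lt le in auto)
  show "T v - X v * y \<le> T j - X j * y"
    if "T v - X v * y \<le> T (N v) - X (N v) * y" "j \<in> {v..<n}"
    by (rule direction_edge_right[OF h(8)[OF v, of j]]) (use that v' lt le in auto)
qed

section \<open>Walking along a hull\<close>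

definition walk_right :: "(iexp \<Rightarrow> rexp) \<Rightarrow> com" where
  "walk_right f =
    While (BAnd (ILess (IArr ''N'' (IVar ''a'')) (IVar ''n''))
        (BNot (RLess (f (IVar ''a'')) (f (IArr ''N'' (IVar ''a''))))))
      (IAssign ''a'' (IArr ''N'' (IVar ''a'')))"

text \<open>Each vertex passed pays 40 steps, and the vertex \<open>a\<close> where the walk stops
  pays for the failing test; hence \<open>\<le>\<close> in the initial potential and
  \<open><\<close> in the final one. The 11 is the cost of one round besides the two evaluations of
  \<open>f\<close>.\<close>

lemma wp_walk_right:
  fixes s u
  defines "st \<equiv> \<lambda>a. s\<lparr>ivar := (ivar s)(''a'' := a)\<rparr>"
  assumes hull: "lower_hull X T lo n N P A" and F: "edge_unimodal A lo n N F"
    and n: "ivar s ''n'' = n" and N: "iarr s ''N'' = N" and a: "ivar s ''a'' \<in> A"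
    and f: "\<And>a. rval (f (IVar ''a'')) (st a) = F a"
      "\<And>a. rval (f (IArr ''N'' (IVar ''a''))) (st a) = F (N a)"
    and min: "\<And>j. lo \<le> j \<Longrightarrow> j < ivar s ''a'' \<Longrightarrow> F (ivar s ''a'') \<le> F j"
    and cost: "rcost (f (IVar ''a'')) + rcost (f (IArr ''N'' (IVar ''a''))) + 11 \<le> 40"
    and r: "0 \<le> r" "r + 40 * int (card {v \<in> A. ivar s ''a'' \<le> v}) \<le> u"
    and Q: "\<And>a u. a \<in> A \<Longrightarrow> ivar s ''a'' \<le> a \<Longrightarrow> (\<forall>j\<in>{lo..<n}. F a \<le> F j) \<Longrightarrow>
      r + 40 * int (card {v \<in> A. a < v}) \<le> u \<Longrightarrow> Q u (st a)"
  shows "wp (walk_right f) Q u s"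
proof -
  note h = lower_hullD[OF hull]
  define I where "I = (\<lambda>u s'. \<exists>a. s' = st a \<and> a \<in> A \<and> ivar s ''a'' \<le> a \<and>
     (\<forall>j. lo \<le> j \<longrightarrow> j < a \<longrightarrow> F a \<le> F j) \<and> r + 40 * int (card {v \<in> A. a \<le> v}) \<le> u)"
  have card: "card {v \<in> A. a \<le> v} = Suc (card {v \<in> A. a < v})" if "a \<in> A" for a
  proof -
    have "{v \<in> A. a \<le> v} = insert a {v \<in> A. a < v}" using that by auto
    then show ?thesis using h(5) by simp
  qed
  have [simp]: "ivar (st a) ''a'' = a" "ivar (st a) ''n'' = n" "iarr (st a) ''N'' = N"
    "(st a)\<lparr>ivar := (ivar (st a))(''a'' := b)\<rparr> = st b" for a b
    using n N by (auto simp: st_def)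
  show ?thesis
    unfolding walk_right_def
  proof (rule wp_While[where I = I])
    have "st (ivar s ''a'') = s" by (simp add: st_def)
    then show "I u s" unfolding I_def
      using a min r by (intro exI[of _ "ivar s ''a''"]) auto
  next
    fix u s' assume "I u s'"
    then show "0 \<le> u" using r by (auto simp: I_def)
  next
    fix u s' assume "I u s'" and g: "bval (BAnd (ILess (IArr ''N'' (IVar ''a'')) (IVar ''n''))
        (BNot (RLess (f (IVar ''a'')) (f (IArr ''N'' (IVar ''a'')))))) s'"
    then obtain a where s': "s' = st a" and a: "a \<in> A" "ivar s ''a'' \<le> a"
      "r + 40 * int (card {v \<in> A. a \<le> v}) \<le> u"
      by (auto simp: I_def)
    have g: "N a < n" "F (N a) \<le> F a" using g unfolding s' by (auto simp: f)
    have sa: "Suc a < n" using g h(10) a by auto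
    have Na: "N a \<in> A" "a < N a" using h(6,7) a sa by auto
    have "card {v \<in> A. N a \<le> v} \<le> card {v \<in> A. a < v}"
      using Na h(5) by (intro card_mono) auto
    moreover have "\<forall>j. lo \<le> j \<longrightarrow> j < N a \<longrightarrow> F (N a) \<le> F j"
      using F a sa g unfolding edge_unimodal_def by auto
    ultimately show "wp (IAssign ''a'' (IArr ''N'' (IVar ''a''))) I
      (u - int (bcost (BAnd (ILess (IArr ''N'' (IVar ''a'')) (IVar ''n''))
        (BNot (RLess (f (IVar ''a'')) (f (IArr ''N'' (IVar ''a'')))))) + 1)) s'"
      using a Na cost card[of a] by (auto simp: I_def s')
  next
    fix u s' assume "I u s'" and g: "\<not> bval (BAnd (ILess (IArr ''N'' (IVar ''a'')) (IVar ''n''))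
        (BNot (RLess (f (IVar ''a'')) (f (IArr ''N'' (IVar ''a'')))))) s'"
    then obtain a where s': "s' = st a" and a: "a \<in> A" "ivar s ''a'' \<le> a"
      "\<forall>j. lo \<le> j \<longrightarrow> j < a \<longrightarrow> F a \<le> F j" "r + 40 * int (card {v \<in> A. a \<le> v}) \<le> u"
      by (auto simp: I_def)
    have edge: "Suc a < n \<Longrightarrow> F a \<le> F (N a)"
      using g a h(10) unfolding s' by (auto simp: f)
    then have "F a \<le> F j" if "j \<in> {lo..<n}" for j
    proof (cases "j < a")
      case False
      then consider "j = a" | "Suc a < n" "a \<le> j" using \<open>j \<in> {lo..<n}\<close>
        by (cases "j = a") auto
      then show ?thesis
      proof cases
        case 2
        have "\<forall>j\<in>{a..<n}. F a \<le> F j"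
          using F a(1) 2 edge unfolding edge_unimodal_def by blast
        then show ?thesis using 2 \<open>j \<in> {lo..<n}\<close> by auto
      qed simp
    qed (use a that in auto)
    then show "Q (u - int (bcost (BAnd (ILess (IArr ''N'' (IVar ''a'')) (IVar ''n''))
        (BNot (RLess (f (IVar ''a'')) (f (IArr ''N'' (IVar ''a'')))))) + 1)) s'"
      unfolding s' using a card[of a] cost by (intro Q) auto
  qed
qed

text \<open>The variable \<open>i\<close> is already the next index to insert, so the hull begins at
  \<open>i + 1\<close>, and this vertex has no valid left link.\<close>

definition walk_left :: "(iexp \<Rightarrow> rexp) \<Rightarrow> com" where
  "walk_left f =
    While (BAnd (ILess (Inc (IVar ''i'')) (IVar ''q''))
        (BNot (RLess (f (IVar ''q'')) (f (IArr ''P'' (IVar ''q''))))))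
      (IAssign ''q'' (IArr ''P'' (IVar ''q'')))"

text \<open>The potential that pays for moving the pointer to the left.\<close>

definition num_before :: "nat set \<Rightarrow> nat \<Rightarrow> nat" where
  "num_before A q = card {v \<in> A. v < q}"

text \<open>Every move lowers \<open>num_before\<close> by at least one. The vertex where the walk
  stops is not counted there, so the failing test needs the extra 40.\<close>

lemma wp_walk_left:
  fixes s u
  defines "st \<equiv> \<lambda>q. s\<lparr>ivar := (ivar s)(''q'' := q)\<rparr>"
  assumes hull: "lower_hull X T (Suc (ivar s ''i'')) n N P A"
    and F: "edge_unimodal A (Suc (ivar s ''i'')) n N F"
    and P: "iarr s ''P'' = P" and q: "ivar s ''q'' \<in> A"
    and f: "\<And>q. rval (f (IVar ''q'')) (st q) = F q"
      "\<And>q. rval (f (IArr ''P'' (IVar ''q''))) (st q) = F (P q)"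
    and min: "\<And>j. ivar s ''q'' \<le> j \<Longrightarrow> j < n \<Longrightarrow> F (ivar s ''q'') \<le> F j"
    and cost: "rcost (f (IVar ''q'')) + rcost (f (IArr ''P'' (IVar ''q''))) + 11 \<le> 40"
    and r: "0 \<le> r" "r + 40 * int (num_before A (ivar s ''q'')) + 40 \<le> u"
    and Q: "\<And>q u. q \<in> A \<Longrightarrow> (\<forall>j\<in>{Suc (ivar s ''i'')..<n}. F q \<le> F j) \<Longrightarrow>
      r + 40 * int (num_before A q) \<le> u \<Longrightarrow> Q u (st q)"
  shows "wp (walk_left f) Q u s"
proof -
  note h = lower_hullD[OF hull]
  define i where "i = ivar s ''i''"
  define I where "I = (\<lambda>u s'. \<exists>q. s' = st q \<and> q \<in> A \<and>
     (\<forall>j. q \<le> j \<longrightarrow> j < n \<longrightarrow> F q \<le> F j) \<and> r + 40 * int (num_before A q) + 40 \<le> u)"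
  have [simp]: "ivar (st q) ''q'' = q" "ivar (st q) ''i'' = i" "iarr (st q) ''P'' = P"
    "(st q)\<lparr>ivar := (ivar (st q))(''q'' := b)\<rparr> = st b" for q b
    using P by (auto simp: st_def i_def)
  have edge: "P q \<in> A" "P q < q" "N (P q) = q" "Suc (P q) < n" if "q \<in> A" "Suc i < q" for q
    using h(9)[of q] that h(1) unfolding i_def by auto
  show ?thesis
    unfolding walk_left_def
  proof (rule wp_While[where I = I])
    have "st (ivar s ''q'') = s" by (simp add: st_def)
    then show "I u s" unfolding I_def
      using q min r by (intro exI[of _ "ivar s ''q''"]) auto
  next
    fix u s' assume "I u s'"
    then show "0 \<le> u" using r by (auto simp: I_def)
  next
    fix u s' assume "I u s'" and g: "bval (BAnd (ILess (Inc (IVar ''i'')) (IVar ''q''))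
        (BNot (RLess (f (IVar ''q'')) (f (IArr ''P'' (IVar ''q'')))))) s'"
    then obtain q where s': "s' = st q" and q: "q \<in> A"
      "r + 40 * int (num_before A q) + 40 \<le> u"
      by (auto simp: I_def)
    have g: "Suc i < q" "F (P q) \<le> F q" using g unfolding s' by (auto simp: f)
    note e = edge[OF q(1) g(1)]
    have "num_before A (P q) < num_before A q"
      unfolding num_before_def using e h(5) by (intro psubset_card_mono) auto
    moreover have "\<forall>j. P q \<le> j \<longrightarrow> j < n \<longrightarrow> F (P q) \<le> F j"
      using F e g unfolding edge_unimodal_def by auto
    ultimately show "wp (IAssign ''q'' (IArr ''P'' (IVar ''q''))) I
      (u - int (bcost (BAnd (ILess (Inc (IVar ''i'')) (IVar ''q''))
        (BNot (RLess (f (IVar ''q'')) (f (IArr ''P'' (IVar ''q'')))))) + 1)) s'"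
      using q e cost by (auto simp: I_def s')
  next
    fix u s' assume "I u s'" and g: "\<not> bval (BAnd (ILess (Inc (IVar ''i'')) (IVar ''q''))
        (BNot (RLess (f (IVar ''q'')) (f (IArr ''P'' (IVar ''q'')))))) s'"
    then obtain q where s': "s' = st q" and q: "q \<in> A" "\<forall>j. q \<le> j \<longrightarrow> j < n \<longrightarrow> F q \<le> F j"
      "r + 40 * int (num_before A q) + 40 \<le> u"
      by (auto simp: I_def)
    have g: "Suc i < q \<Longrightarrow> F q \<le> F (P q)" using g unfolding s' by (auto simp: f)
    have "F q \<le> F j" if "j \<in> {Suc i..<n}" for j
    proof (cases "q \<le> j")
      case False
      then have "Suc i < q" using that by auto
      note e = edge[OF q(1) this] g[OF this]
      then show ?thesis using F that False unfolding edge_unimodal_def i_def by auto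
    qed (use q that in auto)
    then show "Q (u - int (bcost (BAnd (ILess (Inc (IVar ''i'')) (IVar ''q''))
        (BNot (RLess (f (IVar ''q'')) (f (IArr ''P'' (IVar ''q'')))))) + 1)) s'"
      unfolding s' using q cost by (intro Q) (auto simp: i_def)
  qed
qed

section \<open>Inserting a point at the left end of a hull\<close>

definition slope_exp :: "name \<Rightarrow> name \<Rightarrow> name \<Rightarrow> iexp \<Rightarrow> rexp" where
  "slope_exp X Y T e = Divide (Minus (RArr T e) (RArr Y (IVar ''i'')))
     (Minus (RArr X e) (RArr X (IVar ''i'')))"

lemma rval_slope_exp [simp]:
  "rval (slope_exp X Y T e) s =
    slope (rarr s X (ivar s ''i'')) (rarr s Y (ivar s ''i'')) (rarr s X) (rarr s T) (ival e s)"
  "rcost (slope_exp X Y T e) = 2 * icost e + 9"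
  by (simp_all add: slope_exp_def slope_def)

text \<open>Array names are parameters because the same code extends the hull of the tops and,
  dually, the hull of the lines. Deleted vertices are not erased; they merely become unreachable
  through the links.\<close>

definition push :: "name \<Rightarrow> name \<Rightarrow> com" where
  "push X T = Seq (IAssign ''a'' (Inc (IVar ''i'')))
    (Seq (walk_right (slope_exp X T T))
    (Seq (IStore ''N'' (IVar ''i'') (IVar ''a'')) (IStore ''P'' (IVar ''a'') (IVar ''i''))))"

text \<open>The size of the hull is the potential: the walk starts at the leftmost vertex and passes
  only vertices that the insertion removes.\<close>

lemma wp_push:
  assumes hull: "lower_hull (rarr s X) (rarr s T) (Suc (ivar s ''i'')) n (iarr s ''N'') (iarr s ''P'') A"
    and X: "strict_mono_on {ivar s ''i''..<n} (rarr s X)"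
    and n: "ivar s ''n'' = n" "Suc (ivar s ''i'') < n"
    and r: "0 \<le> r" "r + 40 * int (card A) + 100 \<le> u"
    and Q: "\<And>a u N P. a \<in> A \<Longrightarrow>
      lower_hull (rarr s X) (rarr s T) (ivar s ''i'') n N P (insert (ivar s ''i'') {v \<in> A. a \<le> v}) \<Longrightarrow>
      r + 40 * int (card (insert (ivar s ''i'') {v \<in> A. a \<le> v})) \<le> u \<Longrightarrow>
      Q u (s\<lparr>ivar := (ivar s)(''a'' := a), iarr := (iarr s)(''N'' := N, ''P'' := P)\<rparr>)"
  shows "wp (push X T) Q u s"
proof -
  define i where "i = ivar s ''i''"
  note h = lower_hullD[OF hull]
  define x where "x = rarr s X"
  define t where "t = rarr s T"
  have xi: "x i < x (Suc i)"
    using strict_mono_onD[OF X, of i "Suc i"] n by (auto simp: i_def x_def)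
  have X': "strict_mono_on {Suc i..<n} x"
    using X unfolding i_def x_def by (rule monotone_on_subset) auto
  have all: "{v \<in> A. Suc i \<le> v} = A" using h(1) by (auto simp: i_def)
  note F = edge_unimodal_slope[OF hull[folded i_def x_def t_def] X' xi, of "t i"]
  show ?thesis
    unfolding push_def
  \<comment> \<open>The 90 restores the 40 of \<open>a\<close>, spent on the last test, gives 40 to
    the new vertex, and covers the two stores.\<close>
  proof (subst wp_Seq, subst wp_simps(2), subst wp_Seq, rule wp_walk_right[where r = "r + 90"])
    show "lower_hull x t (Suc i) n (iarr s ''N'') (iarr s ''P'') A"
      using hull by (simp add: i_def x_def t_def)
    show "edge_unimodal A (Suc i) n (iarr s ''N'') (slope (x i) (t i) x t)" by (rule F)
    fix a u
    assume a: "a \<in> A" "\<forall>j\<in>{Suc i..<n}. slope (x i) (t i) x t a \<le> slope (x i) (t i) x t j"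
      and u: "r + 90 + 40 * int (card {v \<in> A. a < v}) \<le> u"
    have "{v \<in> A. a \<le> v} = insert a {v \<in> A. a < v}" using a by auto
    then have "card {v \<in> A. a \<le> v} = Suc (card {v \<in> A. a < v})" using h(5) by simp
    moreover have "i \<notin> A" using h(1) by (auto simp: i_def)
    ultimately have c: "card (insert i {v \<in> A. a \<le> v}) = card {v \<in> A. a < v} + 2" using h(5) by simp
    have hull': "lower_hull x t i n ((iarr s ''N'')(i := a)) ((iarr s ''P'')(a := i)) (insert i {v \<in> A. a \<le> v})"
      using hull n X a by (intro lower_hull_insert) (auto simp: i_def x_def t_def)
    show "wp (Seq (IStore ''N'' (IVar ''i'') (IVar ''a'')) (IStore ''P'' (IVar ''a'') (IVar ''i''))) Q u
      (s\<lparr>ivar := (ivar s)(''a'' := ival (Inc (IVar ''i'')) s)\<rparr>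
        \<lparr>ivar := (ivar (s\<lparr>ivar := (ivar s)(''a'' := ival (Inc (IVar ''i'')) s)\<rparr>))(''a'' := a)\<rparr>)"
      using Q[OF a(1) hull'[unfolded i_def x_def t_def], of "u - 6"] u c r(1)
      by (auto simp: i_def)
  qed (use h(2) n r all in \<open>simp_all add: i_def x_def t_def\<close>)
qed

text \<open>The line through \<open>(X i, B i)\<close> with the least slope among those through a top endpoint to the
  right, written as \<open>z \<mapsto> c * z - d\<close>.\<close>

definition tangent_line ::
  "(nat \<Rightarrow> real) \<Rightarrow> (nat \<Rightarrow> real) \<Rightarrow> (nat \<Rightarrow> real) \<Rightarrow> nat \<Rightarrow> nat \<Rightarrow> real \<Rightarrow> real \<Rightarrow> bool" where
  "tangent_line X B T n i c d \<longleftrightarrow>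
    (\<exists>j. i < j \<and> j < n \<and> c = slope (X i) (B i) X T j) \<and> d = c * X i - B i \<and>
    (\<forall>j. i < j \<longrightarrow> j < n \<longrightarrow> c \<le> slope (X i) (B i) X T j)"

definition bridge ::
  "(nat \<Rightarrow> real) \<Rightarrow> (nat \<Rightarrow> real) \<Rightarrow> (nat \<Rightarrow> real) \<Rightarrow> nat \<Rightarrow> nat \<Rightarrow> real \<Rightarrow> real" where
  "bridge X B T i j z = B i + slope (X i) (B i) X T j * (z - X i)"

text \<open>Lines are stored from index \<open>n - 1\<close> downwards, so that \<open>C\<close>
  increases although each new line is flatter than all earlier ones; \<open>l = n\<close> means that
  there is none, and \<open>i < l\<close> keeps a slot free. Domination is required only for
  \<open>z \<le> X i'\<close>, since the towers concerned stand left of \<open>i'\<close>.\<close>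

definition support_lines ::
  "(nat \<Rightarrow> real) \<Rightarrow> (nat \<Rightarrow> real) \<Rightarrow> (nat \<Rightarrow> real) \<Rightarrow> nat \<Rightarrow> nat \<Rightarrow>
    (nat \<Rightarrow> real) \<Rightarrow> (nat \<Rightarrow> real) \<Rightarrow> nat \<Rightarrow> bool" where
  "support_lines X B T n i C D l \<longleftrightarrow> l \<le> n \<and> i < l \<and> strict_mono_on {l..<n} C \<and>
    (\<forall>r\<in>{l..<n}. \<exists>i'<n. tangent_line X B T n i' (C r) (D r)) \<and>
    (\<forall>i'\<in>{i..<n}. \<forall>j\<in>{i'<..<n}. \<exists>r\<in>{l..<n}. \<forall>z\<le>X i'. bridge X B T i' j z \<le> C r * z - D r)"

text \<open>A line of slope \<open>c\<close> rising from below meets the top \<open>q\<close> first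
  among those from \<open>i\<close> onwards.\<close>

definition lowest :: "(nat \<Rightarrow> real) \<Rightarrow> (nat \<Rightarrow> real) \<Rightarrow> nat \<Rightarrow> nat \<Rightarrow> nat \<Rightarrow> real \<Rightarrow> bool" where
  "lowest X T n i q c \<longleftrightarrow> (\<forall>j\<in>{i..<n}. T q - X q * c \<le> T j - X j * c)"

text \<open>Both lines pass through \<open>(X i, B i)\<close>; to the left of a common point the
  flatter line is the higher one.\<close>

lemma bridge_le_tangent:
  assumes "tangent_line X B T n i c d" "i < j" "j < n" "z \<le> X i"
  shows "bridge X B T i j z \<le> c * z - d"
proof -
  have "c \<le> slope (X i) (B i) X T j" and d: "d = c * X i - B i"
    using assms unfolding tangent_line_def by auto
  then have "slope (X i) (B i) X T j * (z - X i) \<le> c * (z - X i)"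
    using assms by (intro mult_right_mono_neg) auto
  then show ?thesis unfolding bridge_def d by (simp add: algebra_simps)
qed

lemma support_lines_cong:
  assumes "support_lines X B T n i C D l" "\<And>r. l \<le> r \<Longrightarrow> C' r = C r \<and> D' r = D r"
  shows "support_lines X B T n i C' D' l"
proof -
  have "strict_mono_on {l..<n} C' \<longleftrightarrow> strict_mono_on {l..<n} C"
    using assms(2) by (auto simp: monotone_on_def)
  then show ?thesis
    using assms unfolding support_lines_def by simp
qed

lemma support_lines_add:
  assumes lines: "support_lines X B T n (Suc i) C D l" and tan: "tangent_line X B T n i c d"
    and less: "l < n \<Longrightarrow> c < C l"
  shows "support_lines X B T n i (C(l - 1 := c)) (D(l - 1 := d)) (l - 1)"
proof -
  have l: "l \<le> n" "Suc i < l" and mono: "strict_mono_on {l..<n} C"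
    and C1: "\<And>r. r \<in> {l..<n} \<Longrightarrow> \<exists>i'<n. tangent_line X B T n i' (C r) (D r)"
    and C2: "\<And>i' j. i' \<in> {Suc i..<n} \<Longrightarrow> j\<in>{i'<..<n} \<Longrightarrow>
      \<exists>r\<in>{l..<n}. \<forall>z\<le>X i'. bridge X B T i' j z \<le> C r * z - D r"
    using lines unfolding support_lines_def by auto
  have *: "{l - 1..<n} = insert (l - 1) {l..<n}" using l by auto
  have "c < C r" if "r \<in> {l..<n}" for r
    using less that strict_mono_on_leD[OF mono, of l r] by auto
  then have "strict_mono_on {l - 1..<n} (C(l - 1 := c))"
    using mono unfolding * by (auto simp: monotone_on_def)
  moreover have "\<exists>i'<n. tangent_line X B T n i' ((C(l - 1 := c)) r) ((D(l - 1 := d)) r)"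
    if "r \<in> {l - 1..<n}" for r
    using that C1[of r] tan l unfolding * by (cases "r = l - 1") (auto intro!: exI[of _ i])
  moreover have "\<exists>r\<in>{l - 1..<n}. \<forall>z\<le>X i'. bridge X B T i' j z \<le> (C(l - 1 := c)) r * z - (D(l - 1 := d)) r"
    if "i' \<in> {i..<n}" "j \<in> {i'<..<n}" for i' j
  proof (cases "i' = i")
    case True
    then show ?thesis
      using bridge_le_tangent[OF tan, of j] that l by (intro bexI[of _ "l - 1"]) auto
  next
    case False
    then have "i' \<in> {Suc i..<n}" using that by auto
    from C2[OF this that(2)] obtain r where "r \<in> {l..<n}"
      "\<forall>z\<le>X i'. bridge X B T i' j z \<le> C r * z - D r" by blast
    then show ?thesis using l by (intro bexI[of _ r]) auto
  qed
  moreover have "l - 1 \<le> n" "i < l - 1" using l by auto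
  ultimately show ?thesis
    unfolding support_lines_def by blast
qed

text \<open>The lowest top \<open>q\<close> is not above the current line \<open>l\<close>; hence no bridge from \<open>(X i, B i)\<close> is flatter
  than \<open>l\<close>, and \<open>(X i, B i)\<close> itself is not above \<open>l\<close>.\<close>

lemma support_lines_skip:
  assumes lines: "support_lines X B T n (Suc i) C D l" and X: "strict_mono_on {i..<n} X"
    and l: "l < n" and q: "i < q" "q < n" and low: "lowest X T n (Suc i) q (C l)"
    and D: "T q - X q * C l \<le> - D l" and skip: "C l \<le> slope (X i) (B i) X T q"
  shows "support_lines X B T n i C D l"
proof -
  have lt: "X u < X v" if "i \<le> u" "u < v" "v < n" for u v
    using strict_mono_onD[OF X, of u v] that by auto
  have Bi: "B i \<le> T q - X q * C l + X i * C l"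
    using skip lt[of i q] q unfolding slope_def by (simp add: field_simps)
  have *: "bridge X B T i j z \<le> C l * z - D l" if j: "j \<in> {i<..<n}" and z: "z \<le> X i" for j z
  proof -
    have "T q - X q * C l \<le> T j - X j * C l" using low j unfolding lowest_def by auto
    then have "C l \<le> slope (X i) (B i) X T j"
      using Bi lt[of i j] j unfolding slope_def by (simp add: field_simps)
    then have "slope (X i) (B i) X T j * (z - X i) \<le> C l * (z - X i)"
      using z by (intro mult_right_mono_neg) auto
    then show ?thesis using Bi D unfolding bridge_def by (simp add: algebra_simps)
  qed
  have "\<exists>r\<in>{l..<n}. \<forall>z\<le>X i. bridge X B T i j z \<le> C r * z - D r" if "j \<in> {i<..<n}" for j
    using * that l by (intro bexI[of _ l]) auto
  moreover have "{i..<n} = insert i {Suc i..<n}" using q by auto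
  ultimately show ?thesis
    using lines unfolding support_lines_def by auto
qed

section \<open>Memory cells left unchanged\<close>

definition frame :: "name set \<Rightarrow> name set \<Rightarrow> name set \<Rightarrow> name set \<Rightarrow> state \<Rightarrow> state \<Rightarrow> bool" where
  "frame IV RV IA RA s s' \<longleftrightarrow>
    (\<forall>a. a \<notin> IV \<longrightarrow> ivar s' a = ivar s a) \<and> (\<forall>a. a \<notin> RV \<longrightarrow> rvar s' a = rvar s a) \<and>
    (\<forall>a. a \<notin> IA \<longrightarrow> iarr s' a = iarr s a) \<and> (\<forall>a. a \<notin> RA \<longrightarrow> rarr s' a = rarr s a)"

lemma frameD:
  assumes "frame IV RV IA RA s s'"
  shows "a \<notin> IV \<Longrightarrow> ivar s' a = ivar s a" "a \<notin> RV \<Longrightarrow> rvar s' a = rvar s a"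
    "a \<notin> IA \<Longrightarrow> iarr s' a = iarr s a" "a \<notin> RA \<Longrightarrow> rarr s' a = rarr s a"
  using assms unfolding frame_def by auto

lemma frame_refl: "frame IV RV IA RA s s"
  by (simp add: frame_def)

lemma frame_trans:
  assumes "frame IV RV IA RA s s'" "frame IV' RV' IA' RA' s' s''"
    "IV \<union> IV' \<subseteq> IV''" "RV \<union> RV' \<subseteq> RV''" "IA \<union> IA' \<subseteq> IA''" "RA \<union> RA' \<subseteq> RA''"
  shows "frame IV'' RV'' IA'' RA'' s s''"
  using assms unfolding frame_def by (metis Un_iff subsetD)

section \<open>Constructing the relevant lines\<close>

text \<open>One comparison decides whether \<open>i\<close> yields a flatter line: if the slope to
  the lowest top \<open>q\<close> is not below \<open>C l\<close>, then the slope to no other top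
  is. Otherwise the point of tangency is sought from \<open>q\<close> to the left only.\<close>

definition record_line :: com where
  "record_line =
    Cond (BNot (BAnd (ILess (IVar ''l'') (IVar ''n''))
        (BNot (RLess (slope_exp ''X'' ''B'' ''T'' (IVar ''q'')) (RArr ''C'' (IVar ''l''))))))
      (Seq (walk_left (slope_exp ''X'' ''B'' ''T''))
      (Seq (IAssign ''l'' (Dec (IVar ''l'')))
      (Seq (RStore ''C'' (IVar ''l'') (slope_exp ''X'' ''B'' ''T'' (IVar ''q'')))
        (RStore ''D'' (IVar ''l'')
          (Minus (Times (RArr ''C'' (IVar ''l'')) (RArr ''X'' (IVar ''i''))) (RArr ''B'' (IVar ''i'')))))))
      Skip"

lemma wp_record_line:
  fixes s
  defines "i \<equiv> ivar s ''i''" and "q0 \<equiv> ivar s ''q''" and "l0 \<equiv> ivar s ''l''"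
    and "X \<equiv> rarr s ''X''" and "B \<equiv> rarr s ''B''" and "T \<equiv> rarr s ''T''"
    and "C0 \<equiv> rarr s ''C''" and "D0 \<equiv> rarr s ''D''"
  assumes hull: "lower_hull X T (Suc i) n N (iarr s ''P'') A"
    and X: "strict_mono_on {i..<n} X" and n: "ivar s ''n'' = n" "Suc i < n"
    and q: "q0 \<in> A" and first: "l0 = n \<Longrightarrow> q0 = n - 1"
    and low: "l0 < n \<Longrightarrow> lowest X T n (Suc i) q0 (C0 l0)"
    and D0: "l0 < n \<Longrightarrow> T q0 - X q0 * C0 l0 \<le> - D0 l0"
    and lines: "support_lines X B T n (Suc i) C0 D0 l0"
    and r: "0 \<le> r" "r + 40 * int (num_before A q0) + 200 \<le> u"
    and Q: "\<And>q l C D u. q \<in> A \<Longrightarrow> l < n \<Longrightarrow> lowest X T n (Suc i) q (C l) \<Longrightarrow>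
      T q - X q * C l \<le> - D l \<Longrightarrow> support_lines X B T n i C D l \<Longrightarrow>
      r + 40 * int (num_before A q) \<le> u \<Longrightarrow>
      Q u (s\<lparr>ivar := (ivar s)(''q'' := q, ''l'' := l), rarr := (rarr s)(''C'' := C, ''D'' := D)\<rparr>)"
  shows "wp record_line Q u s"
proof -
  note h = lower_hullD[OF hull]
  let ?F = "slope (X i) (B i) X T"
  have lt: "X u < X v" if "i \<le> u" "u < v" "v < n" for u v
    using strict_mono_onD[OF X, of u v] that by auto
  have q0: "i < q0" "q0 < n" using q h(1) by auto
  have l0: "l0 \<le> n" "Suc i < l0" using lines unfolding support_lines_def by auto
  have new: "wp (walk_left (slope_exp ''X'' ''B'' ''T''))
     (wp (Seq (IAssign ''l'' (Dec (IVar ''l'')))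
      (Seq (RStore ''C'' (IVar ''l'') (slope_exp ''X'' ''B'' ''T'' (IVar ''q'')))
        (RStore ''D'' (IVar ''l'')
          (Minus (Times (RArr ''C'' (IVar ''l'')) (RArr ''X'' (IVar ''i''))) (RArr ''B'' (IVar ''i'')))))) Q) u' s"
    if less: "l0 < n \<Longrightarrow> ?F q0 < C0 l0" and u': "u - 40 \<le> u'" for u'
  proof (rule wp_walk_left[where r = "r + 100" and F = ?F])
    show "lower_hull X T (Suc (ivar s ''i'')) n N (iarr s ''P'') A" using hull by (simp add: i_def)
    show "edge_unimodal A (Suc (ivar s ''i'')) n N ?F"
      using edge_unimodal_slope[OF hull, of "X i" "B i"] lt[of i "Suc i"] n monotone_on_subset[OF X, of "{Suc i..<n}"]
      unfolding i_def by auto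
    \<comment> \<open>No top right of \<open>q0\<close> can be better: it lies on or above the line
      of slope \<open>C0 l0\<close> through \<open>q0\<close>, which is steeper than the line from
      \<open>(X i, B i)\<close> to \<open>q0\<close>. Before the first line exists,
      \<open>q0\<close> is the last index.\<close>
    show "?F (ivar s ''q'') \<le> ?F j" if j: "ivar s ''q'' \<le> j" "j < n" for j
    proof (cases "l0 = n")
      case True
      then have "j = q0" using first j by (auto simp: q0_def)
      then show ?thesis by (simp add: q0_def)
    next
      case False
      then have l: "l0 < n" using l0 by auto
      have j': "q0 \<le> j" "X q0 \<le> X j" "X i < X q0" "X i < X j"
        using j q0 lt[of i q0] lt[of i j] lt[of q0 j] by (auto simp: q0_def le_less)
      have "T q0 - X q0 * C0 l0 \<le> T j - X j * C0 l0"
        using low[OF l] j q0 unfolding lowest_def q0_def by auto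
      moreover have "?F q0 * (X j - X q0) \<le> C0 l0 * (X j - X q0)"
        using less[OF l] j' by (intro mult_right_mono) auto
      moreover have "T q0 - B i = ?F q0 * (X q0 - X i)"
        using j' unfolding slope_def by simp
      ultimately have "?F q0 * (X j - X i) \<le> T j - B i" by (simp add: algebra_simps)
      then show ?thesis using j' unfolding slope_def[of _ _ _ _ j] q0_def by (simp add: pos_le_divide_eq)
    qed
    fix q u assume q: "q \<in> A" and min: "\<forall>j\<in>{Suc (ivar s ''i'')..<n}. ?F q \<le> ?F j"
      and u: "r + 100 + 40 * int (num_before A q) \<le> u"
    let ?l = "l0 - 1" and ?c = "?F q" let ?d = "?c * X i - B i"
    have qi: "i < q" "q < n" using q h(1) by auto
    have Fle: "?c \<le> ?F j" if "i < j" "j < n" for j using min that by (auto simp: i_def)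
    have Tq: "T q - B i = ?c * (X q - X i)"
      using lt[of i q] qi unfolding slope_def by simp
    \<comment> \<open>The tangent leaves all tops to the right of \<open>i\<close> on or above it
      and touches \<open>q\<close>, so the pointer is again correct for the new slope.\<close>
    have "lowest X T n (Suc i) q ?c"
      unfolding lowest_def
    proof
      fix j assume j: "j \<in> {Suc i..<n}"
      have "?c * (X j - X i) \<le> T j - B i"
        using Fle[of j] j lt[of i j] unfolding slope_def[of _ _ _ _ j] by (simp add: pos_le_divide_eq)
      then show "T q - X q * ?c \<le> T j - X j * ?c" using Tq by (simp add: algebra_simps)
    qed
    moreover have "T q - X q * ?c \<le> - ?d" using Tq by (simp add: algebra_simps)
    moreover have "tangent_line X B T n i ?c ?d"
      using Fle qi unfolding tangent_line_def by auto
    then have "support_lines X B T n i (C0(?l := ?c)) (D0(?l := ?d)) ?l"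
      using support_lines_add[OF lines, of ?c ?d] less Fle[of q0] q0 by fastforce
    ultimately have "Q (u - 26) (s\<lparr>ivar := (ivar s)(''q'' := q, ''l'' := ?l),
        rarr := (rarr s)(''C'' := C0(?l := ?c), ''D'' := D0(?l := ?d))\<rparr>)"
      using q l0 u by (intro Q) auto
    then show "wp (Seq (IAssign ''l'' (Dec (IVar ''l'')))
      (Seq (RStore ''C'' (IVar ''l'') (slope_exp ''X'' ''B'' ''T'' (IVar ''q'')))
        (RStore ''D'' (IVar ''l'')
          (Minus (Times (RArr ''C'' (IVar ''l'')) (RArr ''X'' (IVar ''i''))) (RArr ''B'' (IVar ''i''))))))
        Q u (s\<lparr>ivar := (ivar s)(''q'' := q)\<rparr>)"
      by (simp add: i_def l0_def X_def B_def T_def C0_def D0_def)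
  qed (use q r u' in \<open>simp_all add: i_def q0_def X_def B_def T_def\<close>)
  show ?thesis
  proof (cases "l0 < n \<longrightarrow> ?F q0 < C0 l0")
    case True
    then show ?thesis
      unfolding record_line_def using n new[of "u - 21"]
      by (auto simp: i_def l0_def q0_def X_def B_def T_def C0_def D0_def)
  next
    case False
    then have l: "l0 < n" "C0 l0 \<le> ?F q0" by auto
    then have "support_lines X B T n i C0 D0 l0"
      using support_lines_skip[OF lines X _ _ _ low D0] q0 by auto
    then have "Q (u - 22) (s\<lparr>ivar := (ivar s)(''q'' := q0, ''l'' := l0),
        rarr := (rarr s)(''C'' := C0, ''D'' := D0)\<rparr>)"
      using q l low D0 r by (intro Q) auto
    then show ?thesis
      unfolding record_line_def using n l
      by (simp add: i_def l0_def q0_def X_def B_def T_def C0_def D0_def)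
  qed
qed

text \<open>The line of \<open>i\<close> is determined before the top of \<open>i\<close> enters the
  hull, because a bridge ends strictly right of its start. Only the new top can then undercut the
  pointer, so a single comparison repairs it.\<close>

definition next_index :: com where
  "next_index = Seq (IAssign ''i'' (Dec (IVar ''i'')))
    (Seq record_line (Seq (push ''X'' ''T'')
    (Cond (BNot (RLess
        (Minus (RArr ''T'' (IVar ''q'')) (Times (RArr ''X'' (IVar ''q'')) (RArr ''C'' (IVar ''l''))))
        (Minus (RArr ''T'' (IVar ''i'')) (Times (RArr ''X'' (IVar ''i'')) (RArr ''C'' (IVar ''l''))))))
      (IAssign ''q'' (IVar ''i'')) Skip)))"

definition build_lines :: com where
  "build_lines = Seq (IAssign ''l'' (IVar ''n'')) (Seq (IAssign ''i'' (Dec (IVar ''n'')))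
    (Seq (IAssign ''q'' (IVar ''i'')) (Seq (IStore ''N'' (IVar ''i'') (IVar ''n''))
    (While (ILess (IConst 0) (IVar ''i'')) next_index))))"

text \<open>Two potentials are held at once: the hull size for insertions and
  \<open>num_before\<close> for the pointer; 400 is reserved per remaining index and 10 for the
  final test. While no line exists there is no slope to be lowest for, and the pointer waits at the
  right end so that the first walk can reach all tops.\<close>

definition lines_inv :: "state \<Rightarrow> nat \<Rightarrow> int \<Rightarrow> int \<Rightarrow> state \<Rightarrow> bool" where
  "lines_inv s n r u s' \<longleftrightarrow> frame {''a'', ''i'', ''q'', ''l''} {} {''N'', ''P''} {''C'', ''D''} s s' \<and>
    (let X = rarr s ''X''; B = rarr s ''B''; T = rarr s ''T''; C = rarr s' ''C''; D = rarr s' ''D'';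
         i = ivar s' ''i''; q = ivar s' ''q''; l = ivar s' ''l''
     in i < n \<and> support_lines X B T n i C D l \<and> (l = n \<longrightarrow> q = n - 1) \<and>
       (l < n \<longrightarrow> lowest X T n i q (C l) \<and> T q - X q * C l \<le> - D l) \<and>
       (\<exists>A. lower_hull X T i n (iarr s' ''N'') (iarr s' ''P'') A \<and> q \<in> A \<and>
         r + 40 * int (card A) + 40 * int (num_before A q) + 400 * int i + 10 \<le> u))"

text \<open>A vertex strictly between the ends of the new edge lies on or above it, so its intercept
  cannot be strictly below that of \<open>i\<close> and also at most that of
  \<open>a\<close>.\<close>

lemma pointer_not_popped:
  assumes "supports X T i a q" "X i < X q" "X q < X a"
    and "T q - X q * c < T i - X i * c" "T q - X q * c \<le> T a - X a * c"
  shows False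
proof -
  have "(T a - T i) * (X q - X i) \<le> (T q - T i) * (X a - X i)"
    using assms unfolding supports_def by simp
  moreover have "0 < (X a - X q) * ((T i - X i * c) - (T q - X q * c))"
    using assms by (intro mult_pos_pos) auto
  moreover have "0 \<le> (X q - X i) * ((T a - X a * c) - (T q - X q * c))"
    using assms by (intro mult_nonneg_nonneg) auto
  ultimately show False by (simp add: algebra_simps)
qed

lemma wp_next_index:
  assumes I: "lines_inv s n r u s'" and i: "0 < ivar s' ''i''"
    and X: "strict_mono_on {0..<n} (rarr s ''X'')" and n: "ivar s ''n'' = n" and r: "0 \<le> r"
  shows "wp next_index (lines_inv s n r) (u - 4) s'"
proof -
  define X B T C D where "X = rarr s ''X''" and "B = rarr s ''B''" and "T = rarr s ''T''"
    and "C = rarr s' ''C''" and "D = rarr s' ''D''"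
  define q l where "q = ivar s' ''q''" and "l = ivar s' ''l''"
  obtain i where si: "ivar s' ''i'' = Suc i" using i gr0_implies_Suc by blast
  have fr: "frame {''a'', ''i'', ''q'', ''l''} {} {''N'', ''P''} {''C'', ''D''} s s'"
    and inv: "Suc i < n" "support_lines X B T n (Suc i) C D l" "l = n \<longrightarrow> q = n - 1"
      "l < n \<longrightarrow> lowest X T n (Suc i) q (C l) \<and> T q - X q * C l \<le> - D l"
    and ex: "\<exists>A. lower_hull X T (Suc i) n (iarr s' ''N'') (iarr s' ''P'') A \<and> q \<in> A \<and>
         r + 40 * int (card A) + 40 * int (num_before A q) + 400 * int (Suc i) + 10 \<le> u"
    using I unfolding lines_inv_def Let_def si[symmetric] X_def B_def T_def C_def D_def q_def l_def
    by auto
  obtain A where A: "lower_hull X T (Suc i) n (iarr s' ''N'') (iarr s' ''P'') A" "q \<in> A"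
      "r + 40 * int (card A) + 40 * int (num_before A q) + 400 * int (Suc i) + 10 \<le> u"
    using ex by blast
  note h = lower_hullD[OF A(1)]
  have [simp]: "rarr s' ''X'' = X" "rarr s' ''B'' = B" "rarr s' ''T'' = T" "ivar s' ''n'' = n"
    using frameD(1,4)[OF fr] n by (simp_all add: X_def B_def T_def)
  have Xi: "strict_mono_on {i..<n} X"
    using X unfolding X_def by (rule monotone_on_subset) auto
  have lt: "X u < X v" if "u < v" "v < n" for u v
    using strict_mono_onD[OF X, of u v] that by (auto simp: X_def)
  let ?s1 = "s'\<lparr>ivar := (ivar s')(''i'' := i)\<rparr>"
  let ?update = "Cond (BNot (RLess
        (Minus (RArr ''T'' (IVar ''q'')) (Times (RArr ''X'' (IVar ''q'')) (RArr ''C'' (IVar ''l''))))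
        (Minus (RArr ''T'' (IVar ''i'')) (Times (RArr ''X'' (IVar ''i'')) (RArr ''C'' (IVar ''l''))))))
      (IAssign ''q'' (IVar ''i'')) Skip"
  have "wp record_line (wp (push ''X'' ''T'') (wp ?update (lines_inv s n r))) (u - 7) ?s1"
  \<comment> \<open>The 400 of this round is split into 200 for \<open>record_line\<close>, 100 for
    \<open>push\<close>, and 100 for the pointer update and a possible growth of
    \<open>num_before\<close> by one.\<close>
  proof (rule wp_record_line[where r = "r + 40 * int (card A) + 400 * int i + 200" and n = n and A = A])
    fix q C l D u'
    assume q: "q \<in> A" "l < n"
      and "lowest (rarr ?s1 ''X'') (rarr ?s1 ''T'') n (Suc (ivar ?s1 ''i'')) q (C l)"
      and "rarr ?s1 ''T'' q - rarr ?s1 ''X'' q * C l \<le> - D l"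
      and "support_lines (rarr ?s1 ''X'') (rarr ?s1 ''B'') (rarr ?s1 ''T'') n (ivar ?s1 ''i'') C D l"
      and u': "r + 40 * int (card A) + 400 * int i + 200 + 40 * int (num_before A q) \<le> u'"
    then have low: "lowest X T n (Suc i) q (C l)" and D: "T q - X q * C l \<le> - D l"
      and lines: "support_lines X B T n i C D l" by simp_all
    let ?s2 = "?s1\<lparr>ivar := (ivar ?s1)(''q'' := q, ''l'' := l), rarr := (rarr ?s1)(''C'' := C, ''D'' := D)\<rparr>"
    show "wp (push ''X'' ''T'') (wp ?update (lines_inv s n r)) u' ?s2"
    proof (rule wp_push[where r = "r + 40 * int (num_before A q) + 400 * int i + 100" and n = n and A = A])
      fix a u N P
      let ?A = "insert (ivar ?s2 ''i'') {v \<in> A. a \<le> v}"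
      let ?s3 = "?s2\<lparr>ivar := (ivar ?s2)(''a'' := a), iarr := (iarr ?s2)(''N'' := N, ''P'' := P)\<rparr>"
      assume a: "a \<in> A" and hull': "lower_hull (rarr ?s2 ''X'') (rarr ?s2 ''T'') (ivar ?s2 ''i'') n N P ?A"
        and u: "r + 40 * int (num_before A q) + 400 * int i + 100 + 40 * int (card ?A) \<le> u"
      have hull': "lower_hull X T i n N P ?A" using hull' by simp
      note h' = lower_hullD[OF hull']
      have ai: "i < a" "a < n" and qi: "i < q" "q < n" using a q h(1) by auto
      have fr': "frame {''a'', ''i'', ''q'', ''l''} {} {''N'', ''P''} {''C'', ''D''} s ?s3"
        "frame {''a'', ''i'', ''q'', ''l''} {} {''N'', ''P''} {''C'', ''D''} s (?s3\<lparr>ivar := (ivar ?s3)(''q'' := i)\<rparr>)"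
        using fr unfolding frame_def by auto
      have X3 [simp]: "rarr s ''X'' = X" "rarr s ''B'' = B" "rarr s ''T'' = T"
        by (auto simp: X_def B_def T_def)
      have split: "{i..<n} = insert i {Suc i..<n}" using inv by auto
      show "wp ?update (lines_inv s n r) u ?s3"
      proof (cases "T q - X q * C l < T i - X i * C l")
        case True
        have "q \<in> ?A"
        proof (rule ccontr)
          assume "q \<notin> ?A"
          then have "q < a" using q by auto
          moreover have Ni: "N i \<in> ?A" "i < N i" using h'(6,7)[of i] inv by auto
          ultimately have "q < N i" "N i < n" using h(1) by auto
          then show False
            using pointer_not_popped[of X T i "N i" q "C l"] h'(8)[of i q] True low lt qi Ni inv
            unfolding lowest_def by auto
        qed
        \<comment> \<open>Left of the pointer an insertion can add \<open>i\<close> only, so the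
          pointer's potential rises by at most 40.\<close>
        moreover have "num_before ?A q \<le> Suc (num_before A q)"
        proof -
          have "num_before ?A q \<le> card (insert i {v \<in> A. v < q})"
            unfolding num_before_def using h(5) by (intro card_mono) auto
          also have "\<dots> \<le> Suc (num_before A q)" using h(5) by (simp add: num_before_def card_insert_if)
          finally show ?thesis .
        qed
        moreover have "lowest X T n i q (C l)"
          using low True unfolding lowest_def split by simp
        ultimately have "lines_inv s n r (u - 20) ?s3"
          unfolding lines_inv_def Let_def using fr'(1) inv lines q D hull' u
          by (auto intro!: exI[of _ ?A] simp del: card_insert_if)
        then show ?thesis using True by simp
      next
        case False
        have "{v \<in> ?A. v < i} = {}" using h(1) by auto
        then have "num_before ?A i = 0" unfolding num_before_def by (metis card.empty)
        moreover have "lowest X T n i i (C l)"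
          using low False unfolding lowest_def split by fastforce
        moreover have "T i - X i * C l \<le> - D l" using D False by simp
        ultimately have "lines_inv s n r (u - 21) (?s3\<lparr>ivar := (ivar ?s3)(''q'' := i)\<rparr>)"
          unfolding lines_inv_def Let_def using fr'(2) inv lines q hull' u
          by (auto intro!: exI[of _ ?A] simp del: card_insert_if)
        then show ?thesis using False by simp
      qed
    qed (use A q Xi u' r inv in \<open>auto\<close>)
  qed (use A inv Xi r in \<open>auto simp: l_def q_def C_def D_def\<close>)
  then show ?thesis
    by (simp add: next_index_def si)
qed

lemma wp_build_lines:
  assumes X: "strict_mono_on {0..<n} (rarr s ''X'')" and n: "ivar s ''n'' = n" "1 \<le> n"
    and r: "0 \<le> r" "r + 500 * int n \<le> u"
    and Q: "\<And>s' u. frame {''a'', ''i'', ''q'', ''l''} {} {''N'', ''P''} {''C'', ''D''} s s' \<Longrightarrow>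
      support_lines (rarr s ''X'') (rarr s ''B'') (rarr s ''T'') n 0 (rarr s' ''C'') (rarr s' ''D'') (ivar s' ''l'') \<Longrightarrow>
      r \<le> u \<Longrightarrow> Q u s'"
  shows "wp build_lines Q u s"
proof -
  let ?s1 = "s\<lparr>ivar := (ivar s)(''l'' := n, ''i'' := n - 1, ''q'' := n - 1),
      iarr := (iarr s)(''N'' := (iarr s ''N'')(n - 1 := n))\<rparr>"
  have "{v \<in> {n - 1}. v < n - 1} = {}" by auto
  then have n0: "num_before {n - 1} (n - 1) = 0" unfolding num_before_def by (metis card.empty)
  have "support_lines (rarr s ''X'') (rarr s ''B'') (rarr s ''T'') n (n - 1) (rarr s ''C'') (rarr s ''D'') n"
    using n unfolding support_lines_def by auto
  moreover have "frame {''a'', ''i'', ''q'', ''l''} {} {''N'', ''P''} {''C'', ''D''} s ?s1"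
    unfolding frame_def by auto
  moreover have "lower_hull (rarr s ''X'') (rarr s ''T'') (n - 1) n ((iarr s ''N'')(n - 1 := n)) (iarr s ''P'') {n - 1}"
    using n by (intro lower_hull_singleton) auto
  ultimately have I: "lines_inv s n r (u - 10) ?s1"
    unfolding lines_inv_def Let_def using n n0 r by (auto intro!: exI[of _ "{n - 1}"])
  have "wp (While (ILess (IConst 0) (IVar ''i'')) next_index) Q (u - 10) ?s1"
  proof (rule wp_While[where I = "lines_inv s n r"])
    show "lines_inv s n r (u - 10) ?s1" by (rule I)
    show "0 \<le> u" if "lines_inv s n r u s'" for u s'
      using that r unfolding lines_inv_def Let_def by auto
    show "wp next_index (lines_inv s n r) (u - int (bcost (ILess (IConst 0) (IVar ''i'')) + 1)) s'"
      if "lines_inv s n r u s'" "bval (ILess (IConst 0) (IVar ''i'')) s'" for u s'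
      using wp_next_index[OF that(1) _ X n(1) r(1)] that(2) by simp
    show "Q (u - int (bcost (ILess (IConst 0) (IVar ''i'')) + 1)) s'"
      if "lines_inv s n r u s'" "\<not> bval (ILess (IConst 0) (IVar ''i'')) s'" for u s'
      using that unfolding lines_inv_def Let_def by (intro Q) auto
  qed
  then show ?thesis
    using n by (simp add: build_lines_def)
qed

text \<open>Duality: line \<open>r\<close> is treated as the point \<open>(C r, D r)\<close>. The
  largest \<open>C r * z - D r\<close> is the least \<open>D r - C r * z\<close>, so the upper
  envelope is a lower hull. The links \<open>N\<close> and \<open>P\<close> of the hull of the tops
  are overwritten, as that hull has done its work.\<close>

definition hull_lines :: com where
  "hull_lines = Seq (IAssign ''i'' (Dec (IVar ''n''))) (Seq (IStore ''N'' (IVar ''i'') (IVar ''n''))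
    (While (ILess (IVar ''l'') (IVar ''i''))
      (Seq (IAssign ''i'' (Dec (IVar ''i''))) (push ''C'' ''D''))))"

lemma wp_hull_lines:
  assumes C: "strict_mono_on {ivar s ''l''..<n} (rarr s ''C'')"
    and n: "ivar s ''n'' = n" "ivar s ''l'' < n"
    and r: "0 \<le> r" "r + 200 * int n \<le> u"
    and Q: "\<And>s' u A. frame {''a'', ''i''} {} {''N'', ''P''} {} s s' \<Longrightarrow>
      lower_hull (rarr s ''C'') (rarr s ''D'') (ivar s ''l'') n (iarr s' ''N'') (iarr s' ''P'') A \<Longrightarrow>
      r \<le> u \<Longrightarrow> Q u s'"
  shows "wp hull_lines Q u s"
proof -
  let ?s1 = "s\<lparr>ivar := (ivar s)(''i'' := n - 1), iarr := (iarr s)(''N'' := (iarr s ''N'')(n - 1 := n))\<rparr>"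
  define C D l where "C = rarr s ''C''" and "D = rarr s ''D''" and "l = ivar s ''l''"
  define I where "I = (\<lambda>u s'. frame {''a'', ''i''} {} {''N'', ''P''} {} s s' \<and>
    l \<le> ivar s' ''i'' \<and> ivar s' ''i'' < n \<and>
    (\<exists>A. lower_hull C D (ivar s' ''i'') n (iarr s' ''N'') (iarr s' ''P'') A \<and>
      r + 40 * int (card A) + 120 * int (ivar s' ''i'') + 10 \<le> u))"
  have "lower_hull C D (n - 1) n ((iarr s ''N'')(n - 1 := n)) (iarr s ''P'') {n - 1}"
    using n by (intro lower_hull_singleton) auto
  moreover have "frame {''a'', ''i''} {} {''N'', ''P''} {} s ?s1"
    unfolding frame_def by auto
  ultimately have I: "I (u - 6) ?s1"
    unfolding I_def using n r by (auto intro!: exI[of _ "{n - 1}"] simp: l_def)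
  have "wp (While (ILess (IVar ''l'') (IVar ''i'')) (Seq (IAssign ''i'' (Dec (IVar ''i''))) (push ''C'' ''D'')))
      Q (u - 6) ?s1"
  proof (rule wp_While[where I = I])
    show "I (u - 6) ?s1" by (rule I)
    show "0 \<le> u" if "I u s'" for u s'
      using that r unfolding I_def by auto
  next
    fix u s' assume I: "I u s'" and g: "bval (ILess (IVar ''l'') (IVar ''i'')) s'"
    obtain A where fr: "frame {''a'', ''i''} {} {''N'', ''P''} {} s s'"
      and A: "lower_hull C D (ivar s' ''i'') n (iarr s' ''N'') (iarr s' ''P'') A"
        "r + 40 * int (card A) + 120 * int (ivar s' ''i'') + 10 \<le> u" and i: "ivar s' ''i'' < n"
      using I unfolding I_def by auto
    have [simp]: "rarr s' ''C'' = C" "rarr s' ''D'' = D" "ivar s' ''n'' = n" "ivar s' ''l'' = l"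
      using frameD(1,4)[OF fr] n by (simp_all add: C_def D_def l_def)
    have "l < ivar s' ''i''" using g by simp
    then obtain i where si: "ivar s' ''i'' = Suc i" "l \<le> i" by (cases "ivar s' ''i''") auto
    have "strict_mono_on {i..<n} C"
      using monotone_on_subset[OF C, of "{i..<n}"] si unfolding C_def l_def by auto
    note Ci = this
    let ?s1 = "s'\<lparr>ivar := (ivar s')(''i'' := i)\<rparr>"
    have "wp (push ''C'' ''D'') I (u - 7) ?s1"
    proof (rule wp_push[where r = "r + 120 * int i + 10" and n = n and A = A])
      fix a u N P
      let ?A = "insert (ivar ?s1 ''i'') {v \<in> A. a \<le> v}"
      let ?s2 = "?s1\<lparr>ivar := (ivar ?s1)(''a'' := a), iarr := (iarr ?s1)(''N'' := N, ''P'' := P)\<rparr>"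
      assume "lower_hull (rarr ?s1 ''C'') (rarr ?s1 ''D'') (ivar ?s1 ''i'') n N P ?A"
        "r + 120 * int i + 10 + 40 * int (card ?A) \<le> u"
      moreover have "frame {''a'', ''i''} {} {''N'', ''P''} {} s ?s2"
        using fr unfolding frame_def by auto
      ultimately show "I u ?s2"
        using si i unfolding I_def by (auto intro!: exI[of _ ?A])
    qed (use A Ci i si r in auto)
    then show "wp (Seq (IAssign ''i'' (Dec (IVar ''i''))) (push ''C'' ''D'')) I
        (u - int (bcost (ILess (IVar ''l'') (IVar ''i'')) + 1)) s'"
      by (simp add: si)
  next
    show "Q (u - int (bcost (ILess (IVar ''l'') (IVar ''i'')) + 1)) s'"
      if "I u s'" "\<not> bval (ILess (IVar ''l'') (IVar ''i'')) s'" for u s'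
    proof -
      have fr: "frame {''a'', ''i''} {} {''N'', ''P''} {} s s'" using that unfolding I_def by auto
      have "ivar s' ''i'' = l" using that frameD(1)[OF fr, of "''l''"] unfolding I_def l_def by auto
      then show ?thesis
        using that unfolding I_def by (auto intro!: Q simp: C_def D_def l_def)
    qed
  qed
  then show ?thesis
    using n by (simp add: hull_lines_def)
qed

section \<open>Counting loops\<close>

definition for_j :: "com \<Rightarrow> com" where
  "for_j c = Seq (IAssign ''j'' (IConst 0))
    (While (ILess (IVar ''j'') (IVar ''n'')) (Seq c (IAssign ''j'' (Inc (IVar ''j'')))))"

text \<open>\<open>pot\<close> is an amortised potential: a round costs \<open>K\<close> plus the drop of \<open>pot\<close>.\<close>

lemma wp_for_j:
  fixes pot :: "state \<Rightarrow> int" and s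
  defines "st \<equiv> \<lambda>s j. s\<lparr>ivar := (ivar s)(''j'' := j)\<rparr>"
  assumes n: "ivar s ''n'' = n" and IV: "''j'' \<in> IV" "''n'' \<notin> IV"
    and start: "J 0 (st s 0)"
    and step: "\<And>j s' u r'. J j s' \<Longrightarrow> frame IV RV IA RA s s' \<Longrightarrow> j < n \<Longrightarrow> ivar s' ''j'' = j \<Longrightarrow>
      0 \<le> r' \<Longrightarrow> r' + K + pot s' \<le> u \<Longrightarrow>
      wp c (\<lambda>u' s''. ivar s'' ''j'' = j \<and> frame IV RV IA RA s s'' \<and> J (Suc j) (st s'' (Suc j)) \<and>
        r' + pot (st s'' (Suc j)) \<le> u') u s'"
    and pot: "\<And>s. 0 \<le> pot s" and K: "0 \<le> K"
    and r: "0 \<le> r" "r + (K + 7) * int n + pot (st s 0) + 6 \<le> u"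
    and Q: "\<And>u s'. frame IV RV IA RA s s' \<Longrightarrow> J n s' \<Longrightarrow> r \<le> u \<Longrightarrow> Q u s'"
  shows "wp (for_j c) Q u s"
proof -
  define I where "I = (\<lambda>u s'. \<exists>j. j \<le> n \<and> ivar s' ''j'' = j \<and> J j s' \<and> frame IV RV IA RA s s' \<and>
    r + (K + 7) * int (n - j) + pot s' + 4 \<le> u)"
  have fr_st: "frame IV RV IA RA s (st s' j)" if "frame IV RV IA RA s s'" for s' j
    using that IV unfolding frame_def st_def by auto
  have n': "ivar s' ''n'' = n" if "frame IV RV IA RA s s'" for s'
    using frameD(1)[OF that IV(2)] n by simp
  have nonneg: "0 \<le> (K + 7) * int k" for k using K by simp
  have "wp (While (ILess (IVar ''j'') (IVar ''n'')) (Seq c (IAssign ''j'' (Inc (IVar ''j''))))) Q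
      (u - 2) (st s 0)"
  proof (rule wp_While[where I = I])
    show "I (u - 2) (st s 0)"
      unfolding I_def using start r fr_st[OF frame_refl, of 0] by (intro exI[of _ 0]) (auto simp: st_def)
    show "0 \<le> u" if "I u s'" for u s'
      using that r pot[of s'] nonneg unfolding I_def by (smt (verit))
  next
    fix u s' assume "I u s'" and g: "bval (ILess (IVar ''j'') (IVar ''n'')) s'"
    then obtain j where j: "ivar s' ''j'' = j" "J j s'" and fr: "frame IV RV IA RA s s'"
      and u: "r + (K + 7) * int (n - j) + pot s' + 4 \<le> u"
      unfolding I_def by auto
    have jn: "j < n" using g j n'[OF fr] by simp
    \<comment> \<open>The 7 keeps 3 for incrementing \<open>j\<close> and 4 for the next evaluation
      of the guard.\<close>
    define r' where "r' = r + (K + 7) * int (n - Suc j) + 7"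
    have "n - j = Suc (n - Suc j)" using jn by auto
    then have r': "r + (K + 7) * int (n - j) = r' + K" unfolding r'_def by (simp add: algebra_simps)
    have "wp c (\<lambda>u' s''. ivar s'' ''j'' = j \<and> frame IV RV IA RA s s'' \<and> J (Suc j) (st s'' (Suc j)) \<and>
        r' + pot (st s'' (Suc j)) \<le> u') (u - 4) s'"
      using step[OF j(2) fr jn j(1), of r' "u - 4"] u r' r nonneg[of "n - Suc j"] by (simp add: r'_def)
    then have "wp c (wp (IAssign ''j'' (Inc (IVar ''j''))) I) (u - 4) s'"
    proof (rule wp_mono)
      fix u' s'' assume *: "ivar s'' ''j'' = j \<and> frame IV RV IA RA s s'' \<and> J (Suc j) (st s'' (Suc j)) \<and>
        r' + pot (st s'' (Suc j)) \<le> u'"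
      then have "I (u' - 3) (st s'' (Suc j))"
        unfolding I_def using fr_st jn by (intro exI[of _ "Suc j"]) (auto simp: r'_def st_def)
      then show "wp (IAssign ''j'' (Inc (IVar ''j''))) I u' s''"
        using * by (simp add: st_def)
    qed
    then show "wp (Seq c (IAssign ''j'' (Inc (IVar ''j'')))) I
        (u - int (bcost (ILess (IVar ''j'') (IVar ''n'')) + 1)) s'"
      by simp
  next
    fix u s' assume "I u s'" and g: "\<not> bval (ILess (IVar ''j'') (IVar ''n'')) s'"
    then obtain j where j: "j \<le> n" "ivar s' ''j'' = j" "J j s'" and fr: "frame IV RV IA RA s s'"
      and u: "r + (K + 7) * int (n - j) + pot s' + 4 \<le> u"
      unfolding I_def by auto
    have "j = n" using g j n'[OF fr] by simp
    then show "Q (u - int (bcost (ILess (IVar ''j'') (IVar ''n'')) + 1)) s'"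
      using j fr u pot[of s'] by (intro Q) auto
  qed
  then show ?thesis by (simp add: for_j_def st_def)
qed

section \<open>One side of the tower\<close>

text \<open>The program for one side is run twice, with \<open>p\<close> the identity and \<open>e = 1\<close>, and with \<open>p\<close> the
  reversal and \<open>e = -1\<close>.\<close>

definition copy_input :: com where
  "copy_input = for_j (Seq (RStore ''X'' (IVar ''j'') (Times (RVar ''e'') (RArr ''x'' (IArr ''p'' (IVar ''j'')))))
    (Seq (RStore ''B'' (IVar ''j'') (RArr ''b'' (IArr ''p'' (IVar ''j''))))
      (RStore ''T'' (IVar ''j'') (RArr ''t'' (IArr ''p'' (IVar ''j''))))))"

lemma wp_copy_input:
  fixes s
  defines "p \<equiv> iarr s ''p''"
  assumes n: "ivar s ''n'' = n" and r: "0 \<le> r" "r + 40 * int n + 6 \<le> u"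
    and Q: "\<And>u s'. frame {''j''} {} {} {''X'', ''B'', ''T''} s s' \<Longrightarrow>
      (\<forall>m<n. rarr s' ''X'' m = rvar s ''e'' * rarr s ''x'' (p m) \<and> rarr s' ''B'' m = rarr s ''b'' (p m) \<and>
        rarr s' ''T'' m = rarr s ''t'' (p m)) \<Longrightarrow> r \<le> u \<Longrightarrow> Q u s'"
  shows "wp copy_input Q u s"
  unfolding copy_input_def
proof (rule wp_for_j[where n = n and IV = "{''j''}" and RV = "{}" and IA = "{}" and RA = "{''X'', ''B'', ''T''}"
      and K = 33 and pot = "\<lambda>_. 0" and r = r and
      J = "\<lambda>j s'. \<forall>m<j. rarr s' ''X'' m = rvar s ''e'' * rarr s ''x'' (p m) \<and>
        rarr s' ''B'' m = rarr s ''b'' (p m) \<and> rarr s' ''T'' m = rarr s ''t'' (p m)"], goal_cases)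
  case (5 j s' u r')
  note fr = frameD[OF 5(2)]
  have "frame {''j''} {} {} {''X'', ''B'', ''T''} s (s'\<lparr>rarr := (rarr s')(''X'' := X, ''B'' := B, ''T'' := T)\<rparr>)" for X B T
    using 5(2) unfolding frame_def by auto
  then show ?case
    using 5 fr(2)[of "''e''"] fr(3)[of "''p''"] fr(4)[of "''x''"] fr(4)[of "''b''"] fr(4)[of "''t''"]
    by (auto simp: p_def less_Suc_eq)
qed (use n r Q in auto)

text \<open>\<open>a\<close> is set once, outside the loop: with growing abscissas the best line
  only gets steeper, so all walks together pass each hull vertex at most once. \<open>H\<close> is
  only ever raised, which lets the second run build on the first.\<close>

definition query :: com where
  "query = Seq (IAssign ''a'' (IVar ''l'')) (for_j
    (Seq (RAssign ''y'' (RArr ''X'' (IVar ''j'')))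
    (Seq (walk_right (\<lambda>i. Minus (RArr ''D'' i) (Times (RArr ''C'' i) (RVar ''y''))))
    (Seq (RAssign ''z'' (Minus (Times (RArr ''C'' (IVar ''a'')) (RVar ''y'')) (RArr ''D'' (IVar ''a''))))
    (Cond (RLess (RArr ''H'' (IArr ''p'' (IVar ''j''))) (RVar ''z''))
      (RStore ''H'' (IArr ''p'' (IVar ''j'')) (RVar ''z'')) Skip)))))"

lemma wp_query:
  fixes s
  defines "p \<equiv> iarr s ''p''" and "X \<equiv> rarr s ''X''" and "C \<equiv> rarr s ''C''" and "D \<equiv> rarr s ''D''"
    and "H \<equiv> rarr s ''H''" and "l \<equiv> ivar s ''l''"
  assumes hull: "lower_hull C D l n (iarr s ''N'') P A"
    and C: "strict_mono_on {l..<n} C" and X: "strict_mono_on {0..<n} X" and p: "inj_on p {0..<n}"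
    and n: "ivar s ''n'' = n" and r: "0 \<le> r" "r + 200 * int n \<le> u"
    and Q: "\<And>u s'. frame {''j'', ''a''} {''y'', ''z''} {} {''H''} s s' \<Longrightarrow>
      (\<forall>m<n. H (p m) \<le> rarr s' ''H'' (p m) \<and> (\<forall>q\<in>{l..<n}. C q * X m - D q \<le> rarr s' ''H'' (p m)) \<and>
        (rarr s' ''H'' (p m) = H (p m) \<or> (\<exists>q\<in>{l..<n}. rarr s' ''H'' (p m) = C q * X m - D q))) \<Longrightarrow>
      r \<le> u \<Longrightarrow> Q u s'"
  shows "wp query Q u s"
proof -
  note h = lower_hullD[OF hull]
  let ?G = "\<lambda>m q. D q - C q * X m"
  let ?P = "\<lambda>H' m. H (p m) \<le> H' (p m) \<and> (\<forall>q\<in>{l..<n}. C q * X m - D q \<le> H' (p m)) \<and>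
        (H' (p m) = H (p m) \<or> (\<exists>q\<in>{l..<n}. H' (p m) = C q * X m - D q))"
  let ?J = "\<lambda>j s'. ivar s' ''a'' \<in> A \<and>
      (\<forall>m\<in>{j..<n}. \<forall>q\<in>{l..<ivar s' ''a''}. ?G m (ivar s' ''a'') \<le> ?G m q) \<and>
      (\<forall>m<j. ?P (rarr s' ''H'') m) \<and> (\<forall>m\<in>{j..<n}. rarr s' ''H'' (p m) = H (p m))"
  have ln: "l < n" using h(1,2) by auto
  have card: "card {v \<in> A. a \<le> v} = Suc (card {v \<in> A. a < v})" if "a \<in> A" for a
  proof -
    have "{v \<in> A. a \<le> v} = insert a {v \<in> A. a < v}" using that by auto
    then show ?thesis using h(5) by simp
  qed
  have "card {v \<in> A. l \<le> v} \<le> card {..<n}" using h(1) by (intro card_mono) auto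
  then have cardA: "int (card {v \<in> A. l \<le> v}) \<le> int n" by simp
  have frame_a: "frame {''j'', ''a''} {''y'', ''z''} {} {''H''} (s\<lparr>ivar := (ivar s)(''a'' := l)\<rparr>) s' \<longleftrightarrow>
    frame {''j'', ''a''} {''y'', ''z''} {} {''H''} s s'" for s'
    unfolding frame_def by auto
  have "wp (for_j
    (Seq (RAssign ''y'' (RArr ''X'' (IVar ''j'')))
    (Seq (walk_right (\<lambda>i. Minus (RArr ''D'' i) (Times (RArr ''C'' i) (RVar ''y''))))
    (Seq (RAssign ''z'' (Minus (Times (RArr ''C'' (IVar ''a'')) (RVar ''y'')) (RArr ''D'' (IVar ''a''))))
    (Cond (RLess (RArr ''H'' (IArr ''p'' (IVar ''j''))) (RVar ''z''))
      (RStore ''H'' (IArr ''p'' (IVar ''j'')) (RVar ''z'')) Skip))))) Q (u - 2) (s\<lparr>ivar := (ivar s)(''a'' := l)\<rparr>)"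
  proof (rule wp_for_j[where n = n and IV = "{''j'', ''a''}" and RV = "{''y'', ''z''}" and IA = "{}" and RA = "{''H''}"
      and K = 100 and pot = "\<lambda>s. 40 * int (card {v \<in> A. ivar s ''a'' \<le> v})" and r = r and J = ?J], goal_cases)
    case (5 j s' u r')
    have fr0: "frame {''j'', ''a''} {''y'', ''z''} {} {''H''} s s'"
      using 5(2) unfolding frame_def by auto
    note fr = frameD[OF fr0]
    have [simp]: "ivar s' ''n'' = n" "ivar s' ''l'' = l" "iarr s' ''p'' = p" "rarr s' ''X'' = X"
      "rarr s' ''C'' = C" "rarr s' ''D'' = D" "iarr s' ''N'' = iarr s ''N''" "ivar s' ''j'' = j"
      using fr n 5(4) by (auto simp: p_def X_def C_def D_def l_def)
    let ?s1 = "s'\<lparr>rvar := (rvar s')(''y'' := X j)\<rparr>"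
    have "wp (walk_right (\<lambda>i. Minus (RArr ''D'' i) (Times (RArr ''C'' i) (RVar ''y''))))
      (wp (Seq (RAssign ''z'' (Minus (Times (RArr ''C'' (IVar ''a'')) (RVar ''y'')) (RArr ''D'' (IVar ''a''))))
      (Cond (RLess (RArr ''H'' (IArr ''p'' (IVar ''j''))) (RVar ''z''))
      (RStore ''H'' (IArr ''p'' (IVar ''j'')) (RVar ''z'')) Skip))
      (\<lambda>u' s''. ivar s'' ''j'' = j \<and> frame {''j'', ''a''} {''y'', ''z''} {} {''H''} s s'' \<and>
        ?J (Suc j) (s''\<lparr>ivar := (ivar s'')(''j'' := Suc j)\<rparr>) \<and>
        r' + 40 * int (card {v \<in> A. ivar (s''\<lparr>ivar := (ivar s'')(''j'' := Suc j)\<rparr>) ''a'' \<le> v}) \<le> u')) (u - 3) ?s1"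
    proof (rule wp_walk_right[OF hull edge_unimodal_direction[OF hull C, of "X j"], where r = "r' + 97"])
      fix a u
      assume a: "a \<in> A" and le: "ivar ?s1 ''a'' \<le> a"
        and min: "\<forall>q\<in>{l..<n}. ?G j a \<le> ?G j q"
        and u: "r' + 97 + 40 * int (card {v \<in> A. a < v}) \<le> u"
      let ?z = "C a * X j - D a"
      let ?s2 = "?s1\<lparr>ivar := (ivar ?s1)(''a'' := a)\<rparr>"
      have al: "l \<le> a" "a < n" using a h(1) by auto
      \<comment> \<open>A line of smaller slope that does not win at \<open>X j\<close> cannot win
        further right, so what the walk has skipped stays excluded for all later queries.\<close>
      have minm: "?G m a \<le> ?G m q" if m: "m \<in> {Suc j..<n}" and q: "q \<in> {l..<a}" for m q
      proof -
        have "C q < C a" using strict_mono_onD[OF C, of q a] q al by auto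
        moreover have "X j < X m" using strict_mono_onD[OF X, of j m] m by auto
        ultimately have "0 \<le> (C a - C q) * (X m - X j)" by (intro mult_nonneg_nonneg) auto
        moreover have "?G j a \<le> ?G j q" using min q al by auto
        ultimately show ?thesis by (simp add: algebra_simps)
      qed
      have zmax: "C q * X j - D q \<le> ?z" if "q \<in> {l..<n}" for q
        using min that by force
      have pj: "p m \<noteq> p j" if "m < n" "m \<noteq> j" for m
        using inj_onD[OF p, of m j] that 5(3) by auto
      have H': "rarr s' ''H'' (p j) = H (p j)" using 5(1,3) by auto
      let ?f = "(rarr s' ''H'')(p j := ?z)"
      have J1: "\<forall>m<Suc j. ?P ?f m" "\<forall>m\<in>{Suc j..<n}. ?f (p m) = H (p m)" if "H (p j) < ?z"
        using 5(1,3) zmax that al pj by (auto simp: less_Suc_eq)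
      have J2: "\<forall>m<Suc j. ?P (rarr s' ''H'') m" "\<forall>m\<in>{Suc j..<n}. rarr s' ''H'' (p m) = H (p m)"
        if "\<not> H (p j) < ?z"
        using 5(1,3) zmax that al H' by (force simp: less_Suc_eq)+
      have frs: "frame {''j'', ''a''} {''y'', ''z''} {} {''H''} s
          (?s2\<lparr>rvar := (rvar ?s2)(''z'' := ?z), rarr := (rarr s')(''H'' := h)\<rparr>)"
        "frame {''j'', ''a''} {''y'', ''z''} {} {''H''} s (?s2\<lparr>rvar := (rvar ?s2)(''z'' := ?z)\<rparr>)" for h
        using fr0 unfolding frame_def by auto
      show "wp (Seq (RAssign ''z'' (Minus (Times (RArr ''C'' (IVar ''a'')) (RVar ''y'')) (RArr ''D'' (IVar ''a''))))
      (Cond (RLess (RArr ''H'' (IArr ''p'' (IVar ''j''))) (RVar ''z''))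
      (RStore ''H'' (IArr ''p'' (IVar ''j'')) (RVar ''z'')) Skip))
      (\<lambda>u' s''. ivar s'' ''j'' = j \<and> frame {''j'', ''a''} {''y'', ''z''} {} {''H''} s s'' \<and>
        ?J (Suc j) (s''\<lparr>ivar := (ivar s'')(''j'' := Suc j)\<rparr>) \<and>
        r' + 40 * int (card {v \<in> A. ivar (s''\<lparr>ivar := (ivar s'')(''j'' := Suc j)\<rparr>) ''a'' \<le> v}) \<le> u') u ?s2"
      proof (cases "H (p j) < ?z")
        case True
        then show ?thesis using a minm J1 frs(1)[of ?f] u card[OF a] by (simp add: H')
      next
        case False
        then show ?thesis using a minm J2 frs(2) u card[OF a] by (simp add: H')
      qed
    qed (use 5 in \<open>auto simp: l_def\<close>)
    then show ?case by (simp add: frame_a)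
  next
    case (10 u s')
    then show ?case by (intro Q) (auto simp: frame_a)
  qed (use n r h(2) cardA ln in \<open>auto simp: l_def H_def p_def\<close>)
  then show ?thesis
    by (simp add: query_def l_def)
qed

section \<open>Heights contributed by one side\<close>

lemma bridge_cong:
  assumes "X i = X' i" "B i = B' i" "X j = X' j" "T j = T' j"
  shows "bridge X B T i j z = bridge X' B' T' i j z"
  using assms unfolding bridge_def slope_def by simp

text \<open>A value up to \<open>T m\<close> need not be exact: a tower with such a top has height \<open>0\<close>.\<close>

definition sided_max ::
  "(nat \<Rightarrow> real) \<Rightarrow> (nat \<Rightarrow> real) \<Rightarrow> (nat \<Rightarrow> real) \<Rightarrow> nat \<Rightarrow> nat \<Rightarrow> real \<Rightarrow> real \<Rightarrow> bool" where
  "sided_max X B T n m h0 h \<longleftrightarrow> h0 \<le> h \<and>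
    (\<forall>i j. m < i \<longrightarrow> i < j \<longrightarrow> j < n \<longrightarrow> bridge X B T i j (X m) \<le> h) \<and>
    (h = h0 \<or> h \<le> T m \<or> (\<exists>i j. m < i \<and> i < j \<and> j < n \<and> h \<le> bridge X B T i j (X m)))"

text \<open>Only a line starting right of \<open>m\<close> is a bridge for \<open>m\<close>. One
  starting at \<open>m\<close> has value \<open>B m\<close> there, and one starting further left
  runs on or below all later tops, so in both cases the value is at most \<open>T m\<close> and does
  no harm.\<close>

lemma tangent_line_cases:
  assumes tan: "tangent_line X B T n i c d" and i: "i < n" and m: "m < n" and BT: "B i \<le> T i"
    and X: "strict_mono_on {0..<n} X"
  shows "c * X m - d \<le> T m \<or> (\<exists>j. m < i \<and> i < j \<and> j < n \<and> c * X m - d = bridge X B T i j (X m))"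
proof -
  have d: "d = c * X i - B i" using tan unfolding tangent_line_def by simp
  consider "m < i" | "m = i" | "i < m" by linarith
  then show ?thesis
  proof cases
    case 1
    obtain j where "i < j" "j < n" "c = slope (X i) (B i) X T j"
      using tan unfolding tangent_line_def by auto
    then have "c * X m - d = bridge X B T i j (X m)"
      unfolding bridge_def d by (simp add: algebra_simps)
    then show ?thesis using 1 \<open>i < j\<close> \<open>j < n\<close> by blast
  next
    case 2
    then show ?thesis using BT unfolding d by simp
  next
    case 3
    then have "c \<le> slope (X i) (B i) X T m" using tan m unfolding tangent_line_def by auto
    moreover have "X i < X m" using strict_mono_onD[OF X, of i m] 3 m by auto
    ultimately have "c * (X m - X i) \<le> T m - B i" unfolding slope_def by (simp add: pos_le_divide_eq)
    then show ?thesis unfolding d by (simp add: algebra_simps)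
  qed
qed

definition one_side :: com where
  "one_side = Seq copy_input (Seq build_lines
    (Cond (ILess (IVar ''l'') (IVar ''n'')) (Seq hull_lines query) Skip))"

lemma wp_one_side:
  fixes s
  defines "p \<equiv> iarr s ''p''" and "H \<equiv> rarr s ''H''"
  defines "xs \<equiv> \<lambda>m. rvar s ''e'' * rarr s ''x'' (p m)" and "bs \<equiv> \<lambda>m. rarr s ''b'' (p m)"
    and "ts \<equiv> \<lambda>m. rarr s ''t'' (p m)"
  assumes xs: "strict_mono_on {0..<n} xs" and bt: "\<And>m. m < n \<Longrightarrow> bs m \<le> ts m"
    and p: "inj_on p {0..<n}" and n: "ivar s ''n'' = n" "1 \<le> n"
    and r: "0 \<le> r" "r + 1000 * int n \<le> u"
    and Q: "\<And>u s'. frame {''a'', ''i'', ''q'', ''l'', ''j''} {''y'', ''z''} {''N'', ''P''}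
        {''C'', ''D'', ''X'', ''B'', ''T'', ''H''} s s' \<Longrightarrow>
      (\<forall>m<n. sided_max xs bs ts n m (H (p m)) (rarr s' ''H'' (p m))) \<Longrightarrow> r \<le> u \<Longrightarrow> Q u s'"
  shows "wp one_side Q u s"
  unfolding one_side_def wp_Seq
proof (rule wp_copy_input[OF n(1), where r = "r + 940 * int n"])
  fix u1 s1 assume fr1: "frame {''j''} {} {} {''X'', ''B'', ''T''} s s1"
    and eq: "\<forall>m<n. rarr s1 ''X'' m = rvar s ''e'' * rarr s ''x'' (iarr s ''p'' m) \<and>
      rarr s1 ''B'' m = rarr s ''b'' (iarr s ''p'' m) \<and> rarr s1 ''T'' m = rarr s ''t'' (iarr s ''p'' m)"
    and u1: "r + 940 * int n \<le> u1"
  define X B T where "X = rarr s1 ''X''" and "B = rarr s1 ''B''" and "T = rarr s1 ''T''"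
  have XBT: "X m = xs m" "B m = bs m" "T m = ts m" if "m < n" for m
    using eq that unfolding X_def B_def T_def xs_def bs_def ts_def p_def by auto
  have X: "strict_mono_on {0..<n} X" using xs XBT unfolding monotone_on_def by auto
  have BT: "B m \<le> T m" if "m < n" for m using bt XBT that by auto
  note f1 = frameD[OF fr1]
  show "wp build_lines (wp (Cond (ILess (IVar ''l'') (IVar ''n'')) (Seq hull_lines query) Skip) Q) u1 s1"
  proof (rule wp_build_lines[where r = "r + 420 * int n" and n = n])
    fix s2 u2 assume fr2: "frame {''a'', ''i'', ''q'', ''l''} {} {''N'', ''P''} {''C'', ''D''} s1 s2"
      and lines: "support_lines (rarr s1 ''X'') (rarr s1 ''B'') (rarr s1 ''T'') n 0 (rarr s2 ''C'') (rarr s2 ''D'')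
        (ivar s2 ''l'')"
      and u2: "r + 420 * int n \<le> u2"
    define C D l where "C = rarr s2 ''C''" and "D = rarr s2 ''D''" and "l = ivar s2 ''l''"
    note f2 = frameD[OF fr2]
    have lines: "support_lines X B T n 0 C D l" using lines unfolding X_def B_def T_def C_def D_def l_def .
    have n2: "ivar s2 ''n'' = n" using f2(1) f1(1) n by simp
    show "wp (Cond (ILess (IVar ''l'') (IVar ''n'')) (Seq hull_lines query) Skip) Q u2 s2"
    proof (cases "l < n")
      case True
      have C: "strict_mono_on {l..<n} C" using lines unfolding support_lines_def by simp
      have "wp hull_lines (wp query Q) (u2 - 4) s2"
      proof (rule wp_hull_lines[where r = "r + 200 * int n + 1"])
        fix s3 u3 A assume fr3: "frame {''a'', ''i''} {} {''N'', ''P''} {} s2 s3"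
          and hull: "lower_hull (rarr s2 ''C'') (rarr s2 ''D'') (ivar s2 ''l'') n (iarr s3 ''N'') (iarr s3 ''P'') A"
          and u3: "r + 200 * int n + 1 \<le> u3"
        note f3 = frameD[OF fr3]
        have s3: "rarr s3 ''C'' = C" "rarr s3 ''D'' = D" "ivar s3 ''l'' = l" "rarr s3 ''X'' = X"
          "iarr s3 ''p'' = p" "rarr s3 ''H'' = H" "ivar s3 ''n'' = n"
          using f1 f2 f3 n unfolding C_def D_def l_def X_def p_def H_def by simp_all
        show "wp query Q u3 s3"
        proof (rule wp_query[where s = s3 and r = r and n = n and A = A, unfolded s3])
          fix u4 s4 assume fr4: "frame {''j'', ''a''} {''y'', ''z''} {} {''H''} s3 s4"
            and H: "\<forall>m<n. H (p m) \<le> rarr s4 ''H'' (p m) \<and>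
              (\<forall>q\<in>{l..<n}. C q * X m - D q \<le> rarr s4 ''H'' (p m)) \<and>
              (rarr s4 ''H'' (p m) = H (p m) \<or> (\<exists>q\<in>{l..<n}. rarr s4 ''H'' (p m) = C q * X m - D q))"
            and "r \<le> u4"
          then show "Q u4 s4"
          proof (intro Q)
            have "frame {''a'', ''i'', ''q'', ''l'', ''j''} {} {''N'', ''P''} {''C'', ''D'', ''X'', ''B'', ''T''} s s2"
              by (rule frame_trans[OF fr1 fr2]) auto
            then have "frame {''a'', ''i'', ''q'', ''l'', ''j''} {} {''N'', ''P''} {''C'', ''D'', ''X'', ''B'', ''T''} s s3"
              by (rule frame_trans[OF _ fr3]) auto
            then show "frame {''a'', ''i'', ''q'', ''l'', ''j''} {''y'', ''z''} {''N'', ''P''}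
              {''C'', ''D'', ''X'', ''B'', ''T'', ''H''} s s4"
              by (rule frame_trans[OF _ fr4]) auto
            show "\<forall>m<n. sided_max xs bs ts n m (H (p m)) (rarr s4 ''H'' (p m))"
              unfolding sided_max_def
            proof (intro allI impI conjI)
              fix m assume m: "m < n"
              let ?h = "rarr s4 ''H'' (p m)"
              have Hm: "H (p m) \<le> ?h" "\<And>q. q \<in> {l..<n} \<Longrightarrow> C q * X m - D q \<le> ?h"
                "?h = H (p m) \<or> (\<exists>q\<in>{l..<n}. ?h = C q * X m - D q)"
                using H m by blast+
              show "H (p m) \<le> ?h" by (rule Hm)
              show "bridge xs bs ts i j (xs m) \<le> ?h" if ij: "m < i" "i < j" "j < n" for i j
              proof -
                have "X m \<le> X i" using strict_mono_onD[OF X, of m i] ij by auto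
                moreover obtain q where "q \<in> {l..<n}" "\<forall>z\<le>X i. bridge X B T i j z \<le> C q * z - D q"
                proof -
                  have "i \<in> {0..<n}" "j \<in> {i<..<n}" using ij by auto
                  then show ?thesis using that lines unfolding support_lines_def by blast
                qed
                ultimately have "bridge X B T i j (X m) \<le> ?h"
                  using Hm(2)[of q] by (meson order_trans)
                moreover have "bridge X B T i j (X m) = bridge xs bs ts i j (xs m)"
                  using ij XBT m by (auto intro!: bridge_cong)
                ultimately show ?thesis by simp
              qed
              show "?h = H (p m) \<or> ?h \<le> ts m \<or>
                  (\<exists>i j. m < i \<and> i < j \<and> j < n \<and> ?h \<le> bridge xs bs ts i j (xs m))"
                using Hm(3)
              proof (elim disjE bexE)
                fix q assume q: "q \<in> {l..<n}" "?h = C q * X m - D q"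
                then obtain i where i: "i < n" "tangent_line X B T n i (C q) (D q)"
                  using lines unfolding support_lines_def by blast
                from tangent_line_cases[OF i(2,1) m BT[OF i(1)] X] show ?thesis
                proof (elim disjE exE conjE)
                  fix j assume j: "m < i" "i < j" "j < n" "C q * X m - D q = bridge X B T i j (X m)"
                  moreover have "bridge X B T i j (X m) = bridge xs bs ts i j (xs m)"
                    using j XBT m i by (auto intro!: bridge_cong)
                  ultimately have "?h \<le> bridge xs bs ts i j (xs m)" using q by simp
                  then show ?thesis using j by blast
                qed (use q XBT m in auto)
              qed auto
            qed
          qed auto
        qed (use hull C X p r u3 s3 in \<open>simp_all add: C_def[symmetric] D_def[symmetric] l_def[symmetric]\<close>)
      qed (use C True n2 r u2 n(2) in \<open>simp_all add: C_def l_def\<close>)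
      then show ?thesis using True n2 by (simp add: l_def)
    next
      case False
      \<comment> \<open>With two intervals, the bridge from 0 to 1 would need a recorded line
        dominating it.\<close>
      have n1: "n = 1"
      proof (rule ccontr)
        assume "n \<noteq> 1"
        then have "0 \<in> {0..<n}" "1 \<in> {0<..<n}" using n by auto
        then have "\<exists>q\<in>{l..<n}. \<forall>z\<le>X 0. bridge X B T 0 1 z \<le> C q * z - D q"
          using lines unfolding support_lines_def by blast
        then show False using False by auto
      qed
      have "Q (u2 - 5) s2"
      proof (rule Q)
        have "frame {''a'', ''i'', ''q'', ''l'', ''j''} {} {''N'', ''P''} {''C'', ''D'', ''X'', ''B'', ''T''} s s2"
          by (rule frame_trans[OF fr1 fr2]) auto
        then show "frame {''a'', ''i'', ''q'', ''l'', ''j''} {''y'', ''z''} {''N'', ''P''}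
              {''C'', ''D'', ''X'', ''B'', ''T'', ''H''} s s2"
          by (rule frame_trans[OF _ frame_refl[of "{}" "{}" "{}" "{}"]]) auto
        have "rarr s2 ''H'' = H" using f1(4) f2(4) unfolding H_def by simp
        then show "\<forall>m<n. sided_max xs bs ts n m (H (p m)) (rarr s2 ''H'' (p m))"
          using n1 unfolding sided_max_def by auto
      qed (use u2 n in auto)
      then show ?thesis using False n2 by (simp add: l_def)
    qed
  qed (use X n u1 r f1(1) in \<open>simp_all add: X_def B_def T_def\<close>)
qed (use r n in simp_all)

section \<open>Towers\<close>

text \<open>\<open>on_or_above\<close> only asks for some terrain point below; uniqueness over
  \<open>x i\<close> turns it into a comparison with \<open>v i\<close>. An edge meets the abscissa
  of a vertex only at its own ends because \<open>x\<close> is strictly increasing.\<close>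

lemma terrain_at_vertex:
  assumes x: "strict_mono_on {..<n} x" and i: "i < n" and y: "(x i, y) \<in> terrain n x v"
  shows "y = v i"
proof -
  have lt: "x a < x c" if "a < c" "c < n" for a c
    using strict_mono_onD[OF x, of a c] that by auto
  have inj: "a = c" if "x a = x c" "a < n" "c < n" for a c
    using lt[of a c] lt[of c a] that by (metis less_irrefl linorder_neqE_nat)
  from y consider "(x i, y) \<in> vertices n x v"
    | m where "Suc m < n" "(x i, y) \<in> closed_segment (x m, v m) (x (Suc m), v (Suc m))"
    unfolding terrain_def by auto
  then show ?thesis
  proof cases
    case 1
    then show ?thesis using inj i unfolding vertices_def by auto
  next
    case 2
    then obtain a where a: "0 \<le> a" "a \<le> 1" "x i = (1 - a) * x m + a * x (Suc m)"
      "y = (1 - a) * v m + a * v (Suc m)"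
      unfolding closed_segment_def by auto
    have d: "x m < x (Suc m)" using lt 2 by auto
    have xi: "x i - x m = a * (x (Suc m) - x m)" "x (Suc m) - x i = (1 - a) * (x (Suc m) - x m)"
      using a(3) by (auto simp: algebra_simps)
    show ?thesis
    proof (cases "i \<le> m")
      case True
      then have "x i \<le> x m" using lt[of i m] 2 by (cases "i = m") auto
      then have "a * (x (Suc m) - x m) \<le> 0" unfolding xi(1)[symmetric] by simp
      then have a0: "a = 0" using a(1) d by (simp add: mult_le_0_iff)
      then have "x i = x m" using a(3) by simp
      then show ?thesis using inj[of i m] i 2(1) a(4) a0 by simp
    next
      case False
      then have "x (Suc m) \<le> x i" using lt[of "Suc m" i] i by (cases "i = Suc m") auto
      then have "(1 - a) * (x (Suc m) - x m) \<le> 0" unfolding xi(2)[symmetric] by simp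
      then have a1: "a = 1" using a(2) d by (simp add: mult_le_0_iff)
      then have "x i = x (Suc m)" using a(3) by simp
      then show ?thesis using inj[of i "Suc m"] i 2(1) a(4) a1 by simp
    qed
  qed
qed

text \<open>Extrapolation traded for interpolation: the right-hand side says that the bottom of
  \<open>i\<close> is not above the line from \<open>(x k, w)\<close> to the top of
  \<open>j\<close>. The two differ by the positive factor \<open>1 - u\<close>.\<close>

lemma bridge_le_iff:
  assumes u: "x i = x k + u * (x j - x k)" "u < 1" and ne: "x j \<noteq> x k"
  shows "bridge x b t i j (x k) \<le> w \<longleftrightarrow> b i \<le> (1 - u) * w + u * t j"
proof -
  have 1: "x j - x i = (1 - u) * (x j - x k)" "x k - x i = - u * (x j - x k)"
    using u by (auto simp: algebra_simps)
  have eq: "slope (x i) (b i) x t j * (x k - x i) = - ((t j - b i) * u / (1 - u))"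
    unfolding slope_def 1 using ne u by simp
  then have "bridge x b t i j (x k) = (b i - u * t j) / (1 - u)"
    unfolding bridge_def eq using u(2) by (simp add: field_simps)
  then show ?thesis using u by (simp add: pos_divide_le_eq algebra_simps)
qed

section \<open>Necessity of the bridge condition\<close>

lemma between_cases:
  fixes x :: "nat \<Rightarrow> real"
  assumes x: "strict_mono_on {..<n} x" and "k < i \<and> i < j \<and> j < n \<or> j < i \<and> i < k \<and> k < n"
  obtains u where "x i = x k + u * (x j - x k)" "0 < u" "u < 1" "x j \<noteq> x k"
proof -
  have lt: "x a < x c" if "a < c" "c < n" for a c
    using strict_mono_onD[OF x, of a c] that by auto
  from assms(2) have *: "x k < x i \<and> x i < x j \<or> x j < x i \<and> x i < x k"
    using lt by auto
  let ?u = "(x i - x k) / (x j - x k)"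
  show ?thesis
  proof (rule that[of ?u])
    show "x i = x k + ?u * (x j - x k)" "x j \<noteq> x k" using * by auto
    show "0 < ?u" "?u < 1" using * by (auto simp: divide_simps)
  qed
qed

text \<open>The sight line to vertex \<open>j\<close> must clear vertex \<open>i\<close>; lowering
  \<open>v i\<close> to \<open>b i\<close> and raising \<open>v j\<close> to \<open>t j\<close> only
  weakens this, and what remains no longer depends on the realization.\<close>

lemma guards_bridge:
  assumes x: "strict_mono_on {..<n} x" and v: "realization n b t v"
    and g: "guards (terrain n x v) (x k, w)"
    and ij: "k < i \<and> i < j \<and> j < n \<or> j < i \<and> i < k \<and> k < n"
  shows "bridge x b t i j (x k) \<le> w"
proof -
  obtain u where u: "x i = x k + u * (x j - x k)" "0 < u" "u < 1" "x j \<noteq> x k"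
    using between_cases[OF x ij] by blast
  have ij': "i < n" "j < n" using ij by auto
  have "(x j, v j) \<in> terrain n x v"
    using ij' unfolding terrain_def vertices_def by auto
  then have "visible (terrain n x v) (x k, w) (x j, v j)" using g unfolding guards_def by blast
  moreover have "(x i, (1 - u) * w + u * v j) \<in> closed_segment (x k, w) (x j, v j)"
  proof -
    have "(x i, (1 - u) * w + u * v j) = (1 - u) *\<^sub>R (x k, w) + u *\<^sub>R (x j, v j)"
      unfolding u(1) by (simp add: algebra_simps)
    then show ?thesis unfolding closed_segment_def using u(2,3) by (intro CollectI exI[of _ u]) auto
  qed
  ultimately have "on_or_above (terrain n x v) (x i, (1 - u) * w + u * v j)"
    unfolding visible_def by blast
  then have "v i \<le> (1 - u) * w + u * v j"
    unfolding on_or_above_def using terrain_at_vertex[OF x ij'(1)] by auto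
  moreover have "b i \<le> v i" "v j \<le> t j" using v ij' unfolding realization_def by auto
  moreover have "u * v j \<le> u * t j" using u \<open>v j \<le> t j\<close> by simp
  ultimately have "b i \<le> (1 - u) * w + u * t j" by linarith
  then show ?thesis by (subst bridge_le_iff[where u = u and x = x]) (use u in auto)
qed

section \<open>Sufficiency of slopes increasing outwards\<close>

lemma on_or_above_mono: "on_or_above T (X, y) \<Longrightarrow> y \<le> y' \<Longrightarrow> on_or_above T (X, y')"
  unfolding on_or_above_def by force

text \<open>A chain of edges leading away from the tower, on the side given by the sign \<open>e\<close>; the edges'
  lines pass below the top of the tower.\<close>

lemma chain_visible:
  fixes d h :: "nat \<Rightarrow> real" and e :: real
  assumes edges: "\<And>m. m < N \<Longrightarrow> closed_segment (xk + e * d m, h m) (xk + e * d (Suc m), h (Suc m)) \<subseteq> T"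
    and d: "d 0 = 0" "\<And>m. m < N \<Longrightarrow> d m < d (Suc m)"
    and below: "\<And>m. m < N \<Longrightarrow> (h m - w) * d (Suc m) \<le> (h (Suc m) - w) * d m"
    and m: "m < N" and P: "P \<in> closed_segment (xk + e * d m, h m) (xk + e * d (Suc m), h (Suc m))"
  shows "visible T (xk, w) P"
proof -
  \<comment> \<open>Induction over the edges: \<open>a\<close> locates the target on edge
    \<open>m\<close>, and \<open>u\<close> locates a point on the sight line to it.\<close>
  have above: "on_or_above T (xk + e * (u * ((1 - a) * d m + a * d (Suc m))),
      w + u * ((1 - a) * h m + a * h (Suc m) - w))"
    if "m < N" "0 \<le> a" "a \<le> 1" "0 \<le> u" "u \<le> 1" for a u m
    using that
  proof (induction m arbitrary: a u)
    case (0 a u)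
    have "(xk + e * (u * a * d 1), (1 - u * a) * h 0 + u * a * h 1)
      \<in> closed_segment (xk + e * d 0, h 0) (xk + e * d 1, h 1)"
      unfolding closed_segment_def using 0 d(1)
      by (auto intro!: exI[of _ "u * a"] simp: algebra_simps mult_le_one)
    then have "(xk + e * (u * a * d 1), (1 - u * a) * h 0 + u * a * h 1) \<in> T"
      using edges[of 0] 0 by auto
    then have "on_or_above T (xk + e * (u * a * d 1), (1 - u * a) * h 0 + u * a * h 1)"
      unfolding on_or_above_def by auto
    moreover have "h 0 \<le> w"
      using below[of 0] d(2)[of 0] 0 unfolding d(1) by (simp add: mult_le_0_iff)
    then have "(1 - u) * h 0 \<le> (1 - u) * w" using 0 by (intro mult_left_mono) auto
    then have "(1 - u * a) * h 0 + u * a * h 1 \<le> w + u * ((1 - a) * h 0 + a * h 1 - w)"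
      by (simp add: algebra_simps)
    ultimately show ?case using d(1) by (auto intro: on_or_above_mono simp: algebra_simps)
  next
    case (Suc m a u)
    let ?m = "Suc m"
    define \<delta> where "\<delta> = d (Suc ?m) - d ?m"
    define D where "D = d ?m + a * \<delta>"
    define Y where "Y = h ?m + a * (h (Suc ?m) - h ?m)"
    have \<delta>: "0 < \<delta>" using d(2)[of ?m] Suc.prems unfolding \<delta>_def by auto
    have dpos: "0 < d ?m"
    proof -
      have "0 \<le> d m'" if "m' \<le> m" for m'
        using that
      proof (induction m')
        case (Suc m')
        then show ?case using d(2)[of m'] \<open>Suc m < N\<close> by auto
      qed (use d in auto)
      then show ?thesis using d(2)[of m] Suc.prems by fastforce
    qed
    have b: "0 \<le> d ?m * (h (Suc ?m) - h ?m) - \<delta> * (h ?m - w)"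
      using below[of ?m] Suc.prems unfolding \<delta>_def by (simp add: algebra_simps)
    have goal: "on_or_above T (xk + e * (u * D), w + u * (Y - w))"
    proof (cases "d ?m \<le> u * D")
      case True
      define a' where "a' = (u * D - d ?m) / \<delta>"
      have a': "a' * \<delta> = u * D - d ?m" unfolding a'_def using \<delta> by simp
      have "0 \<le> D" unfolding D_def using dpos \<delta> Suc.prems by simp
      then have "u * D \<le> D" using Suc.prems by (simp add: mult_left_le_one_le)
      moreover have "a * \<delta> \<le> \<delta>" using \<delta> Suc.prems by simp
      ultimately have "a' * \<delta> \<le> 1 * \<delta>" unfolding a' D_def by linarith
      then have a'01: "0 \<le> a'" "a' \<le> 1"
        using True \<delta> by (auto simp: a'_def)
      have "(xk + e * (u * D), h ?m + a' * (h (Suc ?m) - h ?m))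
        \<in> closed_segment (xk + e * d ?m, h ?m) (xk + e * d (Suc ?m), h (Suc ?m))"
      proof -
        have eq: "u * D = d ?m + a' * (d (Suc ?m) - d ?m)" using a' unfolding \<delta>_def by simp
        show ?thesis
          unfolding closed_segment_def eq using a'01
          by (auto intro!: exI[of _ a'] simp: algebra_simps)
      qed
      then have "on_or_above T (xk + e * (u * D), h ?m + a' * (h (Suc ?m) - h ?m))"
        using edges[of ?m] Suc.prems unfolding on_or_above_def by force
      moreover have "h ?m + a' * (h (Suc ?m) - h ?m) \<le> w + u * (Y - w)"
      proof (rule le_by_mult_diff[OF \<delta>])
        \<comment> \<open>The bound used next is in fact an equality: the gap times \<delta> is
          \<open>1 - u\<close> times the quantity in \<open>b\<close>. For the other case the factor
          is \<open>u * a\<close>.\<close>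
        show "0 \<le> (1 - u) * (d ?m * (h (Suc ?m) - h ?m) - \<delta> * (h ?m - w))"
          using b Suc.prems by simp
        have "(w + u * (Y - w) - (h ?m + a' * (h (Suc ?m) - h ?m))) * \<delta> =
          (w + u * (Y - w) - h ?m) * \<delta> - (u * D - d ?m) * (h (Suc ?m) - h ?m)"
          unfolding a'[symmetric] by (simp add: algebra_simps)
        then show "(1 - u) * (d ?m * (h (Suc ?m) - h ?m) - \<delta> * (h ?m - w)) \<le>
          (w + u * (Y - w) - (h ?m + a' * (h (Suc ?m) - h ?m))) * \<delta>"
          unfolding Y_def D_def by (simp add: algebra_simps)
      qed
      ultimately show ?thesis by (rule on_or_above_mono)
    next
      \<comment> \<open>The point is nearer than vertex \<open>m + 1\<close>, the inner end of the
        target's edge. There the sight line to the target runs on or above the sight line to that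
        vertex, which the induction hypothesis with \<open>a = 1\<close> handles.\<close>
      case False
      define u' where "u' = u * D / d ?m"
      have u': "u' * d ?m = u * D" unfolding u'_def using dpos by simp
      have "0 \<le> D" unfolding D_def using dpos \<delta> Suc.prems by simp
      then have "0 \<le> u'" "u' \<le> 1" using False dpos Suc.prems unfolding u'_def by auto
      then have "on_or_above T (xk + e * (u' * d ?m), w + u' * (h ?m - w))"
        using Suc.IH[of 1 u'] Suc.prems by simp
      moreover have "w + u' * (h ?m - w) \<le> w + u * (Y - w)"
      proof (rule le_by_mult_diff[OF dpos])
        show "0 \<le> u * (a * (d ?m * (h (Suc ?m) - h ?m) - \<delta> * (h ?m - w)))"
          using b Suc.prems by simp
        have "(w + u * (Y - w) - (w + u' * (h ?m - w))) * d ?m =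
          u * (Y - w) * d ?m - u * D * (h ?m - w)"
          unfolding u'[symmetric] by (simp add: algebra_simps)
        then show "u * (a * (d ?m * (h (Suc ?m) - h ?m) - \<delta> * (h ?m - w))) \<le>
          (w + u * (Y - w) - (w + u' * (h ?m - w))) * d ?m"
          unfolding Y_def D_def by (simp add: algebra_simps)
      qed
      ultimately show ?thesis unfolding u' by (rule on_or_above_mono)
    qed
    have "(1 - a) * d ?m + a * d (Suc ?m) = D" "(1 - a) * h ?m + a * h (Suc ?m) = Y"
      unfolding D_def Y_def \<delta>_def by (auto simp: algebra_simps)
    then show ?case using goal by simp
  qed
  obtain a where a: "0 \<le> a" "a \<le> 1"
    "P = (xk + e * ((1 - a) * d m + a * d (Suc m)), (1 - a) * h m + a * h (Suc m))"
    using P unfolding closed_segment_def by (auto simp: algebra_simps)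
  show ?thesis
    unfolding visible_def
  proof
    fix r assume "r \<in> closed_segment (xk, w) P"
    then obtain u where "0 \<le> u" "u \<le> 1"
      "r = (xk + e * (u * ((1 - a) * d m + a * d (Suc m))), w + u * ((1 - a) * h m + a * h (Suc m) - w))"
      unfolding closed_segment_def a(3) by (auto simp: algebra_simps)
    then show "on_or_above T r" using above[OF m a(1,2)] by simp
  qed
qed

text \<open>Outside the tower's vertex, \<open>\<sigma> i\<close> is the slope of the segment from the top of the tower to the
  vertex \<open>i\<close>, measured in the direction away from the tower.\<close>

lemma guards_if_slopes_mono:
  assumes x: "strict_mono_on {..<n} x" and k: "k < n" and vk: "v k \<le> w"
    and right: "\<And>i. k < i \<Longrightarrow> i < n \<Longrightarrow> v i = w + \<sigma> i * (x i - x k)"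
    and left: "\<And>i. i < k \<Longrightarrow> v i = w + \<sigma> i * (x k - x i)"
    and mono: "\<And>i j. k < i \<Longrightarrow> i \<le> j \<Longrightarrow> j < n \<Longrightarrow> \<sigma> i \<le> \<sigma> j"
      "\<And>i j. j \<le> i \<Longrightarrow> i < k \<Longrightarrow> \<sigma> i \<le> \<sigma> j"
  shows "guards (terrain n x v) (x k, w)"
proof -
  let ?T = "terrain n x v"
  have lt: "x a < x c" if "a < c" "c < n" for a c
    using strict_mono_onD[OF x, of a c] that by auto
  have edge: "closed_segment (x i, v i) (x (Suc i), v (Suc i)) \<subseteq> ?T" if "Suc i < n" for i
    using that unfolding terrain_def by auto
  have R: "visible ?T (x k, w) P"
    if "k \<le> i" "Suc i < n" "P \<in> closed_segment (x i, v i) (x (Suc i), v (Suc i))" for i P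
  proof (rule chain_visible[where N = "n - 1 - k" and e = 1 and d = "\<lambda>m. x (k + m) - x k"
        and h = "\<lambda>m. v (k + m)" and m = "i - k"])
    fix m assume m: "m < n - 1 - k"
    show "x (k + m) - x k < x (k + Suc m) - x k" using lt[of "k + m" "k + Suc m"] m by auto
    show "(v (k + m) - w) * (x (k + Suc m) - x k) \<le> (v (k + Suc m) - w) * (x (k + m) - x k)"
    proof (cases m)
      \<comment> \<open>At the first edge the inner distance is 0, and the condition reduces to
        \<open>v k \<le> w\<close>.\<close>
      case 0
      then show ?thesis using vk lt[of k "Suc k"] m by (simp add: mult_le_0_iff)
    next
      case (Suc m')
      have kn: "k + m < n" "k + Suc m < n" using m by linarith+
      then have "\<sigma> (k + m) * ((x (k + m) - x k) * (x (k + Suc m) - x k))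
        \<le> \<sigma> (k + Suc m) * ((x (k + m) - x k) * (x (k + Suc m) - x k))"
        using mono(1)[of "k + m" "k + Suc m"] lt[of k "k + m"] lt[of k "k + Suc m"] m Suc
        by (intro mult_right_mono mult_nonneg_nonneg) auto
      moreover have "v (k + m) - w = \<sigma> (k + m) * (x (k + m) - x k)"
        "v (k + Suc m) - w = \<sigma> (k + Suc m) * (x (k + Suc m) - x k)"
        using right[of "k + m"] right[of "k + Suc m"] kn Suc by auto
      ultimately show ?thesis by (simp only: mult_ac)
    qed
  qed (use that edge in auto)
  have L: "visible ?T (x k, w) P"
    if "i < k" "P \<in> closed_segment (x i, v i) (x (Suc i), v (Suc i))" for i P
  \<comment> \<open>Counted outwards from \<open>k\<close>, the edge from \<open>i\<close> to
    \<open>Suc i\<close> has number \<open>k - Suc i\<close> and is traversed backwards.\<close>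
  proof (rule chain_visible[where N = k and e = "-1" and d = "\<lambda>m. x k - x (k - m)"
        and h = "\<lambda>m. v (k - m)" and m = "k - Suc i"])
    fix m assume m: "m < k"
    then have s: "Suc (k - Suc m) = k - m" by auto
    show "closed_segment (x k + - 1 * (x k - x (k - m)), v (k - m))
      (x k + - 1 * (x k - x (k - Suc m)), v (k - Suc m)) \<subseteq> ?T"
      using edge[of "k - Suc m"] m k s by (simp add: closed_segment_commute)
    show "x k - x (k - m) < x k - x (k - Suc m)" using lt[of "k - Suc m" "k - m"] m k by auto
    show "(v (k - m) - w) * (x k - x (k - Suc m)) \<le> (v (k - Suc m) - w) * (x k - x (k - m))"
    proof (cases m)
      case 0
      then show ?thesis using vk lt[of "k - 1" k] m k by (simp add: mult_le_0_iff)
    next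
      case (Suc m')
      have "\<sigma> (k - m) * ((x k - x (k - m)) * (x k - x (k - Suc m)))
        \<le> \<sigma> (k - Suc m) * ((x k - x (k - m)) * (x k - x (k - Suc m)))"
        using mono(2)[of "k - Suc m" "k - m"] lt[of "k - m" k] lt[of "k - Suc m" k] m k Suc
        by (intro mult_right_mono mult_nonneg_nonneg) auto
      moreover have "v (k - m) - w = \<sigma> (k - m) * (x k - x (k - m))"
        "v (k - Suc m) - w = \<sigma> (k - Suc m) * (x k - x (k - Suc m))"
        using left[of "k - m"] left[of "k - Suc m"] m Suc by auto
      ultimately show ?thesis by (simp only: mult_ac)
    qed
  next
    have "k - (k - Suc i) = Suc i" "k - Suc (k - Suc i) = i" using that by auto
    then show "P \<in> closed_segment (x k + - 1 * (x k - x (k - (k - Suc i))), v (k - (k - Suc i)))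
      (x k + - 1 * (x k - x (k - Suc (k - Suc i))), v (k - Suc (k - Suc i)))"
      using that by (simp add: closed_segment_commute)
  qed (use that in auto)
  have V: "visible ?T (x k, w) (x k, v k)"
    unfolding visible_def
  proof
    fix r assume "r \<in> closed_segment (x k, w) (x k, v k)"
    then obtain u where u: "0 \<le> u" "u \<le> 1" "r = (x k, (1 - u) * w + u * v k)"
      unfolding closed_segment_def by (auto simp: algebra_simps)
    have "(1 - u) * v k \<le> (1 - u) * w" using u vk by (intro mult_left_mono) auto
    then have "v k \<le> (1 - u) * w + u * v k" by (simp add: algebra_simps)
    moreover have "(x k, v k) \<in> ?T" using k unfolding terrain_def vertices_def by auto
    ultimately show "on_or_above ?T r" unfolding on_or_above_def u by auto
  qed
  show ?thesis
    unfolding guards_def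
  proof
    fix P assume "P \<in> ?T"
    then consider i where "i < n" "P = (x i, v i)"
      | i where "Suc i < n" "P \<in> closed_segment (x i, v i) (x (Suc i), v (Suc i))"
      unfolding terrain_def vertices_def by auto
    then show "visible ?T (x k, w) P"
    proof cases
      case (1 i)
      consider "i = k" | "i < k" | "k < i" by linarith
      then show ?thesis
      proof cases
        case 3
        then show ?thesis using R[of "i - 1" P] 1 by auto
      qed (use 1 V L[of i P] in auto)
    next
      case (2 i)
      then show ?thesis using R[of i P] L[of i P] by (cases "k \<le> i") auto
    qed
  qed
qed

section \<open>The remaining loops\<close>

definition identity_perm :: com where
  "identity_perm = for_j (IStore ''p'' (IVar ''j'') (IVar ''j''))"

lemma wp_identity_perm:
  assumes n: "ivar s ''n'' = n" and r: "0 \<le> r" "r + 10 * int n + 6 \<le> u"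
    and Q: "\<And>u s'. frame {''j''} {} {''p''} {} s s' \<Longrightarrow> (\<forall>m<n. iarr s' ''p'' m = m) \<Longrightarrow> r \<le> u \<Longrightarrow> Q u s'"
  shows "wp identity_perm Q u s"
  unfolding identity_perm_def
proof (rule wp_for_j[where n = n and IV = "{''j''}" and RV = "{}" and IA = "{''p''}" and RA = "{}"
      and K = 3 and pot = "\<lambda>_. 0" and r = r and J = "\<lambda>j s'. \<forall>m<j. iarr s' ''p'' m = m"], goal_cases)
  case (5 j s' u r')
  have "frame {''j''} {} {''p''} {} s (s'\<lparr>iarr := (iarr s')(''p'' := f)\<rparr>)" for f
    using 5(2) unfolding frame_def by auto
  then show ?case using 5 by (auto simp: less_Suc_eq)
qed (use n r Q in auto)

definition reverse_perm :: com where
  "reverse_perm = Seq (IAssign ''i'' (IVar ''n''))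
    (for_j (Seq (IAssign ''i'' (Dec (IVar ''i''))) (IStore ''p'' (IVar ''j'') (IVar ''i''))))"

lemma wp_reverse_perm:
  assumes n: "ivar s ''n'' = n" and r: "0 \<le> r" "r + 13 * int n + 8 \<le> u"
    and Q: "\<And>u s'. frame {''j'', ''i''} {} {''p''} {} s s' \<Longrightarrow> (\<forall>m<n. iarr s' ''p'' m = n - Suc m) \<Longrightarrow>
      r \<le> u \<Longrightarrow> Q u s'"
  shows "wp reverse_perm Q u s"
proof -
  have frame_i: "frame {''j'', ''i''} {} {''p''} {} (s\<lparr>ivar := (ivar s)(''i'' := a)\<rparr>) s' \<longleftrightarrow>
    frame {''j'', ''i''} {} {''p''} {} s s'" for s' a
    unfolding frame_def by auto
  have "wp (for_j (Seq (IAssign ''i'' (Dec (IVar ''i''))) (IStore ''p'' (IVar ''j'') (IVar ''i''))))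
    Q (u - 2) (s\<lparr>ivar := (ivar s)(''i'' := n)\<rparr>)"
  proof (rule wp_for_j[where n = n and IV = "{''j'', ''i''}" and RV = "{}" and IA = "{''p''}" and RA = "{}"
        and K = 6 and pot = "\<lambda>_. 0" and r = r
        and J = "\<lambda>j s'. ivar s' ''i'' = n - j \<and> (\<forall>m<j. iarr s' ''p'' m = n - Suc m)"], goal_cases)
    case (5 j s' u r')
    have "frame {''j'', ''i''} {} {''p''} {} s (s'\<lparr>ivar := (ivar s')(''i'' := a), iarr := (iarr s')(''p'' := f)\<rparr>)" for f a
      using 5(2) unfolding frame_def by auto
    then show ?case using 5 by (auto simp: less_Suc_eq frame_i)
  qed (use n r Q in \<open>auto simp: frame_i\<close>)
  then show ?thesis using n by (simp add: reverse_perm_def)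
qed

text \<open>Starting from \<open>b\<close> ensures \<open>b k \<le> H k\<close>, which
  \<open>min (t k) (H k)\<close> needs in order to lie in the interval of \<open>k\<close>.\<close>

definition init_heights :: com where
  "init_heights = for_j (RStore ''H'' (IVar ''j'') (RArr ''b'' (IVar ''j'')))"

lemma wp_init_heights:
  assumes n: "ivar s ''n'' = n" and r: "0 \<le> r" "r + 11 * int n + 6 \<le> u"
    and Q: "\<And>u s'. frame {''j''} {} {} {''H''} s s' \<Longrightarrow> (\<forall>m<n. rarr s' ''H'' m = rarr s ''b'' m) \<Longrightarrow>
      r \<le> u \<Longrightarrow> Q u s'"
  shows "wp init_heights Q u s"
  unfolding init_heights_def
proof (rule wp_for_j[where n = n and IV = "{''j''}" and RV = "{}" and IA = "{}" and RA = "{''H''}"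
      and K = 4 and pot = "\<lambda>_. 0" and r = r and J = "\<lambda>j s'. \<forall>m<j. rarr s' ''H'' m = rarr s ''b'' m"], goal_cases)
  case (5 j s' u r')
  have "frame {''j''} {} {} {''H''} s (s'\<lparr>rarr := (rarr s')(''H'' := f)\<rparr>)" for f
    using 5(2) unfolding frame_def by auto
  then show ?case using 5 frameD(4)[OF 5(2), of "''b''"] by (auto simp: less_Suc_eq)
qed (use n r Q in auto)

text \<open>Minimising \<open>H k - t k\<close> also minimises \<open>max 0 (H k - t k)\<close>, as
  truncation at 0 is monotone.\<close>

definition select :: com where
  "select = Seq (IAssign ''k'' (IConst 0)) (for_j
    (Cond (RLess (Minus (RArr ''H'' (IVar ''j'')) (RArr ''t'' (IVar ''j'')))
        (Minus (RArr ''H'' (IVar ''k'')) (RArr ''t'' (IVar ''k''))))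
      (IAssign ''k'' (IVar ''j'')) Skip))"

lemma wp_select:
  fixes s
  defines "H \<equiv> rarr s ''H''" and "t \<equiv> rarr s ''t''"
  assumes n: "ivar s ''n'' = n" "1 \<le> n" and r: "0 \<le> r" "r + 30 * int n + 8 \<le> u"
    and Q: "\<And>u s'. frame {''j'', ''k''} {} {} {} s s' \<Longrightarrow> ivar s' ''k'' < n \<Longrightarrow>
      (\<forall>m<n. H (ivar s' ''k'') - t (ivar s' ''k'') \<le> H m - t m) \<Longrightarrow> r \<le> u \<Longrightarrow> Q u s'"
  shows "wp select Q u s"
proof -
  have frame_k: "frame {''j'', ''k''} {} {} {} (s\<lparr>ivar := (ivar s)(''k'' := a)\<rparr>) s' \<longleftrightarrow>
    frame {''j'', ''k''} {} {} {} s s'" for s' a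
    unfolding frame_def by auto
  have "wp (for_j
    (Cond (RLess (Minus (RArr ''H'' (IVar ''j'')) (RArr ''t'' (IVar ''j'')))
        (Minus (RArr ''H'' (IVar ''k'')) (RArr ''t'' (IVar ''k''))))
      (IAssign ''k'' (IVar ''j'')) Skip)) Q (u - 2) (s\<lparr>ivar := (ivar s)(''k'' := 0)\<rparr>)"
  proof (rule wp_for_j[where n = n and IV = "{''j'', ''k''}" and RV = "{}" and IA = "{}" and RA = "{}"
        and K = 20 and pot = "\<lambda>_. 0" and r = r
        and J = "\<lambda>j s'. ivar s' ''k'' < n \<and> (\<forall>m<j. H (ivar s' ''k'') - t (ivar s' ''k'') \<le> H m - t m)"], goal_cases)
    case (5 j s' u r')
    have fr: "frame {''j'', ''k''} {} {} {} s s'" using 5(2) by (simp add: frame_k)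
    have "frame {''j'', ''k''} {} {} {} s (s'\<lparr>ivar := (ivar s')(''k'' := a)\<rparr>)" for a
      using fr unfolding frame_def by auto
    then show ?case using 5 frameD(4)[OF fr] fr by (auto simp: less_Suc_eq frame_k H_def t_def)
  qed (use n r Q in \<open>auto simp: frame_k\<close>)
  then show ?thesis by (simp add: select_def)
qed

text \<open>\<open>y\<close> is the distance from the tower, negative on the other side. Indices
  with \<open>y \<le> 0\<close> are left alone, so the two runs fill disjoint sides and spare
  \<open>k\<close>. The flag \<open>f\<close> tells whether \<open>z\<close> holds a slope yet;
  slopes may be negative, so 0 would be a wrong start for the running maximum.\<close>

definition fill :: com where
  "fill = Seq (IAssign ''f'' (IConst 0)) (for_j
    (Seq (RAssign ''y'' (Times (RVar ''e'') (Minus (RArr ''x'' (IArr ''p'' (IVar ''j''))) (RArr ''x'' (IVar ''k'')))))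
    (Cond (RLess (RConst 0) (RVar ''y''))
      (Seq (RAssign ''c'' (Divide (Minus (RArr ''b'' (IArr ''p'' (IVar ''j''))) (RVar ''w'')) (RVar ''y'')))
      (Seq (Cond (BAnd (ILess (IConst 0) (IVar ''f'')) (BNot (RLess (RVar ''z'') (RVar ''c''))))
          Skip (Seq (RAssign ''z'' (RVar ''c'')) (IAssign ''f'' (IConst 1))))
        (RStore ''v'' (IArr ''p'' (IVar ''j'')) (Plus (RVar ''w'') (Times (RVar ''z'') (RVar ''y''))))))
      Skip)))"

lemma wp_fill:
  fixes s
  defines "p \<equiv> iarr s ''p''" and "v \<equiv> rarr s ''v''" and "w \<equiv> rvar s ''w''"
  fixes Y B :: "nat \<Rightarrow> real"
  defines "G \<equiv> \<lambda>m. (B m - w) / Y m"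
  assumes Y: "\<And>m. m < n \<Longrightarrow> rvar s ''e'' * (rarr s ''x'' (p m) - rarr s ''x'' (ivar s ''k'')) = Y m"
    and B: "\<And>m. m < n \<Longrightarrow> rarr s ''b'' (p m) = B m"
    and n: "ivar s ''n'' = n" and p: "inj_on p {0..<n}" and r: "0 \<le> r" "r + 60 * int n + 8 \<le> u"
    and Q: "\<And>u s'. frame {''j'', ''f''} {''y'', ''c'', ''z''} {} {''v''} s s' \<Longrightarrow>
      (\<forall>m<n. rarr s' ''v'' (p m) =
        (if 0 < Y m then w + Max (G ` {m'. m' < Suc m \<and> 0 < Y m'}) * Y m else v (p m))) \<Longrightarrow>
      r \<le> u \<Longrightarrow> Q u s'"
  shows "wp fill Q u s"
proof -
  let ?fr = "frame {''j'', ''f''} {''y'', ''c'', ''z''} {} {''v''}"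
  let ?S = "\<lambda>j. {m'. m' < j \<and> 0 < Y m'}"
  let ?J = "\<lambda>j s'. (ivar s' ''f'' = 0 \<longleftrightarrow> ?S j = {}) \<and> (?S j \<noteq> {} \<longrightarrow> rvar s' ''z'' = Max (G ` ?S j)) \<and>
    (\<forall>m<n. rarr s' ''v'' (p m) = (if m < j \<and> 0 < Y m then w + Max (G ` ?S (Suc m)) * Y m else v (p m)))"
  have frame_f: "?fr (s\<lparr>ivar := (ivar s)(''f'' := a)\<rparr>) s' \<longleftrightarrow> ?fr s s'" for s' a
    unfolding frame_def by auto
  let ?body = "Seq (RAssign ''y'' (Times (RVar ''e'') (Minus (RArr ''x'' (IArr ''p'' (IVar ''j''))) (RArr ''x'' (IVar ''k'')))))
    (Cond (RLess (RConst 0) (RVar ''y''))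
      (Seq (RAssign ''c'' (Divide (Minus (RArr ''b'' (IArr ''p'' (IVar ''j''))) (RVar ''w'')) (RVar ''y'')))
      (Seq (Cond (BAnd (ILess (IConst 0) (IVar ''f'')) (BNot (RLess (RVar ''z'') (RVar ''c''))))
          Skip (Seq (RAssign ''z'' (RVar ''c'')) (IAssign ''f'' (IConst 1))))
        (RStore ''v'' (IArr ''p'' (IVar ''j'')) (Plus (RVar ''w'') (Times (RVar ''z'') (RVar ''y''))))))
      Skip)"
  have "wp (for_j ?body) Q (u - 2) (s\<lparr>ivar := (ivar s)(''f'' := 0)\<rparr>)"
  proof (rule wp_for_j[where n = n and IV = "{''j'', ''f''}" and RV = "{''y'', ''c'', ''z''}" and IA = "{}"
        and RA = "{''v''}" and K = 53 and pot = "\<lambda>_. 0" and r = r and J = ?J], goal_cases)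
    case (5 j s' u r')
    have fr: "?fr s s'" using 5(2) by (simp add: frame_f)
    note fD = frameD[OF fr]
    have [simp]: "iarr s' ''p'' = p" "rvar s' ''w'' = w" "rvar s' ''e'' = rvar s ''e''" "rarr s' ''x'' = rarr s ''x''"
      "rarr s' ''b'' = rarr s ''b''" "ivar s' ''k'' = ivar s ''k''" "ivar s' ''j'' = j"
      using fD 5(4) by (auto simp: p_def w_def)
    note J = 5(1)
    have SSuc: "?S (Suc j) = (if 0 < Y j then insert j (?S j) else ?S j)"
      by (auto simp: less_Suc_eq)
    have pj: "p m \<noteq> p j" if "m < n" "m \<noteq> j" for m
      using inj_onD[OF p, of m j] that 5(3) by auto
    have Yj [simp]: "rvar s ''e'' * (rarr s ''x'' (p j) - rarr s ''x'' (ivar s ''k'')) = Y j"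
      "(rarr s ''b'' (p j) - w) / Y j = G j"
      using Y[OF 5(3)] B[OF 5(3)] by (simp_all add: G_def)
    let ?post = "\<lambda>u' s''. ivar s'' ''j'' = j \<and> ?fr s s'' \<and> ?J (Suc j) s'' \<and> r' \<le> u'"
    define R where "R = ?post"
    have "wp ?body R u s'"
    proof (cases "0 < Y j")
      case False
      have "?fr s (s'\<lparr>rvar := (rvar s')(''y'' := Y j)\<rparr>)" using fr unfolding frame_def by auto
      moreover have "?J (Suc j) (s'\<lparr>rvar := (rvar s')(''y'' := Y j)\<rparr>)"
        using J False SSuc by (auto simp: less_Suc_eq)
      ultimately have "R u' (s'\<lparr>rvar := (rvar s')(''y'' := Y j)\<rparr>)" if "r' \<le> u'" for u'
        using that by (simp add: R_def)
      then show ?thesis using False 5(5,6) by simp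
    next
      case True
      define z where "z = Max (G ` ?S (Suc j))"
      have fin: "finite (G ` ?S j)" by simp
      have img: "G ` ?S (Suc j) = insert (G j) (G ` ?S j)" using SSuc True by simp
      have z: "z = (if ivar s' ''f'' \<noteq> 0 \<and> \<not> rvar s' ''z'' < G j then rvar s' ''z'' else G j)"
      proof (cases "?S j = {}")
        case e: True
        then show ?thesis using J unfolding z_def img e by simp
      next
        case ne: False
        then have "z = max (G j) (Max (G ` ?S j))" unfolding z_def img using Max_insert[OF fin] by blast
        moreover have "ivar s' ''f'' \<noteq> 0" using ne unfolding conjunct1[OF J] .
        moreover note conjunct1[OF conjunct2[OF J], rule_format, OF ne, symmetric]
        ultimately have "z = max (G j) (rvar s' ''z'')" "ivar s' ''f'' \<noteq> 0" by simp_all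
        then show ?thesis by (simp add: max_def)
      qed
      have f': "?S (Suc j) \<noteq> {}" using True by auto
      let ?v = "(rarr s' ''v'')(p j := w + z * Y j)"
      have v: "\<forall>m<n. ?v (p m) = (if m < Suc j \<and> 0 < Y m then w + Max (G ` ?S (Suc m)) * Y m else v (p m))"
        using J True pj by (auto simp: less_Suc_eq z_def)
      have fr': "?fr s (s'\<lparr>rvar := (rvar s')(''y'' := b, ''c'' := c, ''z'' := d), ivar := (ivar s')(''f'' := a),
          rarr := (rarr s')(''v'' := g)\<rparr>)"
        "?fr s (s'\<lparr>rvar := (rvar s')(''y'' := b, ''c'' := c),
          rarr := (rarr s')(''v'' := g)\<rparr>)" for a b c d g
        using fr unfolding frame_def by auto
      show ?thesis
      proof (cases "ivar s' ''f'' \<noteq> 0 \<and> \<not> rvar s' ''z'' < G j")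
        case c: True
        then have zz: "z = rvar s' ''z''" using z by simp
        have "?post u' (s'\<lparr>rvar := (rvar s')(''y'' := Y j, ''c'' := G j), rarr := (rarr s')(''v'' := ?v)\<rparr>)"
          if "r' \<le> u'" for u'
          using fr' f' c v zz that by (simp add: z_def[symmetric])
        then have "R u' (s'\<lparr>rvar := (rvar s')(''y'' := Y j, ''c'' := G j),
            rarr := (rarr s')(''v'' := (rarr s' ''v'')(p j := w + rvar s' ''z'' * Y j))\<rparr>)"
          if "r' \<le> u'" for u'
          using that unfolding R_def zz by blast
        then show ?thesis using True c 5(5,6) by simp
      next
        case c: False
        then have zz: "z = G j" using z by auto
        have "?post u' (s'\<lparr>rvar := (rvar s')(''y'' := Y j, ''c'' := G j, ''z'' := G j),
            ivar := (ivar s')(''f'' := 1), rarr := (rarr s')(''v'' := ?v)\<rparr>)"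
          if "r' \<le> u'" for u'
          using fr' f' v zz that by (simp add: z_def[symmetric])
        then have "R u' (s'\<lparr>rvar := (rvar s')(''y'' := Y j, ''c'' := G j, ''z'' := G j),
            ivar := (ivar s')(''f'' := 1),
            rarr := (rarr s')(''v'' := (rarr s' ''v'')(p j := w + G j * Y j))\<rparr>)"
          if "r' \<le> u'" for u'
          using that unfolding R_def zz by blast
        then show ?thesis using True c 5(5,6) by auto
      qed
    qed
    then show ?case
      by (rule wp_mono) (auto simp: frame_f frame_def R_def)
  qed (use n r Q in \<open>auto simp: frame_f v_def\<close>)
  then show ?thesis by (simp add: fill_def)
qed

section \<open>The algorithm\<close>

definition outward :: "nat \<Rightarrow> nat \<Rightarrow> nat \<Rightarrow> nat \<Rightarrow> bool" where
  "outward n k i j \<longleftrightarrow> k < i \<and> i < j \<and> j < n \<or> j < i \<and> i < k \<and> k < n"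

text \<open>Deliberately weaker than being the largest bridge height: any value up to
  \<open>t k\<close> will do, since the tower then has height 0.\<close>

definition tower_bound ::
  "(nat \<Rightarrow> real) \<Rightarrow> (nat \<Rightarrow> real) \<Rightarrow> (nat \<Rightarrow> real) \<Rightarrow> nat \<Rightarrow> nat \<Rightarrow> real \<Rightarrow> bool" where
  "tower_bound x b t n k h \<longleftrightarrow> b k \<le> h \<and>
    (\<forall>i j. outward n k i j \<longrightarrow> bridge x b t i j (x k) \<le> h) \<and>
    (h \<le> t k \<or> (\<exists>i j. outward n k i j \<and> h \<le> bridge x b t i j (x k)))"

lemma sided_max_cong:
  assumes "sided_max X B T n m h0 h" "m < n"
    "\<And>i. i < n \<Longrightarrow> X i = X' i \<and> B i = B' i \<and> T i = T' i"
  shows "sided_max X' B' T' n m h0 h"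
proof -
  have *: "bridge X B T i j (X m) = bridge X' B' T' i j (X' m)" if "i < n" "j < n" for i j
    using assms that by (auto intro!: bridge_cong)
  have **: "bridge X B T i j (X m) = bridge X' B' T' i j (X' m)" if "m < i \<and> i < j \<and> j < n" for i j
    by (rule *) (use that in auto)
  show ?thesis
    using assms(1) assms(3)[OF assms(2)] ** unfolding sided_max_def by (metis)
qed

text \<open>Reflection negates both the run of the slope and the distance to \<open>z\<close>; the
  signs cancel.\<close>

lemma bridge_mirror:
  "bridge (\<lambda>m. - x (f m)) (\<lambda>m. b (f m)) (\<lambda>m. t (f m)) i j (- z) = bridge x b t (f i) (f j) z"
proof -
  have "- x (f j) - - x (f i) = - (x (f j) - x (f i))" "- z - - x (f i) = - (z - x (f i))"
    by simp_all
  then show ?thesis unfolding bridge_def slope_def by (simp only: mult_minus_right divide_minus_right mult_minus_left minus_minus)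
qed

text \<open>The reflected run starts from the results of the first one, hence \<open>h1\<close> as
  its initial value; \<open>n - Suc m\<close> is its own inverse below \<open>n\<close>.\<close>

lemma tower_boundI:
  assumes right: "sided_max x b t n k (b k) h1"
    and left: "sided_max (\<lambda>m. - x (n - Suc m)) (\<lambda>m. b (n - Suc m)) (\<lambda>m. t (n - Suc m)) n (n - Suc k) h1 h"
    and k: "k < n" and bt: "b k \<le> t k"
  shows "tower_bound x b t n k h"
proof -
  let ?f = "\<lambda>m. n - Suc m"
  have ff: "?f (?f i) = i" if "i < n" for i using that by auto
  have br: "bridge (\<lambda>m. - x (?f m)) (\<lambda>m. b (?f m)) (\<lambda>m. t (?f m)) i j (- x (?f (?f k))) =
    bridge x b t (?f i) (?f j) (x k)" for i j
    using bridge_mirror[of x ?f b t i j "x k"] ff[OF k] by simp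
  have h1: "b k \<le> h1" "h1 \<le> h" using left right unfolding sided_max_def by auto
  have "bridge x b t i j (x k) \<le> h" if ij: "outward n k i j" for i j
  proof (cases "k < i")
    case True
    then have "bridge x b t i j (x k) \<le> h1" using ij right unfolding sided_max_def outward_def by auto
    then show ?thesis using h1 by simp
  next
    case False
    then have ij': "j < i" "i < k" using ij unfolding outward_def by auto
    then have "?f k < ?f i" "?f i < ?f j" "?f j < n" using k by auto
    then have "bridge x b t (?f (?f i)) (?f (?f j)) (x k) \<le> h"
      using left unfolding sided_max_def br by blast
    then show ?thesis using ff ij' k by auto
  qed
  moreover have "h \<le> t k \<or> (\<exists>i j. outward n k i j \<and> h \<le> bridge x b t i j (x k))"
  proof -
    have "h = h1 \<or> h \<le> t (?f (?f k)) \<or>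
        (\<exists>i j. ?f k < i \<and> i < j \<and> j < n \<and> h \<le> bridge x b t (?f i) (?f j) (x k))"
      using left unfolding sided_max_def br by (elim conjE)
    then consider "h = h1" | "h \<le> t k"
      | i j where "?f k < i" "i < j" "j < n" "h \<le> bridge x b t (?f i) (?f j) (x k)"
      unfolding ff[OF k] by auto
    then show ?thesis
    proof cases
      case 1
      then show ?thesis using right bt unfolding sided_max_def outward_def by auto
    next
      case (3 i j)
      then have "outward n k (?f i) (?f j)" using k unfolding outward_def by auto
      then show ?thesis using 3 by blast
    qed simp
  qed
  ultimately show ?thesis using h1 unfolding tower_bound_def by auto
qed

text \<open>Either \<open>H k \<le> t k\<close> and the bound is 0, or \<open>H k\<close> is at most
  some bridge, which the top must reach, while the base is at most \<open>t k\<close>.\<close>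

lemma tower_bound_le:
  assumes T: "imprecise_terrain n x b t" and H: "\<And>k. k < n \<Longrightarrow> tower_bound x b t n k (H k)"
    and v: "realization n b t v" and tower: "discrete_watchtower n x v p q"
  shows "\<exists>k<n. max 0 (H k - t k) \<le> dist p q"
proof -
  obtain k where k: "k < n" "p = (x k, v k)"
    using tower unfolding discrete_watchtower_def vertices_def by auto
  obtain w where w: "q = (x k, w)" "v k \<le> w" "guards (terrain n x v) (x k, w)"
    using tower k unfolding discrete_watchtower_def watchtower_def by (cases q) auto
  have x: "strict_mono_on {..<n} x" using T unfolding imprecise_terrain_def by simp
  have vk: "v k \<le> t k" using v k unfolding realization_def by auto
  have d: "dist p q = w - v k" unfolding k w using w(2) by (simp add: dist_Pair_Pair dist_real_def)
  have "H k \<le> t k \<or> H k \<le> w"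
    using H[OF k(1)] guards_bridge[OF x v w(3)] unfolding tower_bound_def outward_def
    by (meson order_trans)
  then have "max 0 (H k - t k) \<le> dist p q" using vk w(2) unfolding d by auto
  then show ?thesis using k by blast
qed

text \<open>The least slope for vertex \<open>i\<close> that clears its own bottom and does not fall
  below the slopes needed nearer to the tower. The absolute value measures outwards on both
  sides.\<close>

definition fan_slope ::
  "(nat \<Rightarrow> real) \<Rightarrow> (nat \<Rightarrow> real) \<Rightarrow> nat \<Rightarrow> real \<Rightarrow> nat \<Rightarrow> real" where
  "fan_slope x b k w i =
    Max ((\<lambda>m. (b m - w) / \<bar>x m - x k\<bar>) ` (if k < i then {k<..i} else {i..<k}))"

text \<open>The fan clears the bottoms and has monotone slopes by construction. It stays below the
  tops because its maximum is attained at some \<open>m\<close>: for \<open>m = i\<close> by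
  \<open>b i \<le> t i\<close>, otherwise by the bound on the bridge from \<open>m\<close> to
  \<open>i\<close>.\<close>

lemma fan_optimal:
  assumes T: "imprecise_terrain n x b t" and H: "\<And>k. k < n \<Longrightarrow> tower_bound x b t n k (H k)"
    and k: "k < n" and least: "\<And>m. m < n \<Longrightarrow> H k - t k \<le> H m - t m"
    and vk: "v k = min (t k) (H k)"
    and v: "\<And>i. i < n \<Longrightarrow> i \<noteq> k \<Longrightarrow> v i = H k + fan_slope x b k (H k) i * \<bar>x i - x k\<bar>"
  shows "optimistic_shortest_discrete_watchtower n x b t v (x k, v k) (x k, H k)"
proof -
  define w where "w = H k"
  let ?\<sigma> = "fan_slope x b k w"
  let ?S = "\<lambda>i. if k < i then {k<..i} else {i..<k}"
  let ?g = "\<lambda>m. (b m - w) / \<bar>x m - x k\<bar>"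
  have x: "strict_mono_on {..<n} x" and bt: "\<And>i. i < n \<Longrightarrow> b i \<le> t i"
    using T unfolding imprecise_terrain_def by auto
  have lt: "x a < x c" if "a < c" "c < n" for a c
    using strict_mono_onD[OF x, of a c] that by auto
  have dpos: "0 < \<bar>x i - x k\<bar>" if "i < n" "i \<noteq> k" for i
    using lt[of i k] lt[of k i] that k by (cases "i < k") auto
  have tb: "tower_bound x b t n k w" unfolding w_def by (rule H[OF k])
  have ge: "?g m \<le> ?\<sigma> i" if "m \<in> ?S i" for m i
    unfolding fan_slope_def by (rule Max_ge) (use that in auto)
  have attained: "\<exists>m\<in>?S i. ?\<sigma> i = ?g m" if "i \<noteq> k" for i
  proof -
    have "?\<sigma> i \<in> ?g ` ?S i" unfolding fan_slope_def by (rule Max_in) (use that in auto)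
    then show ?thesis by auto
  qed
  have mono: "?\<sigma> i \<le> ?\<sigma> j" if "?S i \<subseteq> ?S j" "i \<noteq> k" for i j
  proof -
    obtain m where "m \<in> ?S i" "?\<sigma> i = ?g m" using attained[OF \<open>i \<noteq> k\<close>] by (elim bexE)
    then show ?thesis using ge[OF subsetD[OF \<open>?S i \<subseteq> ?S j\<close>]] by simp
  qed
  have fan: "b i \<le> v i \<and> v i \<le> t i" if i: "i < n" "i \<noteq> k" for i
  proof
    have vi: "v i = w + ?\<sigma> i * \<bar>x i - x k\<bar>" using v i by (simp add: w_def)
    have "i \<in> ?S i" using i by auto
    from ge[OF this] have "b i - w \<le> ?\<sigma> i * \<bar>x i - x k\<bar>"
      using dpos[OF i] by (simp add: pos_divide_le_eq)
    then show "b i \<le> v i" unfolding vi by simp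
    obtain m where m: "m \<in> ?S i" "?\<sigma> i = ?g m" using attained i by blast
    have mn: "m < n" "m \<noteq> k" using m i k by (auto split: if_splits)
    have "?\<sigma> i * \<bar>x i - x k\<bar> \<le> t i - w"
    proof (cases "m = i")
      case True
      then show ?thesis using m(2) dpos[OF i] bt[OF i(1)] by simp
    next
      case False
      then have out: "outward n k m i" using m i k unfolding outward_def by (auto split: if_splits)
      obtain u where u: "x m = x k + u * (x i - x k)" "0 < u" "u < 1" "x i \<noteq> x k"
        using between_cases[OF x out[unfolded outward_def]] by blast
      have "bridge x b t m i (x k) \<le> w" using tb out unfolding tower_bound_def by blast
      then have "b m - w \<le> u * (t i - w)"
        using bridge_le_iff[OF u(1,3,4), of b t w] by (simp add: algebra_simps)
      moreover have "\<bar>x m - x k\<bar> = u * \<bar>x i - x k\<bar>" using u(1,2) by (simp add: abs_mult)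
      then have "?\<sigma> i * \<bar>x i - x k\<bar> = (b m - w) / u" using m(2) u(2) dpos[OF i] by simp
      ultimately show ?thesis using u(2) by (simp add: pos_divide_le_eq mult.commute)
    qed
    then show "v i \<le> t i" unfolding vi by simp
  qed
  have vkk: "v k \<le> w" "b k \<le> v k" "v k \<le> t k"
    using vk tb bt[OF k] unfolding w_def tower_bound_def by auto
  have real: "realization n b t v"
    unfolding realization_def using fan vkk by (metis atLeastAtMost_iff)
  have "guards (terrain n x v) (x k, w)"
  proof (rule guards_if_slopes_mono[where \<sigma> = ?\<sigma>, OF x k])
    show "v k \<le> w" by (rule vkk)
    show "v i = w + ?\<sigma> i * (x i - x k)" if "k < i" "i < n" for i
      using v[of i] lt[of k i] that by (simp add: w_def)
    show "v i = w + ?\<sigma> i * (x k - x i)" if "i < k" for i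
      using v[of i] lt[of i k] that k by (simp add: w_def)
    show "?\<sigma> i \<le> ?\<sigma> j" if "k < i" "i \<le> j" "j < n" for i j
      using that by (intro mono) auto
    show "?\<sigma> i \<le> ?\<sigma> j" if "j \<le> i" "i < k" for i j
      using that by (intro mono) auto
  qed
  then have tower: "discrete_watchtower n x v (x k, v k) (x k, w)"
    using k vkk(1) unfolding discrete_watchtower_def watchtower_def terrain_def vertices_def by auto
  have d: "dist (x k, v k) (x k, w) = max 0 (H k - t k)"
    using vk by (simp add: dist_Pair_Pair dist_real_def w_def)
  have "dist (x k, v k) (x k, w) \<le> dist p q"
    if v': "realization n b t v'" "discrete_watchtower n x v' p q" for v' p q
  proof -
    obtain m where "m < n" "max 0 (H m - t m) \<le> dist p q"
      using tower_bound_le[OF T H v'] by blast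
    then show ?thesis using least[of m] unfolding d by auto
  qed
  then show ?thesis
    using real tower unfolding optimistic_shortest_discrete_watchtower_def w_def by blast
qed

section \<open>The running maxima of the program as fan slopes\<close>

lemma fan_slope_right:
  assumes x: "strict_mono_on {..<n} x" and i: "i < n" "k < i"
  shows "Max ((\<lambda>m. (b m - w) / (x m - x k)) ` {m. m < Suc i \<and> 0 < x m - x k}) = fan_slope x b k w i"
proof -
  have lt: "x a < x c" if "a < c" "c < n" for a c
    using strict_mono_onD[OF x, of a c] that by auto
  have "{m. m < Suc i \<and> 0 < x m - x k} = {k<..i}"
    using lt[of k] lt[of _ k] i by (auto, metis less_asym not_less_iff_gr_or_eq order_less_trans)
  then have "(\<lambda>m. (b m - w) / (x m - x k)) ` {m. m < Suc i \<and> 0 < x m - x k} =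
      (\<lambda>m. (b m - w) / \<bar>x m - x k\<bar>) ` {k<..i}"
    using lt i by (intro image_cong) force+
  then show ?thesis unfolding fan_slope_def using i by simp
qed

lemma fan_slope_left:
  assumes x: "strict_mono_on {..<n} x" and k: "k < n" and i: "i < k"
  shows "Max ((\<lambda>m. (b (n - Suc m) - w) / (- 1 * (x (n - Suc m) - x k))) `
      {m. m < Suc (n - Suc i) \<and> 0 < - 1 * (x (n - Suc m) - x k)}) = fan_slope x b k w i"
proof -
  let ?f = "\<lambda>m. n - Suc m"
  have lt: "x a < x c" if "a < c" "c < n" for a c
    using strict_mono_onD[OF x, of a c] that by auto
  have iff: "x m < x k \<longleftrightarrow> m < k" if "m < n" for m
    using lt[of k m] lt[of m k] that k by (metis less_asym not_less_iff_gr_or_eq)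
  have "{m. m < Suc (n - Suc i) \<and> 0 < - 1 * (x (?f m) - x k)} = ?f ` {i..<k}"
  proof (intro set_eqI iffI)
    fix m assume "m \<in> {m. m < Suc (n - Suc i) \<and> 0 < - 1 * (x (?f m) - x k)}"
    then have m: "m < Suc (n - Suc i)" "x (?f m) < x k" by auto
    then have "?f m < k" using iff[of "?f m"] k i by auto
    then have "?f m \<in> {i..<k}" "m = ?f (?f m)" using m k i by auto
    then show "m \<in> ?f ` {i..<k}" by blast
  next
    fix m assume "m \<in> ?f ` {i..<k}"
    then obtain j where j: "m = ?f j" "i \<le> j" "j < k" by auto
    then have "?f m = j" using k by auto
    then show "m \<in> {m. m < Suc (n - Suc i) \<and> 0 < - 1 * (x (?f m) - x k)}"
      using j lt[of j k] k i by auto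
  qed
  moreover have "(\<lambda>m. (b (?f m) - w) / (- 1 * (x (?f m) - x k))) ` ?f ` {i..<k} =
      (\<lambda>m. (b m - w) / \<bar>x m - x k\<bar>) ` {i..<k}"
    unfolding image_image
  proof (rule image_cong)
    fix j assume "j \<in> {i..<k}"
    then have "?f (?f j) = j" "x j < x k" using k lt by auto
    then show "(b (?f (?f j)) - w) / (- 1 * (x (?f (?f j)) - x k)) = (b j - w) / \<bar>x j - x k\<bar>"
      by simp
  qed simp
  ultimately show ?thesis unfolding fan_slope_def using i by simp
qed

text \<open>The left side is filled first, while \<open>p\<close> and \<open>e\<close> are still
  those of the reflected run; both are then reset for the right side.\<close>

definition watchtower_program :: com where
  "watchtower_program =
    Seq identity_perm (Seq (RAssign ''e'' (RConst 1)) (Seq init_heights (Seq one_side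
    (Seq reverse_perm (Seq (RAssign ''e'' (RConst (- 1))) (Seq one_side
    (Seq select (Seq (RAssign ''w'' (RArr ''H'' (IVar ''k'')))
    (Seq (Cond (RLess (RArr ''t'' (IVar ''k'')) (RVar ''w''))
        (RStore ''v'' (IVar ''k'') (RArr ''t'' (IVar ''k'')))
        (RStore ''v'' (IVar ''k'') (RVar ''w'')))
    (Seq (RAssign ''h'' (Minus (RVar ''w'') (RArr ''v'' (IVar ''k''))))
    (Seq fill (Seq identity_perm (Seq (RAssign ''e'' (RConst 1)) fill)))))))))))))"


lemma wp_watchtower_program:
  assumes T: "imprecise_terrain n x b t"
  shows "wp watchtower_program (\<lambda>u s. 0 \<le> u \<and> solved n x b t s) (3000 * int n) (input_state n x b t)"
proof -
  let ?Q = "\<lambda>u s. 0 \<le> u \<and> solved n x b t s"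
  define s0 where "s0 = input_state n x b t"
  have n: "1 \<le> n" and x: "strict_mono_on {..<n} x" and bt: "\<And>i. i < n \<Longrightarrow> b i \<le> t i"
    using T unfolding imprecise_terrain_def by auto
  have lt: "x a < x c" if "a < c" "c < n" for a c
    using strict_mono_onD[OF x, of a c] that by auto
  have n0: "ivar s0 ''n'' = n" unfolding s0_def input_state_def by simp
  have in0: "rarr s0 ''x'' i = x i" "rarr s0 ''b'' i = b i" "rarr s0 ''t'' i = t i" if "i < n" for i
    using that unfolding s0_def input_state_def by auto
  let ?F = "frame {''a'', ''i'', ''q'', ''l'', ''j'', ''k'', ''f''} {''y'', ''z'', ''e'', ''w'', ''h'', ''c''}
    {''N'', ''P'', ''p''} {''C'', ''D'', ''X'', ''B'', ''T'', ''H'', ''v''} s0"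
  have keep: "ivar s ''n'' = n" "\<And>i. i < n \<Longrightarrow> rarr s ''x'' i = x i" "\<And>i. i < n \<Longrightarrow> rarr s ''b'' i = b i"
    "\<And>i. i < n \<Longrightarrow> rarr s ''t'' i = t i" if "?F s" for s
    using frameD(1,4)[OF that] n0 in0 by simp_all
  have "wp watchtower_program ?Q (3000 * int n) s0"
    unfolding watchtower_program_def wp_Seq
  \<comment> \<open>Each stage passes on a fixed multiple of \<open>n\<close>; additive constants
    are absorbed because \<open>1 \<le> n\<close>.\<close>
  proof (rule wp_identity_perm[OF n0, where r = "2900 * int n"], goal_cases)
    case (3 u1 s1)
    let ?s1 = "s1\<lparr>rvar := (rvar s1)(''e'' := 1)\<rparr>"
    have F1: "?F ?s1" using 3(1) unfolding frame_def by auto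
    have p1: "\<And>m. m < n \<Longrightarrow> iarr ?s1 ''p'' m = m" using 3(2) by auto
    have "wp init_heights (wp one_side (wp reverse_perm (wp (RAssign ''e'' (RConst (- 1))) (wp one_side
    (wp select (wp (RAssign ''w'' (RArr ''H'' (IVar ''k'')))
    (wp (Cond (RLess (RArr ''t'' (IVar ''k'')) (RVar ''w''))
        (RStore ''v'' (IVar ''k'') (RArr ''t'' (IVar ''k'')))
        (RStore ''v'' (IVar ''k'') (RVar ''w'')))
    (wp (RAssign ''h'' (Minus (RVar ''w'') (RArr ''v'' (IVar ''k''))))
    (wp fill (wp identity_perm (wp (RAssign ''e'' (RConst 1)) (wp fill ?Q)))))))))))) (u1 - 2) ?s1"
    proof (rule wp_init_heights[where n = n and r = "2800 * int n"], goal_cases)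
      case (4 u2 s2)
      have F2: "?F s2" by (rule frame_trans[OF F1 4(1)]) auto
      have s2: "iarr s2 ''p'' = iarr ?s1 ''p''" "rvar s2 ''e'' = 1"
        using frameD(2,3)[OF 4(1)] by simp_all
      have H2: "\<And>m. m < n \<Longrightarrow> rarr s2 ''H'' m = b m" using 4(2) keep(3)[OF F1] by simp
      show ?case
      proof (rule wp_one_side[where n = n and r = "1700 * int n"], goal_cases)
        case (8 u3 s3)
        have F3: "?F s3" by (rule frame_trans[OF F2 8(1)]) auto
        have H3: "sided_max x b t n m (b m) (rarr s3 ''H'' m)" if m: "m < n" for m
        proof (rule sided_max_cong)
          show "sided_max (\<lambda>m. rvar s2 ''e'' * rarr s2 ''x'' (iarr s2 ''p'' m))
            (\<lambda>m. rarr s2 ''b'' (iarr s2 ''p'' m)) (\<lambda>m. rarr s2 ''t'' (iarr s2 ''p'' m)) n m (b m) (rarr s3 ''H'' m)"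
            using 8(2) m p1[OF m] H2[OF m] unfolding s2(1) by auto
          show "rvar s2 ''e'' * rarr s2 ''x'' (iarr s2 ''p'' i) = x i \<and> rarr s2 ''b'' (iarr s2 ''p'' i) = b i \<and>
              rarr s2 ''t'' (iarr s2 ''p'' i) = t i" if "i < n" for i
            using that keep(2-4)[OF F2] p1[OF that] unfolding s2 by simp
        qed (rule m)
        show ?case
        proof (rule wp_reverse_perm[where n = n and r = "1600 * int n"], goal_cases)
          case (4 u4 s4)
          let ?s4 = "s4\<lparr>rvar := (rvar s4)(''e'' := - 1)\<rparr>"
          have F4': "?F s4" by (rule frame_trans[OF F3 4(1)]) auto
          then have F4: "?F ?s4" unfolding frame_def by auto
          have H4: "rarr ?s4 ''H'' = rarr s3 ''H''" using frameD(4)[OF 4(1)] by simp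
          have p4: "\<And>m. m < n \<Longrightarrow> iarr ?s4 ''p'' m = n - Suc m" using 4(2) by auto
          have "n - Suc m < n" if "m < n" for m using that by auto
          then have b4: "rarr ?s4 ''b'' (iarr ?s4 ''p'' m) \<le> rarr ?s4 ''t'' (iarr ?s4 ''p'' m)" if "m < n" for m
            using keep(3,4)[OF F4] bt p4[OF that] that by simp
          have x4: "strict_mono_on {0..<n} (\<lambda>m. rvar ?s4 ''e'' * rarr ?s4 ''x'' (iarr ?s4 ''p'' m))"
          proof (rule monotone_onI)
            fix a c assume "a \<in> {0..<n}" "c \<in> {0..<n}" "a < c"
            then have "rarr ?s4 ''x'' (iarr ?s4 ''p'' a) = x (n - Suc a)" "rarr ?s4 ''x'' (iarr ?s4 ''p'' c) = x (n - Suc c)"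
              "x (n - Suc c) < x (n - Suc a)"
              using keep(2)[OF F4] p4[of a] p4[of c] by (auto intro!: lt)
            then show "rvar ?s4 ''e'' * rarr ?s4 ''x'' (iarr ?s4 ''p'' a) < rvar ?s4 ''e'' * rarr ?s4 ''x'' (iarr ?s4 ''p'' c)"
              by simp
          qed
          have "wp one_side (wp select (wp (RAssign ''w'' (RArr ''H'' (IVar ''k'')))
    (wp (Cond (RLess (RArr ''t'' (IVar ''k'')) (RVar ''w''))
        (RStore ''v'' (IVar ''k'') (RArr ''t'' (IVar ''k'')))
        (RStore ''v'' (IVar ''k'') (RVar ''w'')))
    (wp (RAssign ''h'' (Minus (RVar ''w'') (RArr ''v'' (IVar ''k''))))
    (wp fill (wp identity_perm (wp (RAssign ''e'' (RConst 1)) (wp fill ?Q)))))))) (u4 - 2) ?s4"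
          proof (rule wp_one_side[where n = n and r = "500 * int n"], goal_cases)
            case (8 u5 s5)
            have F5: "?F s5" by (rule frame_trans[OF F4 8(1)]) auto
            have s5: "iarr s5 ''p'' = iarr ?s4 ''p''" "rvar s5 ''e'' = - 1"
              using frameD(2,3)[OF 8(1)] by simp_all
            have H5: "tower_bound x b t n k (rarr s5 ''H'' k)" if k: "k < n" for k
            proof (rule tower_boundI[OF H3[OF k] _ k bt[OF k]])
              have k': "n - Suc k < n" "n - Suc (n - Suc k) = k" using k by auto
              show "sided_max (\<lambda>m. - x (n - Suc m)) (\<lambda>m. b (n - Suc m)) (\<lambda>m. t (n - Suc m)) n (n - Suc k)
                (rarr s3 ''H'' k) (rarr s5 ''H'' k)"
              proof (rule sided_max_cong)
                show "sided_max (\<lambda>m. rvar ?s4 ''e'' * rarr ?s4 ''x'' (iarr ?s4 ''p'' m))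
                    (\<lambda>m. rarr ?s4 ''b'' (iarr ?s4 ''p'' m)) (\<lambda>m. rarr ?s4 ''t'' (iarr ?s4 ''p'' m)) n (n - Suc k)
                    (rarr s3 ''H'' k) (rarr s5 ''H'' k)"
                  using 8(2)[rule_format, OF k'(1)] unfolding p4[OF k'(1)] k'(2) H4 .
                show "rvar ?s4 ''e'' * rarr ?s4 ''x'' (iarr ?s4 ''p'' i) = - x (n - Suc i) \<and>
                    rarr ?s4 ''b'' (iarr ?s4 ''p'' i) = b (n - Suc i) \<and>
                    rarr ?s4 ''t'' (iarr ?s4 ''p'' i) = t (n - Suc i)" if "i < n" for i
                  using keep(2-4)[OF F4, of "n - Suc i"] p4[OF that] that by simp
              qed (rule k')
            qed
            show ?case
            proof (rule wp_select[where n = n and r = "400 * int n"], goal_cases)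
              case (5 u6 s6)
              have F6: "?F s6" by (rule frame_trans[OF F5 5(1)]) auto
              define H k where "H = rarr s6 ''H''" and "k = ivar s6 ''k''"
              have kn: "k < n" using 5(2) unfolding k_def .
              have s6: "iarr s6 ''p'' = iarr ?s4 ''p''" "rvar s6 ''e'' = - 1" "rarr s5 ''H'' = H"
                using frameD(2,3,4)[OF 5(1)] s5 by (simp_all add: H_def)
              have least: "H k - t k \<le> H m - t m" if "m < n" for m
                using 5(3)[rule_format, OF that] keep(4)[OF F5] that kn unfolding s6(3) k_def[symmetric] by simp
              define vk where "vk = min (t k) (H k)"
              \<comment> \<open>Both branches that store the base height lead here, since each
                stores \<open>min (t k) (H k)\<close>; the two fills are therefore analysed only
                once.\<close>
              let ?s7 = "s6\<lparr>rarr := (rarr s6)(''v'' := (rarr s6 ''v'')(k := vk)),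
                rvar := (rvar s6)(''w'' := H k, ''h'' := H k - vk)\<rparr>"
              have F7: "?F ?s7" using F6 unfolding frame_def by auto
              let ?Y = "\<lambda>m. - 1 * (x (n - Suc m) - x k)"
              have "wp fill (wp identity_perm (wp (RAssign ''e'' (RConst 1)) (wp fill ?Q))) u ?s7"
                if u: "380 * int n \<le> u" for u
              proof (rule wp_fill[where n = n and r = "300 * int n" and Y = ?Y and B = "\<lambda>m. b (n - Suc m)"], goal_cases)
                case (7 u8 s8)
                have F8: "?F s8" by (rule frame_trans[OF F7 7(1)]) auto
                have s8: "ivar s8 ''k'' = k" "rvar s8 ''w'' = H k" "rvar s8 ''h'' = H k - vk"
                  using frameD(1,2)[OF 7(1)] by (simp_all add: k_def)
                have v8: "rarr s8 ''v'' (n - Suc m) = (if 0 < ?Y m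
                    then H k + Max ((\<lambda>m. (b (n - Suc m) - H k) / ?Y m) ` {m'. m' < Suc m \<and> 0 < ?Y m'}) * ?Y m
                    else rarr ?s7 ''v'' (n - Suc m))" if m: "m < n" for m
                  using 7(2)[rule_format, OF m] p4[OF m] by (simp add: s6(1))
                have left: "rarr s8 ''v'' i = H k + fan_slope x b k (H k) i * \<bar>x i - x k\<bar>" if i: "i < k" for i
                proof -
                  have i': "n - Suc i < n" "n - Suc (n - Suc i) = i" using i kn by auto
                  show ?thesis
                    using v8[OF i'(1)] fan_slope_left[OF x kn i, of b "H k"] lt[OF i kn] unfolding i'(2) by simp
                qed
                have k': "n - Suc k < n" "n - Suc (n - Suc k) = k" using kn by auto
                have mid: "rarr s8 ''v'' k = vk"
                  using v8[OF k'(1)] unfolding k'(2) by simp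
                show ?case
                proof (rule wp_identity_perm[where n = n and r = "200 * int n"], goal_cases)
                  case (4 u9 s9)
                  let ?s9 = "s9\<lparr>rvar := (rvar s9)(''e'' := 1)\<rparr>"
                  have F9': "?F s9" by (rule frame_trans[OF F8 4(1)]) auto
                  then have F9: "?F ?s9" unfolding frame_def by auto
                  have s9: "ivar ?s9 ''k'' = k" "rvar ?s9 ''w'' = H k" "rvar ?s9 ''h'' = H k - vk"
                    "rarr ?s9 ''v'' = rarr s8 ''v''" "rvar ?s9 ''e'' = 1"
                    using frameD(1,2,4)[OF 4(1)] s8 by simp_all
                  have p9: "\<And>m. m < n \<Longrightarrow> iarr ?s9 ''p'' m = m" using 4(2) by auto
                  have "wp fill ?Q (u9 - 2) ?s9"
                  proof (rule wp_fill[where n = n and r = 0 and Y = "\<lambda>m. x m - x k" and B = b], goal_cases)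
                    case (7 u10 s10)
                    have s10: "ivar s10 ''k'' = k" "rvar s10 ''w'' = H k" "rvar s10 ''h'' = H k - vk"
                      using frameD(1,2)[OF 7(1)] s9 by simp_all
                    have v10: "rarr s10 ''v'' m = (if 0 < x m - x k
                        then H k + Max ((\<lambda>m. (b m - H k) / (x m - x k)) ` {m'. m' < Suc m \<and> 0 < x m' - x k}) * (x m - x k)
                        else rarr s8 ''v'' m)" if m: "m < n" for m
                      using 7(2)[rule_format, OF m] unfolding p9[OF m] s9(2,4) .
                    have "rarr s10 ''v'' i = H k + fan_slope x b k (H k) i * \<bar>x i - x k\<bar>"
                      if i: "i < n" "i \<noteq> k" for i
                    proof (cases "k < i")
                      case True
                      then show ?thesis
                        using v10[OF i(1)] lt[OF True i(1)] unfolding fan_slope_right[OF x i(1) True] by simp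
                    next
                      case False
                      then have ik: "i < k" using i by simp
                      then show ?thesis using v10[OF i(1)] lt[OF ik kn] left[OF ik] by simp
                    qed
                    moreover have vk: "rarr s10 ''v'' k = min (t k) (H k)"
                      using v10[OF kn] mid by (simp add: vk_def)
                    ultimately have "optimistic_shortest_discrete_watchtower n x b t (rarr s10 ''v'')
                        (x k, rarr s10 ''v'' k) (x k, H k)"
                      using fan_optimal[OF T H5[unfolded s6(3)] kn least] by blast
                    then show ?case
                      using 7(3) kn vk unfolding solved_def Let_def s10
                      by (simp add: dist_Pair_Pair dist_real_def vk_def)
                  next
                    case (1 m)
                    then show ?case using keep(2)[OF F9] kn p9[OF 1] unfolding s9(1,5) by simp
                  next
                    case (2 m)
                    then show ?case using keep(3)[OF F9] p9[OF 2] by simp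
                  qed (use keep(1)[OF F9] p9 4(3) n in \<open>auto simp: inj_on_def\<close>)
                  then show ?case by simp
                qed (use keep(1)[OF F8] 7(3) n in auto)
              next
                case (1 m)
                then show ?case using keep(2)[OF F7, of "n - Suc m"] keep(2)[OF F7, of k] kn p4[OF 1]
                  by (simp add: s6(1,2) k_def)
              next
                case (2 m)
                then show ?case using keep(3)[OF F7, of "n - Suc m"] p4[OF 2] by (simp add: s6(1))
              qed (use keep(1)[OF F7] p4 u n in \<open>auto simp: inj_on_def s6\<close>)
              note fills = this
              show ?case
              proof (cases "t k < H k")
                case True
                then have "vk = t k" by (simp add: vk_def)
                then show ?thesis
                  using True fills 5(4) n keep(4)[OF F6 kn] by (simp add: H_def[symmetric] k_def[symmetric])
              next
                case False
                then have "vk = H k" by (simp add: vk_def)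
                then show ?thesis
                  using False fills 5(4) n keep(4)[OF F6 kn] by (simp add: H_def[symmetric] k_def[symmetric])
              qed
            qed (use keep(1)[OF F5] 8(3) n in auto)
          next
            case 1
            show ?case by (rule x4)
          next
            case (2 m)
            then show ?case by (rule b4)
          qed (use keep(1)[OF F4] 4(3) n p4 in \<open>auto simp: inj_on_def\<close>)
          then show ?case by simp
        qed (use keep(1)[OF F3] 8(3) n in auto)
      qed (use keep[OF F2] 4(3) n p1 lt bt in \<open>auto simp: inj_on_def s2 monotone_on_def\<close>)
    qed (use keep(1)[OF F1] 3(3) n in auto)
    then show ?case by simp
  qed (use n in auto)
  then show ?thesis unfolding s0_def .
qed

theorem mainTheorem1:
  shows "\<exists>(P :: com) (\<tau> :: nat \<Rightarrow> nat).
    (\<lambda>n. real (\<tau> n)) \<in> O(\<lambda>n. real n) \<and>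
    (\<forall>n x b t. imprecise_terrain n x b t \<longrightarrow>
      (\<exists>T s. exec P (input_state n x b t) T s \<and> T \<le> \<tau> n \<and> solved n x b t s))"
proof (rule exI[of _ watchtower_program], rule exI[of _ "\<lambda>n. 3000 * n"], intro conjI allI impI)
  show "(\<lambda>n. real (3000 * n)) \<in> O(\<lambda>n. real n)" by simp
  fix n x b t assume "imprecise_terrain n x b t"
  then obtain T s where "exec watchtower_program (input_state n x b t) T s"
    "0 \<le> 3000 * int n - int T" "solved n x b t s"
    using wp_watchtower_program unfolding wp_def by blast
  moreover from this have "T \<le> 3000 * n" by linarith
  ultimately show "\<exists>T s. exec watchtower_program (input_state n x b t) T s \<and> T \<le> 3000 * n \<and> solved n x b t s"
    by blast
qed

end
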